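(* Let $N=2n$ be even, let $0<a\le 1$ and $b=2-a$, and consider the biased random transpositions walk on $S_N$ described in the context. For every $\varepsilon\in(0,1)$, its separation mixing time $T(\varepsilon)$ satisfies $$\lim_{N\to\infty}\frac{2a\,T(\varepsilon)}{N\log N}=1 .$$
   Context: Biased random transpositions walk: there are $N=2n$ cards. A fixed set of $n$ of them are called $a$-cards and have weight $p(c)=a$; the other $n$ are $b$-cards and have weight $p(c)=b$, where $0<a\le 1$ and $b=2-a$. At each step $t=1,2,\dots$ two cards $R_t$ ("right hand") and $L_t$ ("left hand") are chosen independently, each equal to a given card $c$ with probability $p(c)/N$, and the positions of $R_t$ and $L_t$ are exchanged (nothing happens if $R_t=L_t$). Starting from the identity arrangement, let $P^t$ denote the distribution on $S_N$ of the arrangement after $t$ steps. This walk has the uniform distribution on $S_N$ as stationary distribution. The separation mixing time is $T(\varepsilon)=\min\{t:\ P^t(\sigma)\ge \frac{1-\varepsilon}{N!}\ \text{for all }\sigma\in S_N\}$. *)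

theory Defs
  imports Complex_Main "HOL-Combinatorics.Permutations"
begin

text \<open>Cards are 0..N-1. An arrangement is a bijection sigma from cards to positions
  (sigma permutes {..<N}); sigma c is the position of card c. A is the set of a-cards.\<close>

definition card_weight :: "real \<Rightarrow> nat \<Rightarrow> nat set \<Rightarrow> nat \<Rightarrow> real" where
  "card_weight a N A c = (if c \<in> A then a else 2 - a) / real N"

text \<open>Exchanging the positions of cards r and l turns sigma into sigma o transpose r l
  (identity if r = l). Since transpose r l is an involution, the predecessor of sigma
  under the move (r,l) is sigma o transpose r l.\<close>

fun walk_dist :: "real \<Rightarrow> nat \<Rightarrow> nat set \<Rightarrow> nat \<Rightarrow> (nat \<Rightarrow> nat) \<Rightarrow> real" where
  "walk_dist a N A 0 \<sigma> = (if \<sigma> = id then 1 else 0)"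
| "walk_dist a N A (Suc t) \<sigma> =
     (\<Sum>r<N. \<Sum>l<N. card_weight a N A r * card_weight a N A l *
        walk_dist a N A t (\<sigma> \<circ> Transposition.transpose r l))"

definition sep_mixing_time :: "real \<Rightarrow> nat \<Rightarrow> nat set \<Rightarrow> real \<Rightarrow> nat" where
  "sep_mixing_time a N A \<epsilon> =
     (LEAST t. \<forall>\<sigma>. \<sigma> permutes {..<N} \<longrightarrow> walk_dist a N A t \<sigma> \<ge> (1 - \<epsilon>) / fact N)"

end

theory Submission
  imports Defs "HOL-Combinatorics.Orbits"
begin

text \<open>
Lower bound: at time \<open>(1 - \<eta>) N ln N / (2a)\<close> about \<open>N\<^sup>\<eta>\<close> of the \<open>a\<close>-cards have never been
touched (second moment), hence are fixed points, while a uniform permutation has few of them.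

Upper bound: say that a set \<open>M\<close> of cards is marked if, given the positions of all other cards, the
cards of \<open>M\<close> are uniformly arranged. Suppose that a large set is marked and an unmarked card \<open>x\<close> is
exchanged with a marked card \<open>c\<close>. Either \<open>x\<close> becomes marked (possible with the minimal rate among
all \<open>c\<close>, the trivial move needed for uniformity being borrowed from the exchanges of two marked
cards), or, for the excess rate of the \<open>b\<close>-cards \<open>c\<close>, the cards \<open>x\<close> and \<open>c\<close> swap roles: \<open>x\<close> is marked
and \<open>c\<close> is not. An unmarked \<open>a\<close>-card thus disappears at rate \<open>2a/N\<close> and an unmarked \<open>b\<close>-card at
rate \<open>2ab/N \<ge> 2a/N\<close>, so all cards are marked at time \<open>(1 + \<eta>) N ln N / (2a)\<close>.

It remains to mark a positive fraction of the cards within \<open>o(N ln N)\<close> steps. The walk contains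
uniform transpositions, which are central and so can be used separately. In \<open>2N\<close> uniform
transpositions a cycle of linear length appears, since otherwise the number of cycles would become
negative; by conjugation invariance it is a uniform cycle on its support. Two such cycles with
overlap \<open>Y\<close> contain a product of two independent uniform cycles on \<open>Y\<close>, which has at least half of the
uniform density on the even permutations of \<open>Y\<close>, and a move that picks one card twice adjusts
the parity. Each such attempt succeeds with probability bounded below.
\<close>

section \<open>Operators on functions of arrangements\<close>

text \<open>No random sets of marked cards and no stopping times are constructed. A function
  \<open>f\<close> of the arrangement is pulled back through the walk, so the last phase is treated
  first, and \<open>M\<close> being marked at \<open>g\<close> means that \<open>f\<close> enters
  only through its average over \<open>g \<circ> h\<close>, with \<open>h\<close> permuting
  \<open>M\<close>. Marking rules are inequalities between such averages, uniform in
  \<open>g\<close>; pointwise lower bounds are what separation asks for, and they survive discarding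
  unfavourable outcomes.

  Marking cannot start from nothing. Uniformity of \<open>x\<close> among \<open>insert x M\<close>
  needs one outcome without motion, which must be paid for by exchanges inside \<open>M\<close>;
  this is possible only if the squared weight of \<open>M\<close> is at least
  \<open>2 * \<alpha>\<close> times the weight of the other cards, where \<open>\<alpha>\<close> is
  the minimal weight. Moreover the rate of marking grows with the size of \<open>M\<close>. Hence
  the separate construction of a first block, whose obstacle is parity: a product of two cycles with
  equal support is always even. The success probability of one attempt may be tiny, since a small
  fraction of \<open>N ln N\<close> steps leaves room for ever more attempts.\<close>

abbreviation exch :: "nat \<Rightarrow> nat \<Rightarrow> nat \<Rightarrow> nat" where
  "exch \<equiv> Transposition.transpose"

text \<open>The weights need not have total mass 1, so that a part of a walk, such as the moves with
  two different cards, is an operator of the same kind.\<close>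

definition move_op :: "(nat \<Rightarrow> nat \<Rightarrow> real) \<Rightarrow> nat \<Rightarrow> ((nat \<Rightarrow> nat) \<Rightarrow> real) \<Rightarrow> (nat \<Rightarrow> nat) \<Rightarrow> real" where
  "move_op q N f g = (\<Sum>r<N. \<Sum>l<N. q r l * f (g \<circ> exch r l))"

text \<open>For \<open>S\<close> the permutations of \<open>M\<close>, this is the value of
  \<open>f\<close> when the cards of \<open>M\<close> are uniformly arranged over the positions that
  \<open>g\<close> gives them and all other cards sit as in \<open>g\<close>.\<close>

definition right_avg :: "(nat \<Rightarrow> nat) set \<Rightarrow> ((nat \<Rightarrow> nat) \<Rightarrow> real) \<Rightarrow> (nat \<Rightarrow> nat) \<Rightarrow> real" where
  "right_avg S f g = (\<Sum>h\<in>S. f (g \<circ> h)) / real (card S)"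

lemma exch_permutes: "r < N \<Longrightarrow> l < N \<Longrightarrow> exch r l permutes {..<N}"
  by (simp add: permutes_swap_id)

lemma comp_exch_permutes:
  "g permutes {..<N} \<Longrightarrow> r < N \<Longrightarrow> l < N \<Longrightarrow> g \<circ> exch r l permutes {..<N}"
  by (simp add: permutes_compose permutes_swap_id)

section \<open>Monotonicity, linearity and left invariance\<close>

lemma move_op_mono:
  assumes "\<And>r l. q r l \<ge> 0" "\<And>g. g permutes {..<N} \<Longrightarrow> f g \<le> h g" "g permutes {..<N}"
  shows "move_op q N f g \<le> move_op q N h g"
  unfolding move_op_def
  using assms by (intro sum_mono mult_left_mono) (auto simp: comp_exch_permutes)


lemma funpow_move_op_mono:
  assumes "\<And>r l. q r l \<ge> 0" "\<And>g. g permutes {..<N} \<Longrightarrow> f g \<le> h g" "g permutes {..<N}"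
  shows "(move_op q N ^^ t) f g \<le> (move_op q N ^^ t) h g"
  using assms(3)
proof (induction t arbitrary: g)
  case 0
  then show ?case using assms(2) by simp
next
  case (Suc t)
  then show ?case using assms(1) by (auto intro: move_op_mono)
qed


lemma move_op_const: "move_op q N (\<lambda>_. c) = (\<lambda>_. (\<Sum>r<N. \<Sum>l<N. q r l) * c)"
  by (simp add: fun_eq_iff move_op_def sum_distrib_right)

lemma move_op_diff: "move_op q N (\<lambda>g. f g - h g) = (\<lambda>g. move_op q N f g - move_op q N h g)"
  by (simp add: fun_eq_iff move_op_def sum_subtractf right_diff_distrib)

lemma move_op_add: "move_op q N (\<lambda>g. f g + h g) = (\<lambda>g. move_op q N f g + move_op q N h g)"
  by (simp add: fun_eq_iff move_op_def sum.distrib distrib_left)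

lemma move_op_cmult: "move_op q N (\<lambda>g. c * f g) = (\<lambda>g. c * move_op q N f g)"
  by (simp add: fun_eq_iff move_op_def sum_distrib_left mult.left_commute)

lemma funpow_move_op_const:
  assumes "(\<Sum>r<N. \<Sum>l<N. q r l) = 1"
  shows "(move_op q N ^^ t) (\<lambda>_. c) = (\<lambda>_. c)"
  by (induction t) (simp_all add: move_op_const assms)

lemma funpow_move_op_add:
  "(move_op q N ^^ t) (\<lambda>g. f g + h g) = (\<lambda>g. (move_op q N ^^ t) f g + (move_op q N ^^ t) h g)"
  by (induction t) (simp_all add: move_op_add)

lemma funpow_move_op_diff:
  "(move_op q N ^^ t) (\<lambda>g. f g - h g) = (\<lambda>g. (move_op q N ^^ t) f g - (move_op q N ^^ t) h g)"
  by (induction t) (simp_all add: move_op_diff)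

lemma funpow_move_op_cmult:
  "(move_op q N ^^ t) (\<lambda>g. c * f g) = (\<lambda>g. c * (move_op q N ^^ t) f g)"
  by (induction t) (simp_all add: move_op_cmult)

lemma funpow_move_op_sum:
  "finite I \<Longrightarrow> (move_op q N ^^ t) (\<lambda>g. \<Sum>i\<in>I. F i g) = (\<lambda>g. \<Sum>i\<in>I. (move_op q N ^^ t) (F i) g)"
proof (induction I rule: finite_induct)
  case empty
  have "(move_op q N ^^ t) (\<lambda>g. 0) = (\<lambda>g. 0)"
    by (induction t) (simp_all add: move_op_const)
  then show ?case by simp
next
  case (insert x F)
  then show ?case by (simp add: funpow_move_op_add)
qed

lemma funpow_move_op_ge_const:
  assumes "\<And>r l. q r l \<ge> 0" "(\<Sum>r<N. \<Sum>l<N. q r l) = 1"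
    and "\<And>g. g permutes {..<N} \<Longrightarrow> f g \<ge> c" "g permutes {..<N}"
  shows "(move_op q N ^^ t) f g \<ge> c"
proof -
  have "(move_op q N ^^ t) (\<lambda>_. c) g \<le> (move_op q N ^^ t) f g"
    by (rule funpow_move_op_mono) (use assms in auto)
  then show ?thesis by (simp add: funpow_move_op_const assms(2))
qed

text \<open>Composition on the left relabels positions, while the moves act on cards from the right;
  the two commute whatever the weights are.\<close>

lemma move_op_left: "move_op q N (\<lambda>g. f (k \<circ> g)) = (\<lambda>g. move_op q N f (k \<circ> g))"
  by (simp add: fun_eq_iff move_op_def comp_assoc)

lemma funpow_move_op_left:
  "(move_op q N ^^ t) (\<lambda>g. f (k \<circ> g)) = (\<lambda>g. (move_op q N ^^ t) f (k \<circ> g))"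
  proof (induction t)
  case (Suc t)
  show ?case unfolding funpow.simps(2) comp_apply[of "move_op q N" "move_op q N ^^ t"] Suc move_op_left ..
qed simp

text \<open>Every move is an involution, so \<open>g \<mapsto> g \<circ> exch r l\<close> carries
  one sum into the other: counting measure is reversible for arbitrary weights.\<close>

lemma move_op_self_adjoint:
  "(\<Sum>g | g permutes {..<N}. move_op q N f g * h g) = (\<Sum>g | g permutes {..<N}. f g * move_op q N h g)"
proof -
  let ?G = "{g. g permutes {..<N}}"
  have *: "(\<Sum>g\<in>?G. f (g \<circ> exch r l) * h g) = (\<Sum>g\<in>?G. f g * h (g \<circ> exch r l))"
    if "r < N" "l < N" for r l
    by (rule sum.reindex_bij_witness[of _ "\<lambda>g. g \<circ> exch r l" "\<lambda>g. g \<circ> exch r l"])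
       (use that in \<open>auto simp: comp_exch_permutes comp_assoc\<close>)
  have "(\<Sum>g\<in>?G. move_op q N f g * h g)
      = (\<Sum>g\<in>?G. \<Sum>r<N. \<Sum>l<N. q r l * (f (g \<circ> exch r l) * h g))"
    by (simp add: move_op_def sum_distrib_right mult.assoc)
  also have "\<dots> = (\<Sum>r<N. \<Sum>l<N. q r l * (\<Sum>g\<in>?G. f (g \<circ> exch r l) * h g))"
    by (subst sum.swap, rule sum.cong[OF refl], subst sum.swap) (simp add: sum_distrib_left)
  also have "\<dots> = (\<Sum>r<N. \<Sum>l<N. q r l * (\<Sum>g\<in>?G. f g * h (g \<circ> exch r l)))"
    using * by (intro sum.cong refl) auto
  also have "\<dots> = (\<Sum>g\<in>?G. \<Sum>r<N. \<Sum>l<N. q r l * (f g * h (g \<circ> exch r l)))"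
    by (rule sym, subst sum.swap, rule sum.cong[OF refl], subst sum.swap) (simp add: sum_distrib_left)
  also have "\<dots> = (\<Sum>g\<in>?G. f g * move_op q N h g)"
    by (simp add: move_op_def sum_distrib_left mult.left_commute)
  finally show ?thesis .
qed

lemma funpow_move_op_self_adjoint:
  "(\<Sum>g | g permutes {..<N}. (move_op q N ^^ t) f g * h g)
     = (\<Sum>g | g permutes {..<N}. f g * (move_op q N ^^ t) h g)"
proof (induction t arbitrary: h)
  case 0
  then show ?case by simp
next
  case (Suc t)
  show ?case
    using Suc[of "move_op q N h"] by (simp add: move_op_self_adjoint funpow_swap1[of _ t h])
qed

section \<open>Laws of the walk as convolution kernels\<close>

definition point_mass :: "(nat \<Rightarrow> nat) \<Rightarrow> (nat \<Rightarrow> nat) \<Rightarrow> real" where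
  "point_mass \<sigma> g = (if g = \<sigma> then 1 else 0)"

lemma sum_point_mass:
  "\<sigma> permutes {..<N} \<Longrightarrow> (\<Sum>g | g permutes {..<N}. point_mass \<sigma> g * f g) = f \<sigma>"
  by (simp add: point_mass_def if_distrib[of "\<lambda>x. x * _"] sum.delta finite_permutations cong: if_cong)

text \<open>Self-adjointness moves the iterate from the point mass to \<open>f\<close>, and left
  invariance turns the value at \<open>g\<close> into a value at \<open>id\<close>.\<close>

lemma funpow_move_op_kernel:
  "(move_op q N ^^ t) f g
    = (\<Sum>\<sigma> | \<sigma> permutes {..<N}. (move_op q N ^^ t) (point_mass id) \<sigma> * f (g \<circ> \<sigma>))"
  using funpow_move_op_self_adjoint[where N = N and q = q and t = t and f = "point_mass id" and h = "\<lambda>\<sigma>. f (g \<circ> \<sigma>)"]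
  by (simp add: funpow_move_op_left sum_point_mass[OF permutes_id])

text \<open>Time reversal: the probability of the target \<open>\<sigma>\<close> becomes the value
  at \<open>id\<close> of a function pulled back from \<open>\<sigma>\<close>, which is the form in
  which the phases of the upper bound compose.\<close>

lemma funpow_move_op_reverse:
  assumes "\<sigma> permutes {..<N}"
  shows "(move_op q N ^^ t) (point_mass id) \<sigma> = (move_op q N ^^ t) (point_mass \<sigma>) id"
  using funpow_move_op_self_adjoint[where N = N and q = q and t = t and f = "point_mass id" and h = "point_mass \<sigma>"]
    sum_point_mass[OF assms, of "(move_op q N ^^ t) (point_mass id)"]
  by (simp add: sum_point_mass[OF permutes_id] mult.commute)

lemma walk_dist_eq_move_op:
  "walk_dist a N A t = (move_op (\<lambda>r l. card_weight a N A r * card_weight a N A l) N ^^ t) (point_mass id)"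
  by (induction t) (auto simp: fun_eq_iff point_mass_def move_op_def)

section \<open>Uniform transpositions and their centrality\<close>

definition trans_op :: "nat \<Rightarrow> ((nat \<Rightarrow> nat) \<Rightarrow> real) \<Rightarrow> (nat \<Rightarrow> nat) \<Rightarrow> real" where
  "trans_op N = move_op (\<lambda>_ _. 1 / real N ^ 2) N"

lemma exch_comp_right: "bij h \<Longrightarrow> exch r l \<circ> h = h \<circ> exch (inv h r) (inv h l)"
  by (rule transpose_comp_eq)

text \<open>Moving \<open>h\<close> past a transposition conjugates the transposition, which merely
  permutes the pairs of cards; constant weights do not notice.\<close>

lemma trans_op_right:
  assumes "h permutes {..<N}"
  shows "trans_op N (\<lambda>g. f (g \<circ> h)) = (\<lambda>g. trans_op N f (g \<circ> h))"
proof
  fix g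
  have b: "bij_betw (inv h) {..<N} {..<N}"
    using permutes_imp_bij[OF permutes_inv[OF assms]] .
  have "(\<Sum>r<N. \<Sum>l<N. f (g \<circ> exch r l \<circ> h))
      = (\<Sum>r<N. \<Sum>l<N. f (g \<circ> h \<circ> exch (inv h r) (inv h l)))"
    by (simp add: comp_assoc exch_comp_right[OF permutes_bij[OF assms]])
  also have "\<dots> = (\<Sum>r<N. \<Sum>l<N. f (g \<circ> h \<circ> exch r l))"
    by (subst sum.reindex_bij_betw[OF b, symmetric],
        subst (2) sum.reindex_bij_betw[OF b, symmetric]) simp
  finally show "trans_op N (\<lambda>g. f (g \<circ> h)) g = trans_op N f (g \<circ> h)"
    by (simp add: trans_op_def move_op_def comp_assoc flip: sum_divide_distrib)
qed

lemma funpow_trans_op_right: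
  assumes "h permutes {..<N}"
  shows "(trans_op N ^^ t) (\<lambda>g. f (g \<circ> h)) = (\<lambda>g. (trans_op N ^^ t) f (g \<circ> h))"
  proof (induction t)
  case (Suc t)
  show ?case unfolding funpow.simps(2) comp_apply[of "trans_op N" "trans_op N ^^ t"] Suc trans_op_right[OF assms] ..
qed simp

lemma funpow_trans_op_right_sum:
  assumes "finite S" "\<And>h. h \<in> S \<Longrightarrow> h permutes {..<N}"
  shows "(trans_op N ^^ t) (\<lambda>g. c * (\<Sum>h\<in>S. f (g \<circ> h))) = (\<lambda>g. c * (\<Sum>h\<in>S. (trans_op N ^^ t) f (g \<circ> h)))"
  unfolding trans_op_def funpow_move_op_cmult funpow_move_op_sum[OF assms(1)]
  using funpow_trans_op_right[of _ N t f] assms(2) by (simp add: trans_op_def)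

lemma funpow_trans_op_right_avg:
  assumes "finite S" "\<And>h. h \<in> S \<Longrightarrow> h permutes {..<N}"
  shows "(trans_op N ^^ t) (right_avg S f) = right_avg S ((trans_op N ^^ t) f)"
  using funpow_trans_op_right_sum[OF assms, where c = "1 / real (card S)"]
  by (simp add: right_avg_def[abs_def])

text \<open>Any move operator is a combination of right translations, and each of them passes
  through uniform transpositions. This allows the uniform part of the biased walk to be collected on
  one side.\<close>

lemma trans_op_move_op_commute:
  "(trans_op N ^^ t) (move_op q N f) g = move_op q N ((trans_op N ^^ t) f) g"
proof -
  have "(trans_op N ^^ t) (move_op q N f)
      = (trans_op N ^^ t) (\<lambda>g. \<Sum>r<N. \<Sum>l<N. q r l * f (g \<circ> exch r l))"
    by (simp add: move_op_def[abs_def])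
  also have "\<dots> = (\<lambda>g. \<Sum>r<N. \<Sum>l<N. q r l * (trans_op N ^^ t) (\<lambda>g. f (g \<circ> exch r l)) g)"
    by (simp add: trans_op_def funpow_move_op_sum funpow_move_op_cmult)
  also have "\<dots> = (\<lambda>g. \<Sum>r<N. \<Sum>l<N. q r l * (trans_op N ^^ t) f (g \<circ> exch r l))"
    by (intro ext sum.cong refl) (simp add: funpow_trans_op_right exch_permutes)
  finally show ?thesis by (simp add: move_op_def)
qed

lemma right_avg_ge_const:
  assumes "finite S" "S \<noteq> {}" "\<And>h. h \<in> S \<Longrightarrow> f (g \<circ> h) \<ge> c"
  shows "right_avg S f g \<ge> c"
proof -
  have "(\<Sum>h\<in>S. c) \<le> (\<Sum>h\<in>S. f (g \<circ> h))"
    by (intro sum_mono assms)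
  moreover have "real (card S) > 0" using assms by (simp add: card_gt_0_iff)
  ultimately show ?thesis by (simp add: right_avg_def field_simps)
qed

section \<open>Cycles on a set\<close>

definition cycles_on :: "nat set \<Rightarrow> (nat \<Rightarrow> nat) set" where
  "cycles_on V = {c. c permutes V \<and> cyclic_on c V}"

text \<open>With cycles described by the absence of proper invariant subsets, inserting or removing
  a point only requires adding it to or deleting it from an invariant set, with no induction along
  orbits.\<close>

lemma cyclic_on_iff_irreducible:
  assumes "c permutes V" "finite V"
  shows "cyclic_on c V \<longleftrightarrow> V \<noteq> {} \<and> (\<forall>X. X \<subseteq> V \<longrightarrow> X \<noteq> {} \<longrightarrow> c ` X \<subseteq> X \<longrightarrow> X = V)"
    (is "_ \<longleftrightarrow> ?R")
proof
  assume cyc: "cyclic_on c V"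
  show ?R
  proof (intro conjI allI impI)
    show "V \<noteq> {}" using cyc by (auto simp: cyclic_on_def)
    fix X assume X: "X \<subseteq> V" "X \<noteq> {}" "c ` X \<subseteq> X"
    then obtain x where x: "x \<in> X" by blast
    have "orbit c x \<subseteq> X"
    proof
      fix y assume "y \<in> orbit c x"
      then show "y \<in> X" by induction (use x X in auto)
    qed
    then show "X = V" using orbit_cyclic_eq3[OF cyc, of x] x X by blast
  qed
next
  assume R: ?R
  then obtain x where x: "x \<in> V" by blast
  have "c ` orbit c x \<subseteq> orbit c x" by (auto intro: orbit.intros)
  moreover have "orbit c x \<subseteq> V" by (rule permutes_orbit_subset[OF assms(1) x])
  ultimately have "orbit c x = V" using R orbit_nonempty[of c x] by blast
  with x show "cyclic_on c V" by (auto simp: cyclic_on_def)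
qed

lemma cycles_onD:
  assumes "c \<in> cycles_on V"
  shows "c permutes V" "V \<noteq> {}"
  using assms by (auto simp: cycles_on_def cyclic_on_def)

lemma cycles_on_irreducible:
  assumes "c \<in> cycles_on V" "finite V" "X \<subseteq> V" "X \<noteq> {}" "c ` X \<subseteq> X"
  shows "X = V"
  using assms cyclic_on_iff_irreducible[OF cycles_onD(1)[OF assms(1)] assms(2)]
  unfolding cycles_on_def by blast

lemma cycles_onI:
  assumes "c permutes V" "finite V" "V \<noteq> {}"
    and "\<And>X. X \<subseteq> V \<Longrightarrow> X \<noteq> {} \<Longrightarrow> c ` X \<subseteq> X \<Longrightarrow> X = V"
  shows "c \<in> cycles_on V"
  using assms cyclic_on_iff_irreducible[OF assms(1,2)] unfolding cycles_on_def by blast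

lemma finite_cycles_on: "finite V \<Longrightarrow> finite (cycles_on V)"
  by (rule finite_subset[OF _ finite_permutations]) (auto simp: cycles_on_def)

text \<open>The new permutation sends \<open>y\<close> to \<open>v\<close> and \<open>v\<close> to
  \<open>c y\<close>, so \<open>v\<close> is spliced into the cycle right behind
  \<open>y\<close>.\<close>

lemma cycles_on_insert:
  assumes "finite Z" "v \<notin> Z" "y \<in> Z" "c \<in> cycles_on Z"
  shows "c \<circ> exch y v \<in> cycles_on (insert v Z)"
proof -
  note c = cycles_onD(1)[OF assms(4)] and irr = cycles_on_irreducible[OF assms(4,1)]
  let ?d = "c \<circ> exch y v"
  have d: "?d permutes insert v Z"
    by (rule permutes_compose[OF permutes_swap_id permutes_imp_permutes_insert[OF c]]) (use assms in auto)
  have cv: "c v = v" using c assms(2) by (simp add: permutes_not_in)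
  have "X = insert v Z" if X: "X \<subseteq> insert v Z" "X \<noteq> {}" "?d ` X \<subseteq> X" for X
  proof -
    have dv: "?d v = c y" "c y \<in> Z" "?d y = v"
      using cv assms(3) permutes_in_image[OF c, of y] by simp_all
    have inv: "?d x \<in> X" if "x \<in> X" for x using X(3) that by (auto simp only: image_subset_iff)
    have "c ` (X - {v}) \<subseteq> X - {v}"
    proof
      fix w assume "w \<in> c ` (X - {v})"
      then obtain x where x: "x \<in> X" "x \<noteq> v" "w = c x" by blast
      have xZ: "x \<in> Z" using x X by blast
      have "w \<in> Z" using x xZ permutes_in_image[OF c] by blast
      moreover have "w \<in> X"
      proof (cases "x = y")
        case True
        then have "v \<in> X" using inv[OF x(1)] dv(3) by simp
        then show ?thesis using inv[of v] x True dv(1) by simp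
      next
        case False
        then show ?thesis using inv[OF x(1)] x by simp
      qed
      ultimately show "w \<in> X - {v}" using assms(2) by blast
    qed
    moreover have "X - {v} \<noteq> {}"
    proof
      assume "X - {v} = {}"
      then have "X = {v}" using X by blast
      then show False using inv[of v] dv(1,2) assms(2) by simp
    qed
    ultimately have XZ: "X - {v} = Z" using irr[of "X - {v}"] X by blast
    then have "y \<in> X" using assms(3) by blast
    then have "v \<in> X" using inv[of y] dv(3) by simp
    then show ?thesis using XZ by blast
  qed
  then show ?thesis using assms by (intro cycles_onI[OF d]) auto
qed

text \<open>Inverse of the splicing: the predecessor \<open>y\<close> of \<open>v\<close> is sent
  directly to \<open>d v\<close>.\<close>

lemma cycles_on_remove:
  assumes "finite Z" "v \<notin> Z" "y \<in> Z" "d \<in> cycles_on (insert v Z)" "d y = v"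
  shows "d \<circ> exch y v \<in> cycles_on Z"
proof -
  let ?c = "d \<circ> exch y v"
  note d = cycles_onD(1)[OF assms(4)]
  have irr: "X = insert v Z" if "X \<subseteq> insert v Z" "X \<noteq> {}" "d ` X \<subseteq> X" for X
    using cycles_on_irreducible[OF assms(4)] that assms(1) by blast
  have c': "?c permutes insert v Z"
    using assms d by (auto intro!: permutes_compose permutes_swap_id)
  have c: "?c permutes Z"
    using assms by (intro permutes_superset[OF c']) auto
  have "X = Z" if X: "X \<subseteq> Z" "X \<noteq> {}" "?c ` X \<subseteq> X" for X
  proof (cases "y \<in> X")
    case True
    have "d ` insert v X \<subseteq> insert v X"
    proof
      fix w assume "w \<in> d ` insert v X"
      then consider "w = d v" | x where "x \<in> X" "w = d x" by blast
      then show "w \<in> insert v X"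
      proof cases
        case 1
        then have "w = ?c y" by simp
        then show ?thesis using X(3) True by blast
      next
        case 2
        show ?thesis
        proof (cases "x = y")
          case False
          then have "w = ?c x" using 2 X assms by (metis comp_apply subsetD transpose_apply_other)
          then show ?thesis using X(3) 2 by blast
        qed (use 2 assms in auto)
      qed
    qed
    then have "insert v X = insert v Z" using irr[of "insert v X"] X(1) by blast
    then show ?thesis using X(1) assms(2) by (metis insert_ident subsetD)
  next
    case False
    have "d x = ?c x" if "x \<in> X" for x
      using that False X(1) assms(2) by (metis comp_apply subsetD transpose_apply_other)
    then have "d ` X = ?c ` X" by (rule image_cong[OF refl])
    then have "d ` X \<subseteq> X" using X(3) by simp
    then have "X = insert v Z" using irr[of X] X(1,2) by blast
    then show ?thesis using X(1) assms(2) by blast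
  qed
  then show ?thesis using assms by (intro cycles_onI[OF c]) auto
qed

lemma cycles_on_singleton: "cycles_on {x} = {id}"
proof -
  have "id \<in> cycles_on {x}" by (rule cycles_onI) auto
  moreover have "cycles_on {x} \<subseteq> {id}" by (auto simp: cycles_on_def)
  ultimately show ?thesis by blast
qed

lemma cycles_on_no_fixpoint:
  assumes "finite Z" "Z \<noteq> {}" "v \<notin> Z" "d \<in> cycles_on (insert v Z)"
  shows "d v \<noteq> v"
proof
  assume "d v = v"
  then have "{v} = insert v Z"
    using cycles_on_irreducible[OF assms(4), of "{v}"] assms by simp
  then show False using assms by blast
qed

text \<open>A cycle through \<open>v\<close> is determined by the predecessor of \<open>v\<close>
  and by what remains when \<open>v\<close> is cut out. This recursion drives the counting, the
  conjugacy and the averaging of cycles below.\<close>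

lemma bij_betw_cycles_on_insert:
  assumes "finite Z" "Z \<noteq> {}" "v \<notin> Z"
  shows "bij_betw (\<lambda>(c, y). c \<circ> exch y v) (cycles_on Z \<times> Z) (cycles_on (insert v Z))"
proof (rule bij_betw_byWitness[where f' = "\<lambda>d. (d \<circ> exch (inv d v) v, inv d v)"])
  show "\<forall>p\<in>cycles_on Z \<times> Z.
      (\<lambda>d. (d \<circ> exch (inv d v) v, inv d v)) ((\<lambda>(c, y). c \<circ> exch y v) p) = p"
  proof
    fix p assume "p \<in> cycles_on Z \<times> Z"
    then obtain c y where p: "p = (c, y)" and cy: "c \<in> cycles_on Z" "y \<in> Z" by blast
    have "c \<circ> exch y v permutes insert v Z"
      using cycles_on_insert[OF assms(1,3) cy(2,1)] by (simp add: cycles_on_def)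
    moreover have "c v = v" using permutes_not_in[OF cycles_onD(1)[OF cy(1)]] assms by blast
    ultimately have "inv (c \<circ> exch y v) v = y" by (subst permutes_inv_eq) auto
    then show "(\<lambda>d. (d \<circ> exch (inv d v) v, inv d v)) ((\<lambda>(c, y). c \<circ> exch y v) p) = p"
      by (simp add: comp_assoc p)
  qed
  show "\<forall>d\<in>cycles_on (insert v Z).
      (\<lambda>(c, y). c \<circ> exch y v) ((\<lambda>d. (d \<circ> exch (inv d v) v, inv d v)) d) = d"
    by (simp add: comp_assoc)
  show "(\<lambda>(c, y). c \<circ> exch y v) ` (cycles_on Z \<times> Z) \<subseteq> cycles_on (insert v Z)"
    using cycles_on_insert[OF assms(1,3)] by auto
  show "(\<lambda>d. (d \<circ> exch (inv d v) v, inv d v)) ` cycles_on (insert v Z) \<subseteq> cycles_on Z \<times> Z"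
  proof safe
    fix d assume d: "d \<in> cycles_on (insert v Z)"
    then have p: "d permutes insert v Z" by (simp add: cycles_on_def)
    have "inv d v \<in> insert v Z" using permutes_in_image[OF permutes_inv[OF p]] by blast
    moreover have "inv d v \<noteq> v"
      using cycles_on_no_fixpoint[OF assms d] permutes_inv_eq[OF p] by blast
    ultimately show y: "inv d v \<in> Z" by blast
    show "d \<circ> exch (inv d v) v \<in> cycles_on Z"
      by (rule cycles_on_remove[OF assms(1,3) y d]) (simp add: permutes_inverses[OF p])
  qed
qed

lemma card_cycles_on:
  "finite V \<Longrightarrow> V \<noteq> {} \<Longrightarrow> card (cycles_on V) = fact (card V - 1)"
proof (induction V rule: finite_ne_induct)
  case (singleton x)
  then show ?case by (simp add: cycles_on_singleton)
next
  case (insert v Z)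
  have "card (cycles_on (insert v Z)) = card (cycles_on Z \<times> Z)"
    using bij_betw_same_card[OF bij_betw_cycles_on_insert[OF insert(1,2,3)]] by simp
  also have "\<dots> = fact (card Z - 1) * card Z"
    using insert by (simp add: card_cartesian_product)
  also have "\<dots> = fact (card Z)"
    using insert(1,2) by (metis card_gt_0_iff fact_reduce mult.commute of_nat_id)
  finally show ?case using insert by simp
qed

text \<open>A uniform cycle is a uniform shorter cycle followed by an independent transposition of
  \<open>v\<close> with a uniform point. Repeated use strips from a cycle the points outside a
  prescribed subset.\<close>

lemma right_avg_cycles_on_insert:
  assumes "finite Z" "Z \<noteq> {}" "v \<notin> Z"
  shows "right_avg (cycles_on (insert v Z)) f g
    = right_avg (cycles_on Z) (right_avg ((\<lambda>y. exch y v) ` Z) f) g"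
proof -
  have inj: "inj_on (\<lambda>y. exch y v) Z"
    by (rule inj_onI) (metis transpose_apply_second)
  have "(\<Sum>d\<in>cycles_on (insert v Z). f (g \<circ> d))
      = (\<Sum>(c, y)\<in>cycles_on Z \<times> Z. f (g \<circ> (c \<circ> exch y v)))"
    by (subst sum.reindex_bij_betw[OF bij_betw_cycles_on_insert[OF assms], symmetric])
       (simp add: case_prod_unfold)
  also have "\<dots> = (\<Sum>c\<in>cycles_on Z. \<Sum>y\<in>Z. f (g \<circ> c \<circ> exch y v))"
    by (simp add: sum.cartesian_product comp_assoc)
  finally have s: "(\<Sum>d\<in>cycles_on (insert v Z). f (g \<circ> d)) = \<dots>" .
  have c: "card (cycles_on (insert v Z)) = card (cycles_on Z) * card Z"
    using bij_betw_same_card[OF bij_betw_cycles_on_insert[OF assms]] by (simp add: card_cartesian_product)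
  show ?thesis
    unfolding right_avg_def s c
    by (simp add: sum.reindex[OF inj] card_image[OF inj] comp_assoc sum_divide_distrib[symmetric] mult.commute)
qed

lemma cycles_on_conj_insert_eq:
  assumes "c permutes Z" "v \<notin> Z" "y \<in> Z"
  shows "exch y v \<circ> c = c \<circ> exch (inv c y) v"
  using assms exch_comp_right[OF permutes_bij[OF assms(1)], of y v]
  by (simp add: permutes_not_in[OF permutes_inv])

text \<open>The transposition can be stripped from the left as well:
  \<open>exch y v \<circ> c\<close> equals \<open>c \<circ> exch (inv c y) v\<close>, and
  \<open>inv c\<close> only permutes \<open>Z\<close>. In a product of two cycles the surplus points
  must leave on the outer side, which is the left for the first factor and the right for the
  second.\<close>

lemma right_avg_cycles_on_insert_left:
  assumes "finite Z" "Z \<noteq> {}" "v \<notin> Z"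
  shows "right_avg (cycles_on (insert v Z)) f g
    = right_avg ((\<lambda>y. exch y v) ` Z) (right_avg (cycles_on Z) f) g"
proof -
  have inj: "inj_on (\<lambda>y. exch y v) Z"
    by (rule inj_onI) (metis transpose_apply_second)
  have "(\<Sum>y\<in>Z. f (g \<circ> c \<circ> exch y v)) = (\<Sum>y\<in>Z. f (g \<circ> exch y v \<circ> c))"
    if "c \<in> cycles_on Z" for c
  proof -
    have c: "c permutes Z" using that by (simp add: cycles_on_def)
    have "(\<Sum>y\<in>Z. f (g \<circ> exch y v \<circ> c)) = (\<Sum>y\<in>Z. f (g \<circ> c \<circ> exch (inv c y) v))"
      using cycles_on_conj_insert_eq[OF c assms(3)] by (intro sum.cong refl) (simp add: comp_assoc)
    also have "\<dots> = (\<Sum>y\<in>Z. f (g \<circ> c \<circ> exch y v))"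
      by (rule sum.reindex_bij_betw[OF permutes_imp_bij[OF permutes_inv[OF c]], of "\<lambda>y. f (g \<circ> c \<circ> exch y v)"])
    finally show ?thesis by simp
  qed
  then have "(\<Sum>c\<in>cycles_on Z. \<Sum>y\<in>Z. f (g \<circ> c \<circ> exch y v))
      = (\<Sum>y\<in>Z. \<Sum>c\<in>cycles_on Z. f (g \<circ> exch y v \<circ> c))"
    by (subst sum.swap) simp
  then show ?thesis
    unfolding right_avg_cycles_on_insert[OF assms]
    by (simp add: right_avg_def sum.reindex[OF inj] card_image[OF inj] comp_assoc
        sum_divide_distrib[symmetric] mult.commute)
qed

text \<open>A conjugation on \<open>Z\<close> extends to \<open>insert v Z\<close> once it carries
  the predecessor of \<open>v\<close> in one cycle to the predecessor in the other. Composing with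
  \<open>d'\<close> keeps it a conjugation and moves the image of \<open>y\<close> one step along
  the cycle, so every image can be reached.\<close>

lemma cycles_on_conjugate:
  assumes "finite V" "c \<in> cycles_on V" "c' \<in> cycles_on V"
  shows "\<exists>p. p permutes V \<and> p \<circ> c = c' \<circ> p"
proof -
  have "V \<noteq> {}" using assms by (auto simp: cycles_on_def cyclic_on_def)
  with assms(1) have "\<forall>c\<in>cycles_on V. \<forall>c'\<in>cycles_on V. \<exists>p. p permutes V \<and> p \<circ> c = c' \<circ> p"
  proof (induction V rule: finite_ne_induct)
    case (singleton x)
    show ?case by (auto simp: cycles_on_singleton)
  next
    case (insert v Z)
    show ?case
    proof (intro ballI)
      fix c c' assume cc: "c \<in> cycles_on (insert v Z)" "c' \<in> cycles_on (insert v Z)"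
      note surj = bij_betw_imp_surj_on[OF bij_betw_cycles_on_insert[OF insert(1,2,3)]]
      obtain d y where dy: "d \<in> cycles_on Z" "y \<in> Z" "c = d \<circ> exch y v"
        using cc(1) unfolding surj[symmetric] by auto
      obtain d' y' where dy': "d' \<in> cycles_on Z" "y' \<in> Z" "c' = d' \<circ> exch y' v"
        using cc(2) unfolding surj[symmetric] by auto
      obtain p where p: "p permutes Z" "p \<circ> d = d' \<circ> p" using insert.IH dy dy' by blast
      have d': "d' permutes Z" using dy' by (simp add: cycles_on_def)
      have conj: "q \<circ> exch x v = exch (q x) v \<circ> q" if "q permutes Z" for q x
        using exch_comp_right[OF permutes_bij[OF that], of "q x" v] insert(3)
        by (simp add: permutes_not_in[OF permutes_inv[OF that]] permutes_inverses[OF that])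
      define X where "X = {x\<in>Z. \<exists>q. q permutes Z \<and> q \<circ> d = d' \<circ> q \<and> q y = x}"
      have "p y \<in> X" using p dy by (auto simp: X_def permutes_in_image)
      moreover have "d' ` X \<subseteq> X"
      proof
        fix w assume "w \<in> d' ` X"
        then obtain q where q: "q permutes Z" "q \<circ> d = d' \<circ> q" "q y \<in> Z" "w = d' (q y)"
          by (auto simp: X_def)
        have "d' \<circ> q permutes Z" using q d' by (simp add: permutes_compose)
        moreover have "(d' \<circ> q) \<circ> d = d' \<circ> (d' \<circ> q)" using q by (simp add: comp_assoc)
        moreover have "w \<in> Z" using q d' by (simp add: permutes_in_image)
        ultimately show "w \<in> X" using q unfolding X_def by (auto intro!: exI[of _ "d' \<circ> q"])
      qed
      moreover have "X \<subseteq> Z" by (auto simp: X_def)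
      ultimately have "X = Z"
        using cycles_on_irreducible[OF dy'(1) insert(1)] by blast
      then have "y' \<in> X" using dy' by simp
      then obtain q where q: "q permutes Z" "q \<circ> d = d' \<circ> q" "q y = y'" by (auto simp: X_def)
      have "q \<circ> c = d' \<circ> (q \<circ> exch y v)" unfolding dy(3) by (metis comp_assoc q(2))
      also have "\<dots> = c' \<circ> q" unfolding conj[OF q(1)] q(3) dy'(3) by (simp add: comp_assoc)
      finally show "\<exists>p. p permutes insert v Z \<and> p \<circ> c = c' \<circ> p"
        by (intro exI[of _ q] conjI permutes_imp_permutes_insert[OF q(1)])
    qed
  qed
  from this[rule_format, OF assms(2,3)] show ?thesis .
qed

text \<open>Fix \<open>x\<close> and put \<open>y = g x\<close>. For any other \<open>v\<close>, the
  permutation \<open>exch y v \<circ> g \<circ> exch x v\<close> fixes \<open>v\<close> and is still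
  even; a solution for it on \<open>Y - {v}\<close> yields one for \<open>g\<close> by splicing
  \<open>v\<close> behind \<open>y\<close> in the first cycle and behind \<open>x\<close> in the
  second. Evenness is forced since both cycles have the same parity.\<close>

lemma card_cycle_factorisations:
  assumes "finite Y" "card Y \<ge> 2" "g permutes Y" "evenperm g"
  shows "card {c \<in> cycles_on Y. c \<circ> g \<in> cycles_on Y} \<ge> fact (card Y - 2)"
  using assms
proof (induction "card Y - 2" arbitrary: Y g)
  case 0
  then have "card Y = 2" by simp
  then obtain x y where xy: "Y = {x, y}" "x \<noteq> y" by (auto simp: card_2_iff)
  have "g = id"
    using 0 xy by (auto simp: permutes_doubleton_iff evenperm_swap)
  moreover have "id \<circ> exch y x \<in> cycles_on {x, y}"
    by (rule cycles_on_insert) (use xy in \<open>auto simp: cycles_on_singleton\<close>)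
  ultimately have "exch y x \<in> {c \<in> cycles_on Y. c \<circ> g \<in> cycles_on Y}" using xy by simp
  moreover have "finite {c \<in> cycles_on Y. c \<circ> g \<in> cycles_on Y}" using finite_cycles_on 0 by simp
  ultimately have "card {c \<in> cycles_on Y. c \<circ> g \<in> cycles_on Y} > 0" by (auto simp: card_gt_0_iff)
  moreover have "fact (card Y - 2) = (1::nat)" using \<open>card Y = 2\<close> by simp
  ultimately show ?case by linarith
next
  case (Suc k)
  then have cY: "card Y = Suc (Suc (Suc k))" by simp
  then obtain x where x: "x \<in> Y" by fastforce
  define y where "y = g x"
  have y: "y \<in> Y" using Suc x by (simp add: y_def permutes_in_image)
  define D where "D v = {c \<in> cycles_on (Y - {v}). c \<circ> (exch y v \<circ> g \<circ> exch x v) \<in> cycles_on (Y - {v})}" for v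
  define W where "W = Y - {x, y}"
  have fW: "finite W" using Suc by (simp add: W_def)
  have fY: "finite Y" using Suc by simp
  have D: "fact k \<le> card (D v)" if v: "v \<in> W" for v
  proof -
    have v': "v \<in> Y" "v \<noteq> x" "v \<noteq> y" using v by (auto simp: W_def)
    let ?h = "exch y v \<circ> g \<circ> exch x v"
    have "?h permutes Y"
      using x y v' Suc by (intro permutes_compose permutes_swap_id) auto
    then have h: "?h permutes (Y - {v})"
      by (rule permutes_superset) (auto simp: y_def[symmetric])
    have pg: "permutation g" using Suc fY permutation_permutes by blast
    have "evenperm ?h"
      using v' Suc(6) pg by (simp add: evenperm_comp permutation_compose permutation_swap_id evenperm_swap)
    have "fact (card (Y - {v}) - 2) \<le> card (D v)"
      unfolding D_def
      using Suc.prems fY v' h \<open>evenperm ?h\<close> cY by (intro Suc.hyps(1)) auto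
    then show ?thesis using v' cY by simp
  qed
  have sub: "(\<lambda>(v, c). c \<circ> exch y v) ` (SIGMA v:W. D v) \<subseteq> {c \<in> cycles_on Y. c \<circ> g \<in> cycles_on Y}"
  proof safe
    fix v c assume vc: "v \<in> W" "c \<in> D v"
    have v': "v \<in> Y" "v \<noteq> x" "v \<noteq> y" using vc by (auto simp: W_def)
    have Yv: "insert v (Y - {v}) = Y" using v' by blast
    show "c \<circ> exch y v \<in> cycles_on Y"
      using cycles_on_insert[of "Y - {v}" v y c] fY vc v' y Yv by (simp add: D_def)
    have "(c \<circ> (exch y v \<circ> g \<circ> exch x v)) \<circ> exch x v \<in> cycles_on Y"
      using cycles_on_insert[of "Y - {v}" v x "c \<circ> (exch y v \<circ> g \<circ> exch x v)"] fY vc v' x Yv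
      by (simp add: D_def)
    then show "c \<circ> exch y v \<circ> g \<in> cycles_on Y" by (simp add: comp_assoc)
  qed
  have inj: "inj_on (\<lambda>(v, c). c \<circ> exch y v) (SIGMA v:W. D v)"
  proof (rule inj_onI, safe)
    fix v c v' c'
    assume *: "v \<in> W" "c \<in> D v" "v' \<in> W" "c' \<in> D v'" "c \<circ> exch y v = c' \<circ> exch y v'"
    have "c permutes Y - {v}" "c' permutes Y - {v'}"
      using * by (auto simp: D_def dest: cycles_onD)
    then have "c v = v" "c' v' = v'" by (auto simp: permutes_not_in)
    \<comment> \<open>The lifted cycle sends \<open>y\<close> to \<open>v\<close>, so it remembers
      which \<open>v\<close> it came from.\<close>
    then show vv: "v = v'" using fun_cong[OF *(5), of y] by simp
    have "(c \<circ> exch y v') \<circ> exch y v' = (c' \<circ> exch y v') \<circ> exch y v'" using *(5) vv by simp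
    then show "c = c'" by (simp only: comp_assoc transpose_comp_involutory comp_id)
  qed
  have fD: "finite (D v)" for v using finite_cycles_on fY by (simp add: D_def)
  have "k + 1 \<le> card W"
  proof -
    have "card Y - card {x, y} \<le> card W"
      unfolding W_def by (rule diff_card_le_card_Diff) simp
    moreover have "card {x, y} \<le> 2" by (simp add: card_insert_if)
    ultimately show ?thesis using cY by simp
  qed
  then have "fact (Suc k) \<le> card W * fact k"
    using mult_le_mono1[of "Suc k" "card W" "fact k"] by simp
  also have "\<dots> \<le> (\<Sum>v\<in>W. card (D v))"
    using sum_mono[of W "\<lambda>_. fact k" "\<lambda>v. card (D v)"] D by simp
  also have "\<dots> = card (SIGMA v:W. D v)" using fW fD by (simp add: card_SigmaI)
  also have "\<dots> = card ((\<lambda>(v, c). c \<circ> exch y v) ` (SIGMA v:W. D v))"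
    by (rule card_image[OF inj, symmetric])
  also have "\<dots> \<le> card {c \<in> cycles_on Y. c \<circ> g \<in> cycles_on Y}"
    using finite_cycles_on[OF fY] by (intro card_mono sub) simp
  finally show ?case using cY by simp
qed

lemma cycles_on_inv:
  assumes "finite V" "c \<in> cycles_on V"
  shows "inv c \<in> cycles_on V"
proof -
  have "permutation c" using assms cycles_onD(1) permutation_permutes by blast
  from orbit_inv_eq[OF this] show ?thesis
    using assms by (simp add: cycles_on_def cyclic_on_def permutes_inv)
qed

section \<open>Products of two long cycles\<close>

text \<open>Divided by the number of all permutations of \<open>Y\<close>, not of the even ones, so
  that the even and odd parts add up to the full average.\<close>

definition even_avg :: "nat set \<Rightarrow> ((nat \<Rightarrow> nat) \<Rightarrow> real) \<Rightarrow> (nat \<Rightarrow> nat) \<Rightarrow> real" where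
  "even_avg Y f g = (1 / fact (card Y)) * (\<Sum>p | p permutes Y \<and> evenperm p. f (g \<circ> p))"

definition odd_avg :: "nat set \<Rightarrow> ((nat \<Rightarrow> nat) \<Rightarrow> real) \<Rightarrow> (nat \<Rightarrow> nat) \<Rightarrow> real" where
  "odd_avg Y f g = (1 / fact (card Y)) * (\<Sum>p | p permutes Y \<and> \<not> evenperm p. f (g \<circ> p))"

lemma even_avg_plus_odd_avg:
  assumes "finite Y"
  shows "even_avg Y f g + odd_avg Y f g = right_avg {p. p permutes Y} f g"
proof -
  have "(\<Sum>p | p permutes Y. f (g \<circ> p))
      = (\<Sum>p | p permutes Y \<and> evenperm p. f (g \<circ> p)) + (\<Sum>p | p permutes Y \<and> \<not> evenperm p. f (g \<circ> p))"
    using finite_permutations[OF assms]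
    by (subst sum.union_disjoint[symmetric]) (auto intro!: sum.cong)
  then show ?thesis
    by (simp add: even_avg_def odd_avg_def right_avg_def card_permutations[OF refl assms] add_divide_distrib)
qed

lemma even_avg_exch:
  assumes "finite Y" "i \<in> Y" "j \<in> Y" "i \<noteq> j"
  shows "even_avg Y f (g \<circ> exch i j) = odd_avg Y f g"
proof -
  have e: "evenperm (exch i j \<circ> p) \<longleftrightarrow> \<not> evenperm p" if "p permutes Y" for p
    using that assms permutation_permutes
    by (subst evenperm_comp) (auto simp: permutation_swap_id evenperm_swap)
  have "(\<Sum>p | p permutes Y \<and> evenperm p. f (g \<circ> exch i j \<circ> p))
      = (\<Sum>p | p permutes Y \<and> \<not> evenperm p. f (g \<circ> p))"
  proof (rule sum.reindex_bij_witness[of _ "\<lambda>p. exch i j \<circ> p" "\<lambda>p. exch i j \<circ> p"])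
    fix p assume "p \<in> {p. p permutes Y \<and> evenperm p}"
    then show "exch i j \<circ> p \<in> {p. p permutes Y \<and> \<not> evenperm p}"
      using e[of p] assms by (simp add: permutes_compose permutes_swap_id)
  next
    fix p assume "p \<in> {p. p permutes Y \<and> \<not> evenperm p}"
    then show "exch i j \<circ> p \<in> {p. p permutes Y \<and> evenperm p}"
      using e[of p] assms by (simp add: permutes_compose permutes_swap_id)
  qed (simp_all only: comp_assoc[symmetric] transpose_comp_involutory id_comp)
  then show ?thesis by (simp only: even_avg_def odd_avg_def)
qed

lemma even_avg_nonneg:
  assumes "\<And>g. g permutes {..<N} \<Longrightarrow> f g \<ge> 0" "Y \<subseteq> {..<N}" "g permutes {..<N}"
  shows "even_avg Y f g \<ge> 0" "odd_avg Y f g \<ge> 0"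
  unfolding even_avg_def odd_avg_def
  by (auto intro!: divide_nonneg_nonneg sum_nonneg assms(1)
      permutes_compose[OF permutes_subset[OF _ assms(2)] assms(3)])

text \<open>With \<open>k\<close> the size of \<open>Y\<close>, each even \<open>p\<close> is a
  product \<open>inv c \<circ> (c \<circ> p)\<close> of two cycles in at least \<open>(k-2)!\<close>
  ways. Among the \<open>(k-1)!\<close> squared pairs of cycles this is a density of at least
  \<open>1 / ((k-1) * (k-1)!)\<close>, which exceeds \<open>1 / k!\<close>.\<close>

lemma two_cycles_ge_even_avg:
  assumes Y: "Y \<subseteq> {..<N}" "card Y \<ge> 2" and g: "g permutes {..<N}"
    and f: "\<And>g. g permutes {..<N} \<Longrightarrow> f g \<ge> 0"
  shows "right_avg (cycles_on Y) (right_avg (cycles_on Y) f) g \<ge> even_avg Y f g"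
proof -
  have fY: "finite Y" using Y finite_subset by blast
  have YN: "Y \<noteq> {}" using Y by auto
  let ?C = "cycles_on Y" and ?E = "{p. p permutes Y \<and> evenperm p}"
  define F where "F p = {c \<in> ?C. c \<circ> p \<in> ?C}" for p
  let ?k = "card Y"
  have fC: "finite ?C" by (rule finite_cycles_on[OF fY])
  have fF: "finite (F p)" for p using fC by (simp add: F_def)
  have fE: "finite ?E" using finite_permutations[OF fY] by simp
  have sub: "p permutes {..<N}" if "p permutes Y" for p using that Y(1) permutes_subset by blast
  have fpos: "f (g \<circ> p) \<ge> 0" if "p permutes Y" for p
    using f g permutes_compose[OF sub[OF that] g] by blast
  have "fact (?k - 2) * (\<Sum>p\<in>?E. f (g \<circ> p)) \<le> (\<Sum>p\<in>?E. real (card (F p)) * f (g \<circ> p))"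
    unfolding sum_distrib_left
  proof (rule sum_mono, rule mult_right_mono)
    fix p assume p: "p \<in> ?E"
    then have "fact (?k - 2) \<le> card (F p)"
      unfolding F_def using card_cycle_factorisations[OF fY Y(2)] by blast
    then show "fact (?k - 2) \<le> real (card (F p))" by (metis of_nat_fact of_nat_le_iff)
    show "0 \<le> f (g \<circ> p)" using p fpos by blast
  qed
  also have "\<dots> = (\<Sum>x\<in>(SIGMA p:?E. F p). f (g \<circ> fst x))"
    using fE fF by (subst sum.Sigma[symmetric, of ?E F "\<lambda>p c. f (g \<circ> p)", simplified case_prod_unfold]) auto
  also have "\<dots> = (\<Sum>y\<in>(\<lambda>(p, c). (inv c, c \<circ> p)) ` (SIGMA p:?E. F p). f (g \<circ> fst y \<circ> snd y))"
  proof (subst sum.reindex)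
    have cinv: "inv c \<circ> (c \<circ> p) = p" if "c \<in> ?C" for c p
      using permutes_inv_o(2)[OF cycles_onD(1)[OF that]] by (simp only: comp_assoc[symmetric] id_comp)
    show "inj_on (\<lambda>(p, c). (inv c, c \<circ> p)) (SIGMA p:?E. F p)"
    proof (rule inj_onI, clarify)
      fix p c p' c' assume *: "c \<in> F p" "c' \<in> F p'" "inv c = inv c'" "c \<circ> p = c' \<circ> p'"
      have cc: "c \<in> ?C" "c' \<in> ?C" using * by (auto simp: F_def)
      have "p = inv c \<circ> (c \<circ> p)" by (rule cinv[OF cc(1), symmetric])
      also have "\<dots> = p'" unfolding *(3,4) by (rule cinv[OF cc(2)])
      finally have "p = p'" .
      moreover have "c = inv (inv c)" by (rule permutes_inv_inv[OF cycles_onD(1)[OF cc(1)], symmetric])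
      then have "c = c'" unfolding *(3) permutes_inv_inv[OF cycles_onD(1)[OF cc(2)]] .
      ultimately show "p = p' \<and> c = c'" ..
    qed
    show "(\<Sum>x\<in>(SIGMA p:?E. F p). f (g \<circ> fst x))
        = sum ((\<lambda>y. f (g \<circ> fst y \<circ> snd y)) \<circ> (\<lambda>(p, c). (inv c, c \<circ> p))) (SIGMA p:?E. F p)"
    proof (rule sum.cong[OF refl])
      fix x assume "x \<in> (SIGMA p:?E. F p)"
      then obtain p c where x: "x = (p, c)" "c \<in> ?C" by (auto simp: F_def)
      show "f (g \<circ> fst x) = ((\<lambda>y. f (g \<circ> fst y \<circ> snd y)) \<circ> (\<lambda>(p, c). (inv c, c \<circ> p))) x"
        using cinv[OF x(2), of p] by (simp add: x(1) comp_assoc)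
    qed
  qed
  also have "\<dots> \<le> (\<Sum>y\<in>?C \<times> ?C. f (g \<circ> fst y \<circ> snd y))"
  proof (rule sum_mono2)
    show "finite (?C \<times> ?C)" using fC by simp
    show "(\<lambda>(p, c). (inv c, c \<circ> p)) ` (SIGMA p:?E. F p) \<subseteq> ?C \<times> ?C"
      using cycles_on_inv[OF fY] by (auto simp: F_def)
    fix y assume "y \<in> ?C \<times> ?C - (\<lambda>(p, c). (inv c, c \<circ> p)) ` (SIGMA p:?E. F p)"
    then obtain c d where y: "y = (c, d)" "c \<in> ?C" "d \<in> ?C" by blast
    have "c \<circ> d permutes Y" using y cycles_onD(1) permutes_compose by blast
    from fpos[OF this] show "0 \<le> f (g \<circ> fst y \<circ> snd y)" by (simp add: y(1) comp_assoc)
  qed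
  also have "\<dots> = (\<Sum>c\<in>?C. \<Sum>d\<in>?C. f (g \<circ> c \<circ> d))"
    by (simp add: sum.cartesian_product case_prod_unfold)
  finally have *: "fact (?k - 2) * (\<Sum>p\<in>?E. f (g \<circ> p)) \<le> (\<Sum>c\<in>?C. \<Sum>d\<in>?C. f (g \<circ> c \<circ> d))" .
  have cC: "card ?C = fact (?k - 1)" by (rule card_cycles_on[OF fY YN])
  have f1: "(fact (?k - 1) :: real) = (real ?k - 1) * fact (?k - 2)"
  proof -
    have "?k - 1 = Suc (?k - 2)" using Y(2) by simp
    then show ?thesis using Y(2) by (simp add: of_nat_diff)
  qed
  have f2: "(fact ?k :: real) = real ?k * fact (?k - 1)" using Y(2) by (simp add: fact_reduce)
  have P: "(\<Sum>p\<in>?E. f (g \<circ> p)) \<ge> 0" using fpos by (intro sum_nonneg) auto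
  have "even_avg Y f g = (\<Sum>p\<in>?E. f (g \<circ> p)) / (real ?k * fact (?k - 1))"
    by (simp add: even_avg_def f2)
  also have "\<dots> \<le> (\<Sum>p\<in>?E. f (g \<circ> p)) / ((real ?k - 1) * fact (?k - 1))"
    using P Y(2) by (intro divide_left_mono mult_right_mono mult_pos_pos) auto
  also have "\<dots> = fact (?k - 2) * (\<Sum>p\<in>?E. f (g \<circ> p)) / (fact (?k - 1) * fact (?k - 1))"
    using Y(2) unfolding f1 by simp
  also have "\<dots> \<le> (\<Sum>c\<in>?C. \<Sum>d\<in>?C. f (g \<circ> c \<circ> d)) / (fact (?k - 1) * fact (?k - 1))"
    by (intro divide_right_mono *) simp
  also have "\<dots> = right_avg ?C (right_avg ?C f) g"
    by (simp add: right_avg_def cC sum_divide_distrib[symmetric])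
  finally show ?thesis .
qed

section \<open>Parity and the moves that pick one card twice\<close>

definition off_op :: "nat \<Rightarrow> ((nat \<Rightarrow> nat) \<Rightarrow> real) \<Rightarrow> (nat \<Rightarrow> nat) \<Rightarrow> real" where
  "off_op N = move_op (\<lambda>r l. if r = l then 0 else 1 / real N ^ 2) N"

text \<open>Separates the moves by parity: the diagonal ones do nothing, every move kept in
  \<open>off_op\<close> is an odd permutation.\<close>

lemma trans_op_eq_off_op:
  assumes "N > 0"
  shows "trans_op N f g = f g / real N + off_op N f g"
proof -
  have "trans_op N f g = (\<Sum>r<N. \<Sum>l<N. (if r = l then 1 / real N ^ 2 * f g else 0)
      + (if r = l then 0 else 1 / real N ^ 2) * f (g \<circ> exch r l))"
    unfolding trans_op_def move_op_def by (intro sum.cong refl) auto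
  also have "\<dots> = (\<Sum>r<N. \<Sum>l<N. (if r = l then 1 / real N ^ 2 * f g else 0)) + off_op N f g"
    by (simp add: sum.distrib off_op_def move_op_def)
  also have "(\<Sum>r<N. \<Sum>l<N. (if r = l then 1 / real N ^ 2 * f g else 0)) = f g / real N"
    using assms by (simp add: power2_eq_square)
  finally show ?thesis .
qed

lemma trans_op_mass: "N > 0 \<Longrightarrow> (\<Sum>r<N. \<Sum>l<N. 1 / real N ^ 2) = 1"
  by (simp add: power2_eq_square)

lemma off_op_mass: "N > 0 \<Longrightarrow> (\<Sum>r<N. \<Sum>l<N. if r = l then 0 else 1 / real N ^ 2) = 1 - 1 / real N"
  using trans_op_eq_off_op[of N "\<lambda>_. 1" id]
  by (simp add: trans_op_def off_op_def move_op_const power2_eq_square)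

lemma funpow_off_op_const:
  assumes "N > 0"
  shows "(off_op N ^^ t) (\<lambda>_. c) = (\<lambda>_. (1 - 1 / real N) ^ t * c)"
  by (induction t) (simp_all add: off_op_def move_op_const off_op_mass[OF assms] mult_ac)

lemma off_op_mono:
  assumes "\<And>g. g permutes {..<N} \<Longrightarrow> f g \<le> h g" "g permutes {..<N}"
  shows "off_op N f g \<le> off_op N h g"
  unfolding off_op_def using assms by (intro move_op_mono) auto

lemma funpow_off_op_mono:
  assumes "\<And>g. g permutes {..<N} \<Longrightarrow> f g \<le> h g" "g permutes {..<N}"
  shows "(off_op N ^^ t) f g \<le> (off_op N ^^ t) h g"
  unfolding off_op_def using assms by (intro funpow_move_op_mono) auto

text \<open>The moves that pick the same card twice are the only source of parity mixing: keep the
  outcomes with none or exactly one of them.\<close>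

lemma funpow_trans_op_ge_off_op:
  assumes "N > 0" "\<And>g. g permutes {..<N} \<Longrightarrow> f g \<ge> 0" "g permutes {..<N}"
  shows "(trans_op N ^^ Suc s) f g \<ge> (off_op N ^^ Suc s) f g + (real (Suc s) / real N) * (off_op N ^^ s) f g"
  using assms(3)
proof (induction s arbitrary: g)
  case 0
  then show ?case by (simp add: trans_op_eq_off_op[OF assms(1)])
next
  case (Suc s)
  let ?T = "(trans_op N ^^ Suc s) f" and ?O = "\<lambda>s. (off_op N ^^ s) f"
  have pos: "?O t g \<ge> 0" if "g permutes {..<N}" for t g
    using funpow_off_op_mono[of N "\<lambda>_. 0" f g t] assms(2) that
    by (simp add: funpow_off_op_const[OF assms(1)])
  have "(trans_op N ^^ Suc (Suc s)) f g = ?T g / real N + off_op N ?T g"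
    using trans_op_eq_off_op[OF assms(1)] by simp
  moreover have "?T g \<ge> ?O (Suc s) g"
  proof -
    have "(real (Suc s) / real N) * ?O s g \<ge> 0" using pos[OF Suc.prems, of s] by simp
    then show ?thesis using Suc.IH[OF Suc.prems] by linarith
  qed
  moreover have "off_op N ?T g \<ge> off_op N (\<lambda>g. ?O (Suc s) g + (real (Suc s) / real N) * ?O s g) g"
    using Suc by (intro off_op_mono) auto
  moreover have "off_op N (\<lambda>g. ?O (Suc s) g + (real (Suc s) / real N) * ?O s g) g
      = ?O (Suc (Suc s)) g + (real (Suc s) / real N) * ?O (Suc s) g"
    by (simp only: off_op_def move_op_add move_op_cmult funpow.simps comp_apply)
  ultimately have "(trans_op N ^^ Suc (Suc s)) f g
      \<ge> ?O (Suc s) g / real N + (?O (Suc (Suc s)) g + (real (Suc s) / real N) * ?O (Suc s) g)"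
    using divide_right_mono[of "?O (Suc s) g" "?T g" "real N"] by linarith
  then show ?case by (simp add: algebra_simps add_divide_distrib)
qed

lemma one_minus_inverse_power_ge: "N \<ge> 2 \<Longrightarrow> (1 - 1 / real N) ^ (N - 1) \<ge> 1 / 3"
proof -
  assume N: "N \<ge> 2"
  let ?m = "N - 1"
  have m: "real ?m > 0" using N by simp
  have "(1 + 1 / real ?m) ^ ?m \<le> exp (1 / real ?m) ^ ?m"
    by (intro power_mono exp_ge_add_one_self) simp
  also have "\<dots> = exp 1" using m by (simp add: exp_of_nat_mult[symmetric])
  also have "\<dots> \<le> 3" by (rule exp_le)
  finally have *: "(1 + 1 / real ?m) ^ ?m \<le> 3" .
  have "1 - 1 / real N = 1 / (1 + 1 / real ?m)"
    using N by (simp add: field_simps of_nat_diff)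
  then have "(1 - 1 / real N) ^ ?m = 1 / (1 + 1 / real ?m) ^ ?m"
    by (simp add: power_one_over)
  also have "\<dots> \<ge> 1 / 3" using * by (intro divide_left_mono mult_pos_pos zero_less_power add_pos_nonneg) auto
  finally show ?thesis .
qed

text \<open>The even and odd averages sum to at least \<open>q\<close>, but two cycles only reach
  the even one. A nontrivial exchange inside \<open>Y\<close> maps the even average to the odd one,
  and outcomes with no lazy move and with exactly one differ in parity, so keeping both kinds makes
  both averages contribute.\<close>

lemma two_cycles_trans_op_ge:
  assumes Y: "Y \<subseteq> {..<N}" "card Y \<ge> 2" and g: "g permutes {..<N}"
    and f: "\<And>g. g permutes {..<N} \<Longrightarrow> f g \<ge> 0"
    and U: "\<And>g. g permutes {..<N} \<Longrightarrow> right_avg {p. p permutes Y} f g \<ge> q"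
    and q: "q \<ge> 0"
  shows "right_avg (cycles_on Y) (right_avg (cycles_on Y) ((trans_op N ^^ N) f)) g
    \<ge> real (card Y) * (real (card Y) - 1) / (3 * real N ^ 2) * q"
proof -
  have fY: "finite Y" using Y finite_subset by blast
  let ?k = "card Y"
  have kN: "?k \<le> N" using card_mono[of "{..<N}" Y] Y by simp
  then have N: "N \<ge> 2" using Y by simp
  \<comment> \<open>The probability that the two hands pick distinct cards of
    \<open>Y\<close>.\<close>
  define \<kappa> where "\<kappa> = real ?k * (real ?k - 1) / real N ^ 2"
  have \<kappa>: "0 \<le> \<kappa>" "\<kappa> \<le> 1"
  proof -
    have "real ?k * (real ?k - 1) \<le> real N * real N"
      using kN Y by (intro mult_mono) auto
    then show "\<kappa> \<le> 1" using N by (simp add: \<kappa>_def power2_eq_square)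
    show "0 \<le> \<kappa>" using Y by (simp add: \<kappa>_def)
  qed
  let ?\<phi> = "even_avg Y f" and ?\<psi> = "odd_avg Y f"
  have \<phi>: "?\<phi> g \<ge> 0" "?\<psi> g \<ge> 0" if "g permutes {..<N}" for g
    using even_avg_nonneg[OF f Y(1) that] by auto
  have off: "off_op N ?\<phi> g \<ge> \<kappa> * ?\<psi> g" if g: "g permutes {..<N}" for g
  proof -
    have "(\<Sum>r\<in>Y. \<Sum>l\<in>Y. (if r = l then 0 else 1 / real N ^ 2 * ?\<psi> g)) \<le> off_op N ?\<phi> g"
    proof -
      have "(\<Sum>r\<in>Y. \<Sum>l\<in>Y. (if r = l then 0 else 1 / real N ^ 2 * ?\<psi> g))
          = (\<Sum>r\<in>Y. \<Sum>l\<in>Y. (if r = l then 0 else 1 / real N ^ 2) * ?\<phi> (g \<circ> exch r l))"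
        using even_avg_exch[OF fY] by (intro sum.cong refl) auto
      also have "\<dots> \<le> (\<Sum>r\<in>Y. \<Sum>l<N. (if r = l then 0 else 1 / real N ^ 2) * ?\<phi> (g \<circ> exch r l))"
        using Y \<phi>(1) g by (intro sum_mono sum_mono2) (auto simp: comp_exch_permutes subset_iff)
      also have "\<dots> \<le> (\<Sum>r<N. \<Sum>l<N. (if r = l then 0 else 1 / real N ^ 2) * ?\<phi> (g \<circ> exch r l))"
        using Y \<phi>(1) g by (intro sum_mono2 sum_nonneg) (auto simp: comp_exch_permutes subset_iff)
      finally show ?thesis by (simp add: off_op_def move_op_def)
    qed
    moreover have "(\<Sum>r\<in>Y. \<Sum>l\<in>Y. (if r = l then 0 else 1 / real N ^ 2 * ?\<psi> g)) = \<kappa> * ?\<psi> g"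
    proof -
      have "(\<Sum>l\<in>Y. (if r = l then 0 else 1 / real N ^ 2 * ?\<psi> g)) = (real ?k - 1) * (1 / real N ^ 2 * ?\<psi> g)"
        if "r \<in> Y" for r
      proof -
        have "(\<Sum>l\<in>Y. (if r = l then 0 else 1 / real N ^ 2 * ?\<psi> g)) = (\<Sum>l\<in>Y - {r}. 1 / real N ^ 2 * ?\<psi> g)"
          using fY that by (subst sum.remove[of Y r]) (auto intro!: sum.cong)
        also have "\<dots> = (real ?k - 1) * (1 / real N ^ 2 * ?\<psi> g)"
          using that fY Y(2) by (simp add: of_nat_diff)
        finally show ?thesis .
      qed
      then show ?thesis by (simp add: \<kappa>_def)
    qed
    ultimately show ?thesis by simp
  qed
  have sum: "?\<phi> g + off_op N ?\<phi> g \<ge> \<kappa> * q" if g: "g permutes {..<N}" for g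
  proof -
    have "\<kappa> * q \<le> \<kappa> * (?\<phi> g + ?\<psi> g)"
      using U[OF g] \<kappa> even_avg_plus_odd_avg[OF fY, of f g] by (intro mult_left_mono) auto
    also have "\<dots> \<le> ?\<phi> g + \<kappa> * ?\<psi> g"
      using mult_right_mono[OF \<kappa>(2) \<phi>(1)[OF g]] by (simp add: distrib_left)
    finally show ?thesis using off[OF g] by linarith
  qed
  \<comment> \<open>The number of steps is \<open>N\<close> so that the outcomes with one lazy move
    come with coefficient exactly 1; then both kinds are \<open>N - 1\<close> iterates of
    \<open>off_op\<close> on one function, which is bounded below by
    \<open>\<kappa> * q\<close>.\<close>
  have N1: "Suc (N - 1) = N" using N by simp
  have "1 / 3 * (\<kappa> * q) \<le> (1 - 1 / real N) ^ (N - 1) * (\<kappa> * q)"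
    using one_minus_inverse_power_ge[OF N] \<kappa> q by (intro mult_right_mono) auto
  also have "\<dots> = (off_op N ^^ (N - 1)) (\<lambda>_. \<kappa> * q) g"
    using N by (simp add: funpow_off_op_const)
  also have "\<dots> \<le> (off_op N ^^ (N - 1)) (\<lambda>g. ?\<phi> g + off_op N ?\<phi> g) g"
    by (rule funpow_off_op_mono[OF sum g])
  also have "\<dots> = (off_op N ^^ (N - 1)) ?\<phi> g + (off_op N ^^ Suc (N - 1)) ?\<phi> g"
    by (simp add: off_op_def funpow_move_op_add funpow_swap1)
  also have "\<dots> = (off_op N ^^ Suc (N - 1)) ?\<phi> g + (real (Suc (N - 1)) / real N) * (off_op N ^^ (N - 1)) ?\<phi> g"
    using N by (simp add: N1)
  also have "\<dots> \<le> (trans_op N ^^ Suc (N - 1)) ?\<phi> g"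
    using N \<phi> g by (intro funpow_trans_op_ge_off_op) auto
  also have "\<dots> = even_avg Y ((trans_op N ^^ N) f) g"
    unfolding N1 even_avg_def[abs_def]
    by (subst funpow_trans_op_right_sum)
       (use finite_permutations[OF fY] Y(1) in \<open>auto intro: permutes_subset\<close>)
  also have "\<dots> \<le> right_avg (cycles_on Y) (right_avg (cycles_on Y) ((trans_op N ^^ N) f)) g"
  proof (rule two_cycles_ge_even_avg[OF Y g])
    fix g assume "g permutes {..<N}"
    then show "(trans_op N ^^ N) f g \<ge> 0"
      unfolding trans_op_def using f N by (intro funpow_move_op_ge_const) (auto simp: power2_eq_square)
  qed
  finally show ?thesis by (simp add: \<kappa>_def)
qed

section \<open>Functions with a lower bound on every large block\<close>

definition block_uniform :: "nat \<Rightarrow> nat \<Rightarrow> real \<Rightarrow> ((nat \<Rightarrow> nat) \<Rightarrow> real) \<Rightarrow> bool" where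
  "block_uniform N w q f \<longleftrightarrow> (\<forall>g. g permutes {..<N} \<longrightarrow> f g \<ge> 0) \<and>
     (\<forall>Y g. Y \<subseteq> {..<N} \<longrightarrow> w \<le> card Y \<longrightarrow> g permutes {..<N} \<longrightarrow> right_avg {p. p permutes Y} f g \<ge> q)"

text \<open>Conjugation: \<open>p \<circ> h\<close> equals
  \<open>h \<circ> (inv h \<circ> p \<circ> h)\<close>, and the conjugate permutes the image of
  \<open>Y\<close> under \<open>inv h\<close>.\<close>

lemma right_avg_permutes_shift:
  assumes "h permutes {..<N}"
  shows "right_avg {p. p permutes Y} (\<lambda>g. f (g \<circ> h)) g = right_avg {p. p permutes (inv h ` Y)} f (g \<circ> h)"
proof -
  note bij = permutes_bij[OF assms] and inv1 = permutes_inv_o[OF assms]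
  have c1: "inv h \<circ> p \<circ> h permutes (inv h ` Y)" if p: "p permutes Y" for p
  proof (rule bij_imp_permutes)
    have "bij_betw h (inv h ` Y) Y"
      by (rule bij_betw_byWitness[where f' = "inv h"])
         (auto simp: permutes_inverses[OF assms])
    moreover have "bij_betw (inv h) Y (inv h ` Y)"
      by (rule bij_betw_imageI[OF permutes_inj_on[OF permutes_inv[OF assms]] refl])
    ultimately show "bij_betw (inv h \<circ> p \<circ> h) (inv h ` Y) (inv h ` Y)"
      using permutes_imp_bij[OF p] by (meson bij_betw_trans)
    fix x assume "x \<notin> inv h ` Y"
    then have "h x \<notin> Y" using permutes_inverses(2)[OF assms] by (metis imageI)
    then show "(inv h \<circ> p \<circ> h) x = x" by (simp add: permutes_not_in[OF p] permutes_inverses[OF assms])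
  qed
  have c2: "h \<circ> p \<circ> inv h permutes Y" if p: "p permutes (inv h ` Y)" for p
  proof (rule bij_imp_permutes)
    have "bij_betw h (inv h ` Y) Y"
      by (rule bij_betw_byWitness[where f' = "inv h"])
         (auto simp: permutes_inverses[OF assms])
    moreover have "bij_betw (inv h) Y (inv h ` Y)"
      by (rule bij_betw_imageI[OF permutes_inj_on[OF permutes_inv[OF assms]] refl])
    ultimately show "bij_betw (h \<circ> p \<circ> inv h) Y Y"
      using permutes_imp_bij[OF p] by (meson bij_betw_trans)
    fix x assume "x \<notin> Y"
    then have "inv h x \<notin> inv h ` Y" by (metis imageE permutes_inverses(1)[OF assms])
    then show "(h \<circ> p \<circ> inv h) x = x" by (simp add: permutes_not_in[OF p] permutes_inverses[OF assms])
  qed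
  have b: "bij_betw (\<lambda>p. inv h \<circ> p \<circ> h) {p. p permutes Y} {p. p permutes (inv h ` Y)}"
  proof (rule bij_betw_byWitness[where f' = "\<lambda>p. h \<circ> p \<circ> inv h"])
    show "\<forall>p\<in>{p. p permutes Y}. h \<circ> (inv h \<circ> p \<circ> h) \<circ> inv h = p"
      by (auto simp: fun_eq_iff permutes_inverses[OF assms])
    show "\<forall>p\<in>{p. p permutes (inv h ` Y)}. inv h \<circ> (h \<circ> p \<circ> inv h) \<circ> h = p"
      by (auto simp: fun_eq_iff permutes_inverses[OF assms])
  qed (use c1 c2 in auto)
  have e: "g \<circ> p \<circ> h = g \<circ> h \<circ> (inv h \<circ> p \<circ> h)" for p
    by (auto simp: fun_eq_iff permutes_inverses[OF assms])
  have "(\<Sum>p | p permutes Y. f (g \<circ> p \<circ> h)) = (\<Sum>p | p permutes (inv h ` Y). f (g \<circ> h \<circ> p))"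
    unfolding e by (rule sum.reindex_bij_betw[OF b])
  then show ?thesis by (simp add: right_avg_def bij_betw_same_card[OF b])
qed

text \<open>A right translation replaces the block by another one of the same size. This stability
  is the reason why \<open>block_uniform\<close> speaks of all blocks instead of a fixed
  one.\<close>

lemma block_uniform_right_avg:
  assumes "block_uniform N w q f" "finite S" "S \<noteq> {}" "\<And>h. h \<in> S \<Longrightarrow> h permutes {..<N}"
  shows "block_uniform N w q (right_avg S f)"
  unfolding block_uniform_def
proof (intro conjI allI impI)
  fix g :: "nat \<Rightarrow> nat" assume "g permutes {..<N}"
  then show "right_avg S f g \<ge> 0"
    using assms by (intro right_avg_ge_const) (auto simp: block_uniform_def permutes_compose)
next
  fix Y and g :: "nat \<Rightarrow> nat"
  assume *: "Y \<subseteq> {..<N}" "w \<le> card Y" "g permutes {..<N}"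
  have eq: "right_avg {p. p permutes Y} (right_avg S f) g
      = (\<Sum>h\<in>S. right_avg {p. p permutes Y} (\<lambda>g. f (g \<circ> h)) g) / real (card S)"
    unfolding right_avg_def sum_divide_distrib[symmetric]
    by (subst sum.swap) (simp add: mult.commute)
  have "right_avg {p. p permutes Y} (\<lambda>g. f (g \<circ> h)) g \<ge> q" if h: "h \<in> S" for h
  proof -
    note hp = assms(4)[OF h]
    have "inv h ` Y \<subseteq> {..<N}"
      using *(1) permutes_in_image[OF permutes_inv[OF hp]] by blast
    moreover have "card (inv h ` Y) = card Y"
      by (rule card_image) (use permutes_inj[OF permutes_inv[OF hp]] in \<open>auto intro: inj_on_subset\<close>)
    ultimately show ?thesis
      unfolding right_avg_permutes_shift[OF hp]
      using assms(1) * hp by (auto simp: block_uniform_def permutes_compose)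
  qed
  then have "(\<Sum>h\<in>S. q) \<le> (\<Sum>h\<in>S. right_avg {p. p permutes Y} (\<lambda>g. f (g \<circ> h)) g)"
    by (rule sum_mono)
  moreover have "real (card S) > 0" using assms by (simp add: card_gt_0_iff)
  ultimately show "right_avg {p. p permutes Y} (right_avg S f) g \<ge> q"
    unfolding eq by (simp add: pos_le_divide_eq mult.commute)
qed

text \<open>The points of the two supports outside the common part \<open>Y\<close> are stripped one
  at a time as outer transpositions, until two cycles on exactly \<open>Y\<close> remain.\<close>

lemma two_cycles_overlap_ge:
  assumes "block_uniform N w q f" "q \<ge> 0" "w \<ge> 2"
    and Y: "Y \<subseteq> {..<N}" "card Y \<ge> w" and Z: "finite Z" "Z \<subseteq> {..<N}" "Z \<inter> Y = {}"
    and Z': "finite Z'" "Z' \<subseteq> {..<N}" "Z' \<inter> Y = {}"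
    and g: "g permutes {..<N}"
  shows "right_avg (cycles_on (Z \<union> Y)) (right_avg (cycles_on (Z' \<union> Y)) ((trans_op N ^^ N) f)) g
    \<ge> real w * (real w - 1) / (3 * real N ^ 2) * q"
proof -
  have fY: "finite Y" using Y finite_subset by blast
  have YN: "Y \<noteq> {}" using Y assms(3) by auto
  let ?c = "real w * (real w - 1) / (3 * real N ^ 2) * q"
  have ins: "finite ((\<lambda>y. exch y v) ` X)" "(\<lambda>y. exch y v) ` X \<noteq> {}"
    "\<And>h. h \<in> (\<lambda>y. exch y v) ` X \<Longrightarrow> h permutes {..<N}"
    if "v < N" "X \<subseteq> {..<N}" "X \<noteq> {}" for v X
    using that finite_subset[of X "{..<N}"] by (auto intro!: exch_permutes)
  \<comment> \<open>\<open>f\<close> is quantified because a transposition stripped from the right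
    passes through the uniform transpositions and is averaged into \<open>f\<close>.\<close>
  have step: "\<forall>f g. block_uniform N w q f \<longrightarrow> g permutes {..<N} \<longrightarrow>
      right_avg (cycles_on Y) (right_avg (cycles_on (Z' \<union> Y)) ((trans_op N ^^ N) f)) g \<ge> ?c"
    using Z'
  proof (induction Z' rule: finite_induct)
    case empty
    show ?case
    proof (intro allI impI)
      fix f :: "(nat \<Rightarrow> nat) \<Rightarrow> real" and g :: "nat \<Rightarrow> nat"
      assume f: "block_uniform N w q f" and g: "g permutes {..<N}"
      have "real w * (real w - 1) \<le> real (card Y) * (real (card Y) - 1)"
        using Y assms(3) by (intro mult_mono) auto
      then have "?c \<le> real (card Y) * (real (card Y) - 1) / (3 * real N ^ 2) * q"
        using assms(2) by (intro mult_right_mono divide_right_mono) auto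
      also have "\<dots> \<le> right_avg (cycles_on Y) (right_avg (cycles_on Y) ((trans_op N ^^ N) f)) g"
        using f Y assms(2,3) g by (intro two_cycles_trans_op_ge) (auto simp: block_uniform_def)
      finally show "right_avg (cycles_on Y) (right_avg (cycles_on ({} \<union> Y)) ((trans_op N ^^ N) f)) g \<ge> ?c"
        by simp
    qed
  next
    case (insert v Z')
    let ?X = "Z' \<union> Y"
    have X: "finite ?X" "?X \<noteq> {}" "v \<notin> ?X" "v < N" "?X \<subseteq> {..<N}"
      using insert Y fY YN by auto
    show ?case
    proof (intro allI impI)
      fix f :: "(nat \<Rightarrow> nat) \<Rightarrow> real" and g :: "nat \<Rightarrow> nat"
      assume f: "block_uniform N w q f" and g: "g permutes {..<N}"
      let ?S = "(\<lambda>y. exch y v) ` ?X"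
      have S: "finite ?S" "?S \<noteq> {}" "\<And>h. h \<in> ?S \<Longrightarrow> h permutes {..<N}"
        using ins[OF X(4,5,2)] by auto
      have "right_avg (cycles_on (insert v Z' \<union> Y)) ((trans_op N ^^ N) f)
          = right_avg (cycles_on ?X) ((trans_op N ^^ N) (right_avg ?S f))"
      proof -
        have "(trans_op N ^^ N) (right_avg ?S f) = right_avg ?S ((trans_op N ^^ N) f)"
          by (rule funpow_trans_op_right_avg) (use S in auto)
        then show ?thesis
          by (intro ext) (simp only: Un_insert_left right_avg_cycles_on_insert[OF X(1-3)])
      qed
      then show "right_avg (cycles_on Y) (right_avg (cycles_on (insert v Z' \<union> Y)) ((trans_op N ^^ N) f)) g \<ge> ?c"
        using insert block_uniform_right_avg[OF f S] g by auto
    qed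
  qed
  \<comment> \<open>A transposition stripped from the left only changes the starting arrangement, so
    here \<open>g\<close> has to vary while \<open>f\<close> is fixed.\<close>
  have "\<forall>g. g permutes {..<N} \<longrightarrow>
      right_avg (cycles_on (Z \<union> Y)) (right_avg (cycles_on (Z' \<union> Y)) ((trans_op N ^^ N) f)) g \<ge> ?c"
    using Z
  proof (induction Z rule: finite_induct)
    case empty
    then show ?case using step assms(1) by auto
  next
    case (insert v Z)
    let ?X = "Z \<union> Y"
    have X: "finite ?X" "?X \<noteq> {}" "v \<notin> ?X" "v < N" "?X \<subseteq> {..<N}"
      using insert Y fY YN by auto
    let ?S = "(\<lambda>y. exch y v) ` ?X"
    have S: "finite ?S" "?S \<noteq> {}" "\<And>h. h \<in> ?S \<Longrightarrow> h permutes {..<N}"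
      using ins[OF X(4,5,2)] by auto
    show ?case
    proof (intro allI impI)
      fix g :: "nat \<Rightarrow> nat" assume g: "g permutes {..<N}"
      have "right_avg (cycles_on (insert v Z \<union> Y)) (right_avg (cycles_on (Z' \<union> Y)) ((trans_op N ^^ N) f)) g
          = right_avg ?S (right_avg (cycles_on ?X) (right_avg (cycles_on (Z' \<union> Y)) ((trans_op N ^^ N) f))) g"
        using right_avg_cycles_on_insert_left[OF X(1-3)] by simp
      also have "\<dots> \<ge> ?c"
      proof (rule right_avg_ge_const[OF S(1,2)])
        fix h assume "h \<in> ?S"
        then have "g \<circ> h permutes {..<N}" using S(3) permutes_compose g by blast
        then show "right_avg (cycles_on ?X) (right_avg (cycles_on (Z' \<union> Y)) ((trans_op N ^^ N) f)) (g \<circ> h) \<ge> ?c"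
          using insert.IH insert.prems by blast
      qed
      finally show "right_avg (cycles_on (insert v Z \<union> Y)) (right_avg (cycles_on (Z' \<union> Y)) ((trans_op N ^^ N) f)) g \<ge> ?c" .
    qed
  qed
  then show ?thesis using g by blast
qed

section \<open>Emergence of long cycles\<close>

definition num_orbits :: "nat \<Rightarrow> (nat \<Rightarrow> nat) \<Rightarrow> real" where
  "num_orbits N \<sigma> = real (card (orbit \<sigma> ` {..<N}))"

text \<open>For a permutation of the \<open>N\<close> cards, the probability that two independent
  uniform cards lie in the same cycle.\<close>

definition orbit_mass :: "nat \<Rightarrow> (nat \<Rightarrow> nat) \<Rightarrow> real" where
  "orbit_mass N \<sigma> = (\<Sum>x<N. real (card (orbit \<sigma> x))) / real N ^ 2"

lemma orbit_permutes_eq: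
  fixes \<sigma> :: "nat \<Rightarrow> nat"
  assumes "\<sigma> permutes {..<N}" "y \<in> orbit \<sigma> x"
  shows "orbit \<sigma> y = orbit \<sigma> x"
  by (rule orbit_cyclic_eq3[OF cyclic_on_orbit[OF assms(1)] assms(2)]) simp

lemma self_in_orbit_permutes: "\<sigma> permutes {..<N::nat} \<Longrightarrow> x \<in> orbit \<sigma> x"
  by (rule permutation_self_in_orbit) (use finite_lessThan permutation_permutes in blast)

text \<open>Orbits of \<open>\<tau>\<close> avoiding both \<open>i\<close> and \<open>j\<close> are
  old orbits. Inside one cycle the exchange creates at most two pieces; for different cycles,
  \<open>\<tau>\<close> started at \<open>j\<close> runs through the whole old orbit of
  \<open>i\<close>, so the two merge.\<close>

lemma num_orbits_exch:
  assumes \<sigma>: "\<sigma> permutes {..<N}" and i: "i < N" and j: "j < N"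
  shows "num_orbits N (\<sigma> \<circ> exch i j) \<le> num_orbits N \<sigma> + (if j \<in> orbit \<sigma> i then 1 else -1)"
proof -
  define \<tau> where "\<tau> = \<sigma> \<circ> exch i j"
  have \<tau>: "\<tau> permutes {..<N}" unfolding \<tau>_def by (rule comp_exch_permutes[OF assms])
  have \<tau>j: "\<tau> j = \<sigma> i" and \<tau>y: "\<And>y. y \<noteq> i \<Longrightarrow> y \<noteq> j \<Longrightarrow> \<tau> y = \<sigma> y"
    by (simp_all add: \<tau>_def)
  note self = self_in_orbit_permutes[OF \<sigma>] and self' = self_in_orbit_permutes[OF \<tau>]
  let ?O = "orbit \<sigma> ` {..<N}" and ?O' = "orbit \<tau> ` {..<N}"
  let ?D = "{orbit \<sigma> i, orbit \<sigma> j}" and ?D' = "{orbit \<tau> i, orbit \<tau> j}"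
  have "?O' \<subseteq> ?D' \<union> (?O - ?D)"
  proof
    fix V assume "V \<in> ?O'"
    then obtain x where x: "x < N" "V = orbit \<tau> x" by blast
    show "V \<in> ?D' \<union> (?O - ?D)"
    proof (cases "i \<in> V \<or> j \<in> V")
      case True
      then show ?thesis using orbit_permutes_eq[OF \<tau>] x by blast
    next
      case False
      have "orbit \<sigma> x = orbit \<tau> x"
      proof (rule orbit_cong[OF self'])
        fix s assume "s \<in> orbit \<tau> x"
        then have "s \<noteq> i" "s \<noteq> j" using False x by auto
        then show "\<sigma> s = \<tau> s" by (simp add: \<tau>y)
      qed
      then have V: "V = orbit \<sigma> x" using x by simp
      then have "V \<noteq> orbit \<sigma> i" "V \<noteq> orbit \<sigma> j" using False self by auto
      then show ?thesis using V x by blast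
    qed
  qed
  then have "card ?O' \<le> card (?D' \<union> (?O - ?D))" by (intro card_mono) auto
  also have "\<dots> \<le> card ?D' + card (?O - ?D)" by (rule card_Un_le)
  finally have "card ?O' \<le> card ?D' + card (?O - ?D)" .
  moreover have "card (?O - ?D) = card ?O - card ?D"
    using i j by (intro card_Diff_subset) auto
  moreover have "card ?D \<le> card ?O" using i j by (intro card_mono) auto
  ultimately have main: "real (card ?O') \<le> real (card ?D') + real (card ?O) - real (card ?D)"
    by linarith
  show ?thesis
  proof (cases "j \<in> orbit \<sigma> i")
    case True
    have "card ?D' \<le> 2" "card ?D \<ge> 1" by (auto simp: card_insert_if)
    then show ?thesis using main True by (simp add: num_orbits_def flip: \<tau>_def)
  next
    case False
    have "y \<in> orbit \<tau> j" if "y \<in> orbit \<sigma> i" for y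
      using that
    proof induction
      case base
      show ?case using orbit.base[of \<tau> j] by (simp add: \<tau>j)
    next
      case (step y)
      have "y \<noteq> j" using step False by blast
      show ?case
      proof (cases "y = i")
        case True
        then show ?thesis using orbit.base[of \<tau> j] by (simp add: \<tau>j)
      next
        case False
        then show ?thesis using orbit.step[OF step.IH] \<open>y \<noteq> j\<close> by (simp add: \<tau>y)
      qed
    qed
    then have "i \<in> orbit \<tau> j" using self by blast
    then have "card ?D' = 1" using orbit_permutes_eq[OF \<tau>] by simp
    moreover have "orbit \<sigma> i \<noteq> orbit \<sigma> j" using False self by blast
    then have "card ?D = 2" by simp
    ultimately show ?thesis using main False by (simp add: num_orbits_def flip: \<tau>_def)
  qed
qed

text \<open>A uniform pair lies in a common cycle with probability \<open>orbit_mass\<close>; then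
  the count rises by at most 1, and otherwise it drops by 1.\<close>

lemma trans_op_num_orbits_le:
  assumes \<sigma>: "\<sigma> permutes {..<N}" and N: "N > 0"
  shows "trans_op N (num_orbits N) \<sigma> \<le> num_orbits N \<sigma> + 2 * orbit_mass N \<sigma> - 1"
proof -
  have row: "(\<Sum>j<N. num_orbits N \<sigma> + (if j \<in> orbit \<sigma> i then 1 else -1))
      = real N * num_orbits N \<sigma> + 2 * real (card (orbit \<sigma> i)) - real N" if "i < N" for i
  proof -
    have sub: "orbit \<sigma> i \<subseteq> {..<N}" using permutes_orbit_subset[OF \<sigma>] that by simp
    have "(\<Sum>j<N. (if j \<in> orbit \<sigma> i then 1 else -1::real)) = (\<Sum>j<N. 2 * (if j \<in> orbit \<sigma> i then 1 else 0) - 1)"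
      by (intro sum.cong refl) auto
    also have "\<dots> = 2 * (\<Sum>j<N. (if j \<in> orbit \<sigma> i then 1 else 0)) - real N"
      by (simp add: sum_subtractf sum_distrib_left)
    also have "(\<Sum>j<N. (if j \<in> orbit \<sigma> i then 1 else 0::real)) = real (card (orbit \<sigma> i))"
      using sub by (simp add: sum.If_cases Int_absorb1)
    finally show ?thesis by (simp add: sum.distrib)
  qed
  have "trans_op N (num_orbits N) \<sigma> = (\<Sum>i<N. \<Sum>j<N. num_orbits N (\<sigma> \<circ> exch i j)) / real N ^ 2"
    by (simp add: trans_op_def move_op_def sum_divide_distrib)
  also have "\<dots> \<le> (\<Sum>i<N. \<Sum>j<N. num_orbits N \<sigma> + (if j \<in> orbit \<sigma> i then 1 else -1)) / real N ^ 2"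
    using num_orbits_exch[OF \<sigma>] by (intro divide_right_mono sum_mono) auto
  also have "(\<Sum>i<N. \<Sum>j<N. num_orbits N \<sigma> + (if j \<in> orbit \<sigma> i then 1 else -1))
      = (\<Sum>i<N. real N * num_orbits N \<sigma> + 2 * real (card (orbit \<sigma> i)) - real N)"
    by (intro sum.cong refl row) auto
  also have "\<dots> = real N ^ 2 * num_orbits N \<sigma> + 2 * (\<Sum>i<N. real (card (orbit \<sigma> i))) - real N ^ 2"
    by (simp add: sum.distrib sum_subtractf sum_distrib_left power2_eq_square)
  also have "\<dots> / real N ^ 2 = num_orbits N \<sigma> + 2 * orbit_mass N \<sigma> - 1"
    using N by (simp add: orbit_mass_def add_divide_distrib diff_divide_distrib)
  finally show ?thesis .
qed

text \<open>As long as the cycles are short, most moves merge two cycles, and only \<open>N\<close> mergers are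
  possible in excess of the splittings.\<close>

lemma ex_large_orbit_mass:
  assumes N: "N > 0"
  shows "\<exists>t<2*N. (trans_op N ^^ t) (orbit_mass N) id \<ge> 1 / 4"
proof (rule ccontr)
  assume "\<not> ?thesis"
  then have small: "(trans_op N ^^ t) (orbit_mass N) id < 1 / 4" if "t < 2 * N" for t
    using that by force
  have mass: "(\<Sum>r<N. \<Sum>l<N. 1 / real N ^ 2) = 1" by (rule trans_op_mass[OF N])
  have step: "(trans_op N ^^ Suc t) (num_orbits N) id
      \<le> (trans_op N ^^ t) (num_orbits N) id + 2 * (trans_op N ^^ t) (orbit_mass N) id - 1" for t
  proof -
    have "(trans_op N ^^ Suc t) (num_orbits N) id = (trans_op N ^^ t) (trans_op N (num_orbits N)) id"
      by (simp add: funpow_swap1)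
    also have "\<dots> \<le> (trans_op N ^^ t) (\<lambda>\<sigma>. num_orbits N \<sigma> + 2 * orbit_mass N \<sigma> - 1) id"
      unfolding trans_op_def
      by (rule funpow_move_op_mono) (use trans_op_num_orbits_le[OF _ N] in \<open>auto simp: trans_op_def\<close>)
    also have "\<dots> = (trans_op N ^^ t) (num_orbits N) id + 2 * (trans_op N ^^ t) (orbit_mass N) id - 1"
      unfolding trans_op_def
      by (simp only: funpow_move_op_diff funpow_move_op_add funpow_move_op_cmult funpow_move_op_const[OF mass])
    finally show ?thesis .
  qed
  define u where "u t = (trans_op N ^^ t) (num_orbits N) id" for t
  have "u t \<le> real N - real t / 2" if "t \<le> 2 * N" for t
    using that
  proof (induction t)
    case 0
    have "card (orbit id ` {..<N}) \<le> N" using card_image_le[of "{..<N}" "orbit id"] by simp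
    then have "num_orbits N id \<le> real N" unfolding num_orbits_def of_nat_le_iff .
    then show ?case by (simp only: u_def funpow_0 of_nat_0 div_0 diff_zero)
  next
    case (Suc t)
    have "u (Suc t) \<le> u t + 2 * (1 / 4) - 1"
      using step[of t] small[of t] Suc.prems unfolding u_def by linarith
    then show ?case using Suc by (simp add: field_simps)
  qed
  from this[of "2 * N"] have "u (2 * N) \<le> 0" by simp
  moreover have "u (2 * N) \<ge> 1"
    unfolding trans_op_def u_def
  proof (rule funpow_move_op_ge_const)
    fix g :: "nat \<Rightarrow> nat"
    have "card (orbit g ` {..<N}) > 0" using N by (simp add: card_gt_0_iff lessThan_empty_iff)
    then show "num_orbits N g \<ge> 1" by (simp add: num_orbits_def)
  qed (use mass in auto)
  ultimately show False by simp
qed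

section \<open>Conjugation invariance and the cycle of a given card\<close>

definition trans_dist :: "nat \<Rightarrow> nat \<Rightarrow> (nat \<Rightarrow> nat) \<Rightarrow> real" where
  "trans_dist N t = (trans_op N ^^ t) (point_mass id)"

lemma trans_dist_kernel:
  "(trans_op N ^^ t) f g = (\<Sum>\<sigma> | \<sigma> permutes {..<N}. trans_dist N t \<sigma> * f (g \<circ> \<sigma>))"
  unfolding trans_op_def trans_dist_def by (rule funpow_move_op_kernel)

lemma trans_dist_nonneg:
  assumes "N > 0" "\<sigma> permutes {..<N}"
  shows "trans_dist N t \<sigma> \<ge> 0"
  unfolding trans_op_def trans_dist_def
  by (rule funpow_move_op_ge_const) (use assms trans_op_mass[of N] in \<open>auto simp: point_mass_def\<close>)

lemma trans_dist_sum:
  assumes "N > 0"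
  shows "(\<Sum>\<sigma> | \<sigma> permutes {..<N}. trans_dist N t \<sigma>) = 1"
  using trans_dist_kernel[where N = N and t = t and f = "\<lambda>_. 1" and g = id]
    funpow_move_op_const[OF trans_op_mass[OF assms], of t 1]
  by (simp add: trans_op_def)

text \<open>Left translations commute with all moves and right translations with uniform ones, so
  the conjugation can be shifted onto the point mass at \<open>id\<close>, which it
  preserves.\<close>

lemma trans_dist_conj:
  assumes "h permutes {..<N}"
  shows "trans_dist N t (h \<circ> \<sigma> \<circ> inv h) = trans_dist N t \<sigma>"
proof -
  let ?F = "point_mass (id :: nat \<Rightarrow> nat)"
  have "?F (h \<circ> s \<circ> inv h) = ?F s" for s
  proof -
    have "h \<circ> s \<circ> inv h = id \<longleftrightarrow> s = id"
    proof
      assume e: "h \<circ> s \<circ> inv h = id"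
      have "s = inv h \<circ> (h \<circ> s \<circ> inv h) \<circ> h"
        by (auto simp: fun_eq_iff permutes_inverses[OF assms])
      then show "s = id" unfolding e by (simp add: permutes_inv_o[OF assms])
    qed (simp add: permutes_inv_o[OF assms])
    then show ?thesis by (simp add: point_mass_def)
  qed
  then have F: "(\<lambda>s. ?F (h \<circ> (s \<circ> inv h))) = ?F" by (simp add: fun_eq_iff comp_assoc)
  have "trans_dist N t (h \<circ> \<sigma> \<circ> inv h) = (\<lambda>g. (trans_op N ^^ t) ?F (h \<circ> g)) (\<sigma> \<circ> inv h)"
    by (simp add: trans_dist_def comp_assoc)
  also have "(\<lambda>g. (trans_op N ^^ t) ?F (h \<circ> g)) = (trans_op N ^^ t) (\<lambda>g. ?F (h \<circ> g))"
    unfolding trans_op_def by (rule funpow_move_op_left[symmetric])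
  also have "(trans_op N ^^ t) (\<lambda>g. ?F (h \<circ> g)) (\<sigma> \<circ> inv h) = (trans_op N ^^ t) (\<lambda>s. ?F (h \<circ> (s \<circ> inv h))) \<sigma>"
    by (subst funpow_trans_op_right[OF permutes_inv[OF assms], of t "\<lambda>g. ?F (h \<circ> g)"]) simp
  also have "\<dots> = trans_dist N t \<sigma>" unfolding F trans_dist_def ..
  finally show ?thesis .
qed

lemma permutes_disjoint_commute:
  assumes "p permutes A" "q permutes B" "A \<inter> B = {}"
  shows "p \<circ> q = q \<circ> p"
proof
  fix x
  show "(p \<circ> q) x = (q \<circ> p) x"
  proof (cases "x \<in> A")
    case True
    then have "p x \<notin> B" "x \<notin> B" using assms permutes_in_image[OF assms(1)] by blast+
    then show ?thesis using assms by (simp add: permutes_not_in)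
  next
    case False
    have "q x \<notin> A"
    proof (cases "x \<in> B")
      case True
      then show ?thesis using assms permutes_in_image[OF assms(2)] by blast
    next
      case F: False
      then show ?thesis using False assms(2) by (simp add: permutes_not_in)
    qed
    then show ?thesis using False assms by (simp add: permutes_not_in)
  qed
qed

text \<open>Exposes the cycle through \<open>x\<close> as a coordinate independent of the rest, so
  that permutations differing only in that cycle can be compared.\<close>

lemma bij_betw_fixed_orbit:
  assumes x: "x \<in> V" and V: "V \<subseteq> {..<N}"
  shows "bij_betw (\<lambda>(c, h). c \<circ> h) (cycles_on V \<times> {h. h permutes ({..<N} - V)})
    {\<sigma>. \<sigma> permutes {..<N} \<and> orbit \<sigma> x = V}"
proof (rule bij_betw_byWitness[where f' = "\<lambda>\<sigma>. (perm_restrict \<sigma> V, perm_restrict \<sigma> ({..<N} - V))"])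
  have fV: "finite V" using V finite_subset by blast
  show "\<forall>p\<in>cycles_on V \<times> {h. h permutes ({..<N} - V)}.
      (\<lambda>\<sigma>. (perm_restrict \<sigma> V, perm_restrict \<sigma> ({..<N} - V))) ((\<lambda>(c, h). c \<circ> h) p) = p"
  proof
    fix p assume "p \<in> cycles_on V \<times> {h. h permutes ({..<N} - V)}"
    then obtain c h where p: "p = (c, h)" and c: "c permutes V" and h: "h permutes ({..<N} - V)"
      by (auto dest: cycles_onD)
    have "perm_restrict (c \<circ> h) V = c"
      using permutes_not_in[OF c] permutes_not_in[OF h] by (auto simp: fun_eq_iff perm_restrict_def)
    moreover have "perm_restrict (c \<circ> h) ({..<N} - V) = h"
    proof
      fix y
      show "perm_restrict (c \<circ> h) ({..<N} - V) y = h y"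
      proof (cases "y \<in> {..<N} - V")
        case True
        then have "h y \<notin> V" using permutes_in_image[OF h] by blast
        then show ?thesis using True by (simp add: perm_restrict_def permutes_not_in[OF c])
      next
        case False
        then show ?thesis using permutes_not_in[OF h False] by (simp only: perm_restrict_def if_False)
      qed
    qed
    ultimately show "(\<lambda>\<sigma>. (perm_restrict \<sigma> V, perm_restrict \<sigma> ({..<N} - V))) ((\<lambda>(c, h). c \<circ> h) p) = p"
      by (simp add: p)
  qed
  have cyc: "cyclic_on \<sigma> V" if "\<sigma> permutes {..<N}" "orbit \<sigma> x = V" for \<sigma>
    using cyclic_on_orbit[OF that(1)] that(2) by auto
  show "\<forall>\<sigma>\<in>{\<sigma>. \<sigma> permutes {..<N} \<and> orbit \<sigma> x = V}.
      (\<lambda>(c, h). c \<circ> h) ((\<lambda>\<sigma>. (perm_restrict \<sigma> V, perm_restrict \<sigma> ({..<N} - V))) \<sigma>) = \<sigma>"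
  proof
    fix \<sigma> assume "\<sigma> \<in> {\<sigma>. \<sigma> permutes {..<N} \<and> orbit \<sigma> x = V}"
    then have \<sigma>: "\<sigma> permutes {..<N}" "orbit \<sigma> x = V" by auto
    have "V \<union> ({..<N} - V) = {..<N}" using V by blast
    moreover have "y \<in> V" if "\<sigma> y \<in> V" for y
      using cyclic_on_f_in[OF \<sigma>(1) cyc[OF \<sigma>] that] .
    ultimately have "perm_restrict \<sigma> V \<circ> perm_restrict \<sigma> ({..<N} - V) = perm_restrict \<sigma> {..<N}"
      using V by (auto simp: fun_eq_iff perm_restrict_def)
    then show "(\<lambda>(c, h). c \<circ> h) ((\<lambda>\<sigma>. (perm_restrict \<sigma> V, perm_restrict \<sigma> ({..<N} - V))) \<sigma>) = \<sigma>"
      using \<sigma> by simp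
  qed
  show "(\<lambda>(c, h). c \<circ> h) ` (cycles_on V \<times> {h. h permutes ({..<N} - V)})
      \<subseteq> {\<sigma>. \<sigma> permutes {..<N} \<and> orbit \<sigma> x = V}"
  proof
    fix \<sigma> assume "\<sigma> \<in> (\<lambda>(c, h). c \<circ> h) ` (cycles_on V \<times> {h. h permutes ({..<N} - V)})"
    then obtain c h where s: "\<sigma> = c \<circ> h" and c: "c \<in> cycles_on V" and h: "h permutes ({..<N} - V)"
      by auto
    have "\<sigma> permutes {..<N}" unfolding s
      using permutes_compose[OF permutes_subset[OF h] permutes_subset[OF cycles_onD(1)[OF c]]] V by blast
    moreover have "cyclic_on c V" using c by (simp add: cycles_on_def)
    then have co: "orbit c x = V" by (rule orbit_cyclic_eq3) (rule x)
    have "orbit \<sigma> x = orbit c x"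
    proof (rule orbit_cong)
      show "x \<in> orbit c x" using co x by simp
      fix y assume "y \<in> orbit c x"
      then have "y \<notin> {..<N} - V" using co by simp
      then show "\<sigma> y = c y" using permutes_not_in[OF h] s by simp
    qed
    ultimately show "\<sigma> \<in> {\<sigma>. \<sigma> permutes {..<N} \<and> orbit \<sigma> x = V}" using co by simp
  qed
  show "(\<lambda>\<sigma>. (perm_restrict \<sigma> V, perm_restrict \<sigma> ({..<N} - V))) ` {\<sigma>. \<sigma> permutes {..<N} \<and> orbit \<sigma> x = V}
      \<subseteq> cycles_on V \<times> {h. h permutes ({..<N} - V)}"
  proof
    fix p assume "p \<in> (\<lambda>\<sigma>. (perm_restrict \<sigma> V, perm_restrict \<sigma> ({..<N} - V))) ` {\<sigma>. \<sigma> permutes {..<N} \<and> orbit \<sigma> x = V}"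
    then obtain \<sigma> where p: "p = (perm_restrict \<sigma> V, perm_restrict \<sigma> ({..<N} - V))"
      and \<sigma>: "\<sigma> permutes {..<N}" "orbit \<sigma> x = V" by blast
    note cy = cyc[OF \<sigma>]
    have "perm_restrict \<sigma> V permutes V"
    proof (rule inj_imp_permutes)
      show "inj_on (perm_restrict \<sigma> V) V"
        using permutes_inj_on[OF \<sigma>(1)] by (auto simp: inj_on_def perm_restrict_def)
    qed (use fV cyclic_on_inI[OF cy] in \<open>auto simp: perm_restrict_def\<close>)
    moreover have "cyclic_on (perm_restrict \<sigma> V) V" using cy by (simp add: cyclic_on_perm_restrict)
    ultimately show "p \<in> cycles_on V \<times> {h. h permutes ({..<N} - V)}"
      using perm_restrict_diff_cyclic[OF \<sigma>(1) cy] by (simp add: p cycles_on_def)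
  qed
qed

text \<open>Conjugation by a permutation of \<open>V\<close> takes any cycle on \<open>V\<close> to
  any other and leaves the part outside \<open>V\<close> alone. Given \<open>V\<close> and the outer
  part, the cycle through \<open>x\<close> is therefore uniform, and its average can be bounded by
  \<open>F\<close>.\<close>

lemma fixed_orbit_sum_ge:
  assumes N: "N > 0" and x: "x \<in> V" and V: "V \<subseteq> {..<N}" and g: "g permutes {..<N}"
    and F: "\<And>g. g permutes {..<N} \<Longrightarrow> right_avg (cycles_on V) F g \<ge> z"
  shows "(\<Sum>\<sigma> | \<sigma> permutes {..<N} \<and> orbit \<sigma> x = V. trans_dist N t \<sigma> * F (g \<circ> \<sigma>))
    \<ge> (\<Sum>\<sigma> | \<sigma> permutes {..<N} \<and> orbit \<sigma> x = V. trans_dist N t \<sigma> * z)"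
proof -
  have fV: "finite V" using V finite_subset by blast
  let ?C = "cycles_on V" and ?H = "{h. h permutes ({..<N} - V)}" and ?w = "trans_dist N t"
  have cpos: "real (card ?C) > 0" using card_cycles_on[OF fV] x by (metis empty_iff fact_gt_zero of_nat_0_less_iff)
  then obtain c0 where c0: "c0 \<in> ?C" by (auto simp: card_gt_0_iff)
  have w: "?w (c \<circ> h) = ?w (c0 \<circ> h)" if c: "c \<in> ?C" and h: "h \<in> ?H" for c h
  proof -
    obtain p where p: "p permutes V" "p \<circ> c0 = c \<circ> p" using cycles_on_conjugate[OF fV c0 c] by blast
    have pN: "p permutes {..<N}" using permutes_subset[OF p(1) V] .
    have hp: "p \<circ> h = h \<circ> p" using permutes_disjoint_commute[OF p(1)] h by blast
    have "p \<circ> (c0 \<circ> h) \<circ> inv p = (c \<circ> p) \<circ> h \<circ> inv p" using p(2) by (simp only: comp_assoc[symmetric])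
    also have "\<dots> = c \<circ> h \<circ> (p \<circ> inv p)" using hp by (simp only: comp_assoc)
    also have "\<dots> = c \<circ> h" by (simp add: permutes_inv_o[OF p(1)])
    finally show ?thesis using trans_dist_conj[OF pN, of t "c0 \<circ> h"] by simp
  qed
  have conv: "(\<Sum>\<sigma> | \<sigma> permutes {..<N} \<and> orbit \<sigma> x = V. ?w \<sigma> * G \<sigma>)
      = (\<Sum>h\<in>?H. ?w (c0 \<circ> h) * (\<Sum>c\<in>?C. G (c \<circ> h)))" for G
  proof -
    have "(\<Sum>\<sigma> | \<sigma> permutes {..<N} \<and> orbit \<sigma> x = V. ?w \<sigma> * G \<sigma>)
        = (\<Sum>(c, h)\<in>?C \<times> ?H. ?w (c \<circ> h) * G (c \<circ> h))"
      by (subst sum.reindex_bij_betw[OF bij_betw_fixed_orbit[OF x V], symmetric])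
         (simp add: case_prod_unfold)
    also have "\<dots> = (\<Sum>c\<in>?C. \<Sum>h\<in>?H. ?w (c \<circ> h) * G (c \<circ> h))"
      by (simp add: sum.cartesian_product)
    also have "\<dots> = (\<Sum>h\<in>?H. \<Sum>c\<in>?C. ?w (c \<circ> h) * G (c \<circ> h))" by (rule sum.swap)
    also have "\<dots> = (\<Sum>h\<in>?H. ?w (c0 \<circ> h) * (\<Sum>c\<in>?C. G (c \<circ> h)))"
      unfolding sum_distrib_left using w by (intro sum.cong refl) auto
    finally show ?thesis .
  qed
  show ?thesis
    unfolding conv
  proof (rule sum_mono, rule mult_left_mono)
    fix h assume h: "h \<in> ?H"
    then have hN: "h permutes {..<N}" using permutes_subset[of h "{..<N} - V" "{..<N}"] by blast
    have c0N: "c0 permutes {..<N}" using permutes_subset[OF cycles_onD(1)[OF c0] V] .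
    show "0 \<le> ?w (c0 \<circ> h)"
      using trans_dist_nonneg[OF N permutes_compose[OF hN c0N]] .
    have "(\<Sum>c\<in>?C. F (g \<circ> (c \<circ> h))) = (\<Sum>c\<in>?C. F (g \<circ> h \<circ> c))"
    proof (rule sum.cong[OF refl])
      fix c assume "c \<in> ?C"
      then have "c \<circ> h = h \<circ> c" using permutes_disjoint_commute[OF cycles_onD(1)] h by blast
      then show "F (g \<circ> (c \<circ> h)) = F (g \<circ> h \<circ> c)" by (simp add: comp_assoc)
    qed
    moreover have "right_avg ?C F (g \<circ> h) \<ge> z" using F[OF permutes_compose[OF hN g]] .
    ultimately show "(\<Sum>c\<in>?C. z) \<le> (\<Sum>c\<in>?C. F (g \<circ> (c \<circ> h)))"
      using cpos by (simp add: right_avg_def pos_le_divide_eq mult.commute)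
  qed
qed

text \<open>The bound holds for each card \<open>x\<close>; the mean over \<open>x\<close> is taken
  because the available information, \<open>orbit_mass\<close>, concerns the cycle of a uniform
  card.\<close>

lemma trans_op_orbit_average_ge:
  assumes N: "N > 0" and g: "g permutes {..<N}"
    and F: "\<And>V g. V \<subseteq> {..<N} \<Longrightarrow> V \<noteq> {} \<Longrightarrow> g permutes {..<N} \<Longrightarrow> right_avg (cycles_on V) F g \<ge> z V"
  shows "(trans_op N ^^ t) F g
    \<ge> (\<Sum>x<N. \<Sum>\<sigma> | \<sigma> permutes {..<N}. trans_dist N t \<sigma> / real N * z (orbit \<sigma> x))"
proof -
  let ?G = "{\<sigma>. \<sigma> permutes {..<N}}" and ?w = "trans_dist N t"
  have fG: "finite ?G" by (simp add: finite_permutations)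
  have x: "(\<Sum>\<sigma>\<in>?G. ?w \<sigma> * z (orbit \<sigma> x)) \<le> (trans_op N ^^ t) F g" if x: "x < N" for x
  proof -
    have group: "(\<Sum>V\<in>Pow {..<N}. \<Sum>\<sigma> | \<sigma> permutes {..<N} \<and> orbit \<sigma> x = V. k \<sigma>) = (\<Sum>\<sigma>\<in>?G. k \<sigma>)"
      for k :: "(nat \<Rightarrow> nat) \<Rightarrow> real"
      using sum.group[OF fG, of "Pow {..<N}" "\<lambda>\<sigma>. orbit \<sigma> x" k] permutes_orbit_subset[of _ "{..<N}" x] x
      by (simp add: image_subset_iff Collect_conj_eq)
    have "(\<Sum>\<sigma>\<in>?G. ?w \<sigma> * z (orbit \<sigma> x))
        = (\<Sum>V\<in>Pow {..<N}. \<Sum>\<sigma> | \<sigma> permutes {..<N} \<and> orbit \<sigma> x = V. ?w \<sigma> * z V)"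
      by (subst group[symmetric]) simp
    also have "\<dots> \<le> (\<Sum>V\<in>Pow {..<N}. \<Sum>\<sigma> | \<sigma> permutes {..<N} \<and> orbit \<sigma> x = V. ?w \<sigma> * F (g \<circ> \<sigma>))"
    proof (rule sum_mono)
      fix V assume V: "V \<in> Pow {..<N}"
      show "(\<Sum>\<sigma> | \<sigma> permutes {..<N} \<and> orbit \<sigma> x = V. ?w \<sigma> * z V)
          \<le> (\<Sum>\<sigma> | \<sigma> permutes {..<N} \<and> orbit \<sigma> x = V. ?w \<sigma> * F (g \<circ> \<sigma>))"
      proof (cases "x \<in> V")
        case True
        then show ?thesis using V F by (intro fixed_orbit_sum_ge[OF N True _ g]) auto
      next
        case False
        then have "{\<sigma>. \<sigma> permutes {..<N} \<and> orbit \<sigma> x = V} = {}"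
          using self_in_orbit_permutes by blast
        then show ?thesis by (simp only: sum.empty)
      qed
    qed
    also have "\<dots> = (trans_op N ^^ t) F g" unfolding group trans_dist_kernel ..
    finally show ?thesis .
  qed
  have "(\<Sum>x<N. \<Sum>\<sigma>\<in>?G. ?w \<sigma> / real N * z (orbit \<sigma> x)) = (\<Sum>x<N. (\<Sum>\<sigma>\<in>?G. ?w \<sigma> * z (orbit \<sigma> x))) / real N"
    by (simp add: sum_divide_distrib)
  also have "\<dots> \<le> (\<Sum>x<N. (trans_op N ^^ t) F g) / real N"
    using x by (intro divide_right_mono sum_mono) auto
  also have "\<dots> = (trans_op N ^^ t) F g" using N by simp
  finally show ?thesis .
qed

section \<open>Producing a uniformly arranged block\<close>

text \<open>The expected overlap of two independent samples is the sum of the squared covering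
  probabilities \<open>d y\<close>, at least \<open>N / 16\<close> by Cauchy-Schwarz, here in the
  form of a nonnegative variance. An overlap is at most \<open>w\<close>, plus \<open>N\<close> if
  it reaches \<open>w\<close>.\<close>

lemma overlap_mass_ge:
  fixes \<mu> :: "'a \<Rightarrow> real" and V :: "'a \<Rightarrow> nat set"
  assumes fin: "finite \<Omega>" and pos: "\<And>i. i \<in> \<Omega> \<Longrightarrow> \<mu> i \<ge> 0" and one: "(\<Sum>i\<in>\<Omega>. \<mu> i) = 1"
    and V: "\<And>i. i \<in> \<Omega> \<Longrightarrow> V i \<subseteq> {..<N}" and N: "N > 0"
    and big: "(\<Sum>i\<in>\<Omega>. \<mu> i * real (card (V i))) \<ge> real N / 4"
  shows "(\<Sum>i\<in>\<Omega>. \<Sum>j\<in>\<Omega>. \<mu> i * \<mu> j * (if w \<le> card (V i \<inter> V j) then 1 else 0)) \<ge> 1 / 16 - real w / real N"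
proof -
  define d where "d y = (\<Sum>i\<in>\<Omega>. \<mu> i * (if y \<in> V i then 1 else 0))" for y
  have ind: "(\<Sum>y<N. if y \<in> X then 1 else 0) = real (card X)" if "X \<subseteq> {..<N}" for X
    using that by (simp add: sum.If_cases Int_absorb1)
  have sumd: "(\<Sum>y<N. d y) = (\<Sum>i\<in>\<Omega>. \<mu> i * real (card (V i)))"
  proof -
    have "(\<Sum>y<N. d y) = (\<Sum>i\<in>\<Omega>. \<Sum>y<N. \<mu> i * (if y \<in> V i then 1 else 0))"
      unfolding d_def by (rule sum.swap)
    also have "\<dots> = (\<Sum>i\<in>\<Omega>. \<mu> i * real (card (V i)))"
      unfolding sum_distrib_left[symmetric] using ind[OF V] by (intro sum.cong refl) auto
    finally show ?thesis .
  qed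
  have sq: "(\<Sum>y<N. (d y)\<^sup>2) = (\<Sum>i\<in>\<Omega>. \<Sum>j\<in>\<Omega>. \<mu> i * \<mu> j * real (card (V i \<inter> V j)))"
  proof -
    have "(\<Sum>y<N. (d y)\<^sup>2) = (\<Sum>y<N. \<Sum>i\<in>\<Omega>. \<Sum>j\<in>\<Omega>. \<mu> i * \<mu> j * (if y \<in> V i \<inter> V j then 1 else 0))"
      unfolding d_def power2_eq_square sum_product by (intro sum.cong refl) auto
    also have "\<dots> = (\<Sum>i\<in>\<Omega>. \<Sum>j\<in>\<Omega>. \<Sum>y<N. \<mu> i * \<mu> j * (if y \<in> V i \<inter> V j then 1 else 0))"
      by (subst sum.swap, rule sum.cong[OF refl], rule sum.swap)
    also have "\<dots> = (\<Sum>i\<in>\<Omega>. \<Sum>j\<in>\<Omega>. \<mu> i * \<mu> j * real (card (V i \<inter> V j)))"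
      unfolding sum_distrib_left[symmetric] using V by (intro sum.cong refl) (subst ind, auto)
    finally show ?thesis .
  qed
  let ?D = "\<Sum>y<N. d y"
  define m where "m = ?D / real N"
  have "0 \<le> (\<Sum>y<N. (d y - m)\<^sup>2)" by (intro sum_nonneg) auto
  also have "\<dots> = (\<Sum>y<N. (d y)\<^sup>2) + real N * m\<^sup>2 - 2 * m * ?D"
    by (simp add: power2_diff sum.distrib sum_subtractf sum_distrib_left mult_ac)
  also have "\<dots> = (\<Sum>y<N. (d y)\<^sup>2) - ?D\<^sup>2 / real N"
    using N by (simp add: m_def power2_eq_square)
  finally have "(\<Sum>y<N. (d y)\<^sup>2) \<ge> ?D\<^sup>2 / real N" by simp
  moreover have "?D\<^sup>2 / real N \<ge> (real N / 4)\<^sup>2 / real N"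
    using big unfolding sumd by (intro divide_right_mono power_mono) auto
  moreover have "(real N / 4)\<^sup>2 / real N = real N / 16" using N by (simp add: power2_eq_square)
  ultimately have low: "(\<Sum>i\<in>\<Omega>. \<Sum>j\<in>\<Omega>. \<mu> i * \<mu> j * real (card (V i \<inter> V j))) \<ge> real N / 16"
    unfolding sq by linarith
  let ?I = "\<Sum>i\<in>\<Omega>. \<Sum>j\<in>\<Omega>. \<mu> i * \<mu> j * (if w \<le> card (V i \<inter> V j) then 1 else 0)"
  have "(\<Sum>i\<in>\<Omega>. \<Sum>j\<in>\<Omega>. \<mu> i * \<mu> j * real (card (V i \<inter> V j)))
      \<le> (\<Sum>i\<in>\<Omega>. \<Sum>j\<in>\<Omega>. \<mu> i * \<mu> j * (real w + real N * (if w \<le> card (V i \<inter> V j) then 1 else 0)))"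
  proof (intro sum_mono mult_left_mono mult_nonneg_nonneg pos)
    fix i j assume "i \<in> \<Omega>" "j \<in> \<Omega>"
    then have "card (V i \<inter> V j) \<le> N"
      using card_mono[of "{..<N}" "V i \<inter> V j"] V by (metis card_lessThan finite_lessThan inf.coboundedI1)
    then show "real (card (V i \<inter> V j)) \<le> real w + real N * (if w \<le> card (V i \<inter> V j) then 1 else 0)"
      by auto
  qed
  also have "\<dots> = (\<Sum>i\<in>\<Omega>. \<Sum>j\<in>\<Omega>. \<mu> i * \<mu> j * real w) + real N * ?I"
    by (simp add: sum.distrib distrib_left sum_distrib_left mult_ac)
  also have "(\<Sum>i\<in>\<Omega>. \<Sum>j\<in>\<Omega>. \<mu> i * \<mu> j * real w) = real w"
    using one by (simp add: sum_distrib_left[symmetric] sum_distrib_right[symmetric])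
  finally have "real N / 16 \<le> real w + real N * ?I" using low by linarith
  then have "1 / 16 \<le> (real w + real N * ?I) / real N" using N by (simp add: field_simps)
  then show ?thesis using N by (simp add: add_divide_distrib)
qed

text \<open>One attempt spends \<open>t\<close> steps on each cycle and \<open>N\<close> steps on
  parity. Both cycles use the same \<open>t\<close>, so their supports are two samples of one law,
  as the overlap estimate presupposes.\<close>

lemma trans_op_attempt:
  assumes N: "N > 0" and w: "w \<ge> 2"
  obtains s where "s > 0" "s \<le> 5 * N"
    "\<And>f q g. block_uniform N w q f \<Longrightarrow> q \<ge> 0 \<Longrightarrow> g permutes {..<N} \<Longrightarrow>
      (trans_op N ^^ s) f g \<ge> (1 / 16 - real w / real N) * (real w * (real w - 1) / (3 * real N ^ 2)) * q"
proof -
  obtain t where t: "t < 2 * N" "(trans_op N ^^ t) (orbit_mass N) id \<ge> 1 / 4"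
    using ex_large_orbit_mass[OF N] by blast
  let ?G = "{\<sigma>. \<sigma> permutes {..<N}}"
  define \<Omega> where "\<Omega> = {..<N} \<times> ?G"
  define \<mu> where "\<mu> i = trans_dist N t (snd i) / real N" for i :: "nat \<times> (nat \<Rightarrow> nat)"
  define V where "V i = orbit (snd i) (fst i)" for i :: "nat \<times> (nat \<Rightarrow> nat)"
  have fG: "finite ?G" by (simp add: finite_permutations)
  have fin: "finite \<Omega>" using fG by (simp add: \<Omega>_def)
  have sum\<Omega>: "(\<Sum>x<N. \<Sum>\<sigma>\<in>?G. trans_dist N t \<sigma> / real N * k (orbit \<sigma> x)) = (\<Sum>i\<in>\<Omega>. \<mu> i * k (V i))"
    for k :: "nat set \<Rightarrow> real"
    unfolding \<Omega>_def \<mu>_def V_def by (simp add: sum.cartesian_product case_prod_unfold)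
  have pos: "\<mu> i \<ge> 0" if "i \<in> \<Omega>" for i
    using that trans_dist_nonneg[OF N] by (auto simp: \<Omega>_def \<mu>_def)
  have one: "(\<Sum>i\<in>\<Omega>. \<mu> i) = 1"
    using sum\<Omega>[of "\<lambda>_. 1"] trans_dist_sum[OF N, of t] N by (simp add: sum_divide_distrib[symmetric])
  have VN: "V i \<subseteq> {..<N}" "V i \<noteq> {}" if "i \<in> \<Omega>" for i
    using that permutes_orbit_subset[of "snd i" "{..<N}" "fst i"] orbit_nonempty[of "snd i" "fst i"]
    by (auto simp: \<Omega>_def V_def)
  have big: "(\<Sum>i\<in>\<Omega>. \<mu> i * real (card (V i))) \<ge> real N / 4"
  proof -
    have "(trans_op N ^^ t) (orbit_mass N) id = (\<Sum>\<sigma>\<in>?G. trans_dist N t \<sigma> * orbit_mass N \<sigma>)"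
      using trans_dist_kernel[where g = id and N = N and t = t and f = "orbit_mass N"]
      by (simp only: id_comp)
    also have "\<dots> = (\<Sum>\<sigma>\<in>?G. \<Sum>x<N. trans_dist N t \<sigma> / real N * real (card (orbit \<sigma> x))) / real N"
      by (simp add: orbit_mass_def sum_distrib_left sum_divide_distrib power2_eq_square)
    also have "(\<Sum>\<sigma>\<in>?G. \<Sum>x<N. trans_dist N t \<sigma> / real N * real (card (orbit \<sigma> x)))
        = (\<Sum>i\<in>\<Omega>. \<mu> i * real (card (V i)))"
      unfolding sum\<Omega>[of "\<lambda>X. real (card X)", symmetric] by (rule sum.swap)
    finally have "1 / 4 \<le> (\<Sum>i\<in>\<Omega>. \<mu> i * real (card (V i))) / real N" using t(2) by linarith
    then show ?thesis using N by (simp add: field_simps)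
  qed
  note overlap = overlap_mass_ge[OF fin pos one VN(1) N big, of w]
  define c where "c = real w * (real w - 1) / (3 * real N ^ 2)"
  have c0: "c \<ge> 0" using w by (simp add: c_def)
  have mass: "(\<Sum>r<N. \<Sum>l<N. 1 / real N ^ 2) = 1" by (rule trans_op_mass[OF N])
  show thesis
  proof (rule that[of "t + (t + N)"])
    show "t + (t + N) > 0" "t + (t + N) \<le> 5 * N" using t N by auto
    fix f :: "(nat \<Rightarrow> nat) \<Rightarrow> real" and q and g :: "nat \<Rightarrow> nat"
    assume f: "block_uniform N w q f" and q: "q \<ge> 0" and g: "g permutes {..<N}"
    define F where "F = (trans_op N ^^ N) f"
    define I :: "nat set \<Rightarrow> nat set \<Rightarrow> real" where "I X X' = (if w \<le> card (X \<inter> X') then 1 else 0)" for X X'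
    have F0: "F g \<ge> 0" if "g permutes {..<N}" for g
      unfolding F_def trans_op_def
      by (rule funpow_move_op_ge_const) (use that f mass in \<open>auto simp: block_uniform_def\<close>)
    have cyc: "finite (cycles_on X)" "cycles_on X \<noteq> {}" "\<And>h. h \<in> cycles_on X \<Longrightarrow> h permutes {..<N}"
      if "X \<subseteq> {..<N}" "X \<noteq> {}" for X
    proof -
      have fX: "finite X" using that finite_subset by blast
      show "finite (cycles_on X)" by (rule finite_cycles_on[OF fX])
      have "card (cycles_on X) > 0" using card_cycles_on[OF fX that(2)] by simp
      then show "cycles_on X \<noteq> {}" by (auto simp: card_gt_0_iff)
      show "h permutes {..<N}" if "h \<in> cycles_on X" for h
        using permutes_subset[OF cycles_onD(1)[OF that]] \<open>X \<subseteq> {..<N}\<close> by blast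
    qed
    have two: "right_avg (cycles_on X) (right_avg (cycles_on X') F) g \<ge> c * q * I X X'"
      if X: "X \<subseteq> {..<N}" "X \<noteq> {}" and X': "X' \<subseteq> {..<N}" "X' \<noteq> {}" and g: "g permutes {..<N}" for X X' g
    proof (cases "w \<le> card (X \<inter> X')")
      case True
      have "right_avg (cycles_on ((X - X') \<union> (X \<inter> X')))
          (right_avg (cycles_on ((X' - X) \<union> (X \<inter> X'))) ((trans_op N ^^ N) f)) g
          \<ge> real w * (real w - 1) / (3 * real N ^ 2) * q"
        using X X' True finite_subset[of X "{..<N}"] finite_subset[of X' "{..<N}"]
        by (intro two_cycles_overlap_ge[OF f q w _ _ _ _ _ _ _ _ g]) auto
      moreover have "(X - X') \<union> (X \<inter> X') = X" "(X' - X) \<union> (X \<inter> X') = X'" by auto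
      ultimately show ?thesis using True by (simp add: c_def I_def F_def)
    next
      case False
      have "0 \<le> right_avg (cycles_on X) (right_avg (cycles_on X') F) g"
        using F0 g cyc[OF X] cyc[OF X'] by (intro right_avg_ge_const) (auto intro: permutes_compose)
      then show ?thesis using False by (simp add: I_def)
    qed
    define z where "z X = (\<Sum>j\<in>\<Omega>. \<mu> j * (c * q * I (V j) X))" for X
    have "right_avg (cycles_on X) ((trans_op N ^^ t) F) g \<ge> z X"
      if X: "X \<subseteq> {..<N}" "X \<noteq> {}" and g: "g permutes {..<N}" for X g
    proof -
      have "(trans_op N ^^ t) (right_avg (cycles_on X) F) g
          \<ge> (\<Sum>x<N. \<Sum>\<sigma>\<in>?G. trans_dist N t \<sigma> / real N * (c * q * I (orbit \<sigma> x) X))"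
        by (rule trans_op_orbit_average_ge[OF N g]) (use two X in auto)
      \<comment> \<open>Centrality brings the average over the cycle already obtained below the
        second batch of steps, which makes the two cycles adjacent.\<close>
      moreover have "(trans_op N ^^ t) (right_avg (cycles_on X) F) = right_avg (cycles_on X) ((trans_op N ^^ t) F)"
        by (rule funpow_trans_op_right_avg) (use cyc[OF X] in auto)
      ultimately show ?thesis unfolding z_def sum\<Omega>[of "\<lambda>Y. c * q * I Y X"] by simp
    qed
    then have "(trans_op N ^^ t) ((trans_op N ^^ t) F) g
        \<ge> (\<Sum>x<N. \<Sum>\<sigma>\<in>?G. trans_dist N t \<sigma> / real N * z (orbit \<sigma> x))"
      by (intro trans_op_orbit_average_ge[OF N g]) auto
    also have "(\<Sum>x<N. \<Sum>\<sigma>\<in>?G. trans_dist N t \<sigma> / real N * z (orbit \<sigma> x))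
        = c * q * (\<Sum>i\<in>\<Omega>. \<Sum>j\<in>\<Omega>. \<mu> i * \<mu> j * (if w \<le> card (V i \<inter> V j) then 1 else 0))"
      unfolding sum\<Omega>[of z] unfolding z_def I_def
      by (simp add: sum_distrib_left mult_ac Int_commute)
    finally have "(trans_op N ^^ t) ((trans_op N ^^ t) F) g
        \<ge> c * q * (\<Sum>i\<in>\<Omega>. \<Sum>j\<in>\<Omega>. \<mu> i * \<mu> j * (if w \<le> card (V i \<inter> V j) then 1 else 0))" .
    moreover have "c * q * (1 / 16 - real w / real N)
        \<le> c * q * (\<Sum>i\<in>\<Omega>. \<Sum>j\<in>\<Omega>. \<mu> i * \<mu> j * (if w \<le> card (V i \<inter> V j) then 1 else 0))"
      by (rule mult_left_mono[OF overlap]) (use c0 q in auto)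
    ultimately show "(trans_op N ^^ (t + (t + N))) f g
        \<ge> (1 / 16 - real w / real N) * (real w * (real w - 1) / (3 * real N ^ 2)) * q"
      by (simp add: funpow_add F_def c_def mult_ac)
  qed
qed

section \<open>From one attempt to geometric convergence\<close>

lemma block_uniform_mono_const:
  assumes f: "block_uniform N w q f" and r: "\<And>g. g permutes {..<N} \<Longrightarrow> f g \<ge> r"
  shows "block_uniform N w (q - r) (\<lambda>g. f g - r)"
  unfolding block_uniform_def
proof (intro conjI allI impI)
  fix Y and g :: "nat \<Rightarrow> nat" assume Y: "Y \<subseteq> {..<N}" "w \<le> card Y" "g permutes {..<N}"
  have fY: "finite Y" using Y finite_subset by blast
  have "right_avg {p. p permutes Y} (\<lambda>g. f g - r) g = right_avg {p. p permutes Y} f g - r"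
    by (simp add: right_avg_def sum_subtractf card_permutations[OF refl fY] diff_divide_distrib)
  then show "right_avg {p. p permutes Y} (\<lambda>g. f g - r) g \<ge> q - r"
    using f Y by (auto simp: block_uniform_def)
qed (use r in auto)

lemma block_uniform_trans_op:
  assumes f: "block_uniform N w q f" and N: "N > 0"
  shows "block_uniform N w q ((trans_op N ^^ t) f)"
  unfolding block_uniform_def
proof (intro conjI allI impI)
  note mass = trans_op_mass[OF N]
  fix g :: "nat \<Rightarrow> nat" assume g: "g permutes {..<N}"
  then show "(trans_op N ^^ t) f g \<ge> 0"
    unfolding trans_op_def
    by (intro funpow_move_op_ge_const) (use f mass in \<open>auto simp: block_uniform_def\<close>)
  fix Y assume Y: "Y \<subseteq> {..<N}" "w \<le> card Y"
  have fY: "finite Y" using Y finite_subset by blast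
  have "right_avg {p. p permutes Y} ((trans_op N ^^ t) f) g = (trans_op N ^^ t) (right_avg {p. p permutes Y} f) g"
    by (subst funpow_trans_op_right_avg)
       (use finite_permutations[OF fY] Y permutes_subset in auto)
  also have "\<dots> \<ge> q"
    unfolding trans_op_def
    by (intro funpow_move_op_ge_const) (use f g Y mass in \<open>auto simp: block_uniform_def\<close>)
  finally show "right_avg {p. p permutes Y} ((trans_op N ^^ t) f) g \<ge> q" .
qed

text \<open>When \<open>r\<close> is guaranteed everywhere, subtracting it leaves a nonnegative
  function with block bound \<open>q - r\<close>, and a further attempt recovers the fraction
  \<open>c\<close> of what is still missing.\<close>

lemma trans_op_repeated_attempts:
  assumes N: "N > 0" and s: "s > 0" and c: "0 \<le> c" "c \<le> 1" and q: "q \<ge> 0"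
    and att: "\<And>f q g. block_uniform N w q f \<Longrightarrow> q \<ge> 0 \<Longrightarrow> g permutes {..<N} \<Longrightarrow> (trans_op N ^^ s) f g \<ge> c * q"
    and f: "block_uniform N w q f" and g: "g permutes {..<N}"
  shows "(trans_op N ^^ (K * s + j)) f g \<ge> (1 - (1 - c) ^ K) * q"
  using g
proof (induction K arbitrary: g)
  case 0
  then show ?case using block_uniform_trans_op[OF f N, of j] by (simp add: block_uniform_def)
next
  case (Suc K)
  define r where "r = (1 - (1 - c) ^ K) * q"
  define h where "h = (trans_op N ^^ (K * s + j)) f"
  have r: "0 \<le> q - r" using c q by (simp add: r_def algebra_simps)
  have "block_uniform N w (q - r) (\<lambda>g. h g - r)"
    using block_uniform_trans_op[OF f N] Suc.IH by (intro block_uniform_mono_const) (auto simp: h_def r_def)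
  from att[OF this r Suc.prems] have "c * (q - r) \<le> (trans_op N ^^ s) (\<lambda>g. h g - r) g" .
  also have "\<dots> = (trans_op N ^^ s) h g - r"
    unfolding trans_op_def by (simp add: funpow_move_op_diff funpow_move_op_const[OF trans_op_mass[OF N]])
  also have "(trans_op N ^^ s) h = (trans_op N ^^ (Suc K * s + j)) f"
    by (simp add: h_def funpow_add add.assoc)
  finally have "(trans_op N ^^ (Suc K * s + j)) f g \<ge> r + c * (q - r)" by simp
  also have "r + c * (q - r) = (1 - (1 - c) ^ Suc K) * q" by (simp add: r_def algebra_simps)
  finally show ?case .
qed

text \<open>Rounding \<open>j\<close> down to whole attempts costs a factor \<open>exp 1\<close>, at
  most 3. The error is brought into the form of a pure power in \<open>j\<close> because such a
  power can be averaged over a binomial number of steps.\<close>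

lemma trans_op_exp_bound:
  assumes N: "N > 0" and s: "s > 0" "real s \<le> S" and c: "0 \<le> c" "c \<le> 1" and q: "q \<ge> 0"
    and att: "\<And>f q g. block_uniform N w q f \<Longrightarrow> q \<ge> 0 \<Longrightarrow> g permutes {..<N} \<Longrightarrow> (trans_op N ^^ s) f g \<ge> c * q"
    and f: "block_uniform N w q f" and g: "g permutes {..<N}"
  shows "(trans_op N ^^ j) f g \<ge> (1 - 3 * exp (- c / S) ^ j) * q"
proof -
  define K where "K = j div s"
  have j: "j = K * s + j mod s" by (simp add: K_def)
  have "real j \<le> real (K * s + s)" using j mod_less_divisor[OF s(1), of j] by linarith
  then have "real j \<le> (real K + 1) * real s" by (simp add: algebra_simps)
  then have "real j \<le> (real K + 1) * S"
    using mult_left_mono[OF s(2), of "real K + 1"] by linarith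
  then have jK: "real j / S \<le> real K + 1"
    using s by (simp add: divide_le_eq)
  have "(1 - c) ^ K \<le> exp (- c) ^ K"
    using exp_ge_add_one_self[of "- c"] c by (intro power_mono) auto
  also have "\<dots> = exp (- c * real K)" by (rule exp_of_nat2_mult[symmetric])
  also have "\<dots> \<le> exp (1 + (- c / S) * real j)"
  proof -
    have "c * (real j / S) \<le> c * (real K + 1)" using jK c by (intro mult_left_mono)
    then show ?thesis using c by (simp add: algebra_simps)
  qed
  also have "\<dots> = exp 1 * exp (- c / S) ^ j" by (simp only: exp_add exp_of_nat2_mult)
  also have "\<dots> \<le> 3 * exp (- c / S) ^ j" by (intro mult_right_mono exp_le) auto
  finally have "(1 - 3 * exp (- c / S) ^ j) * q \<le> (1 - (1 - c) ^ K) * q"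
    using q by (intro mult_right_mono) auto
  also have "\<dots> \<le> (trans_op N ^^ (K * s + j mod s)) f g"
    by (rule trans_op_repeated_attempts[OF N s(1) c q att f g])
  finally show ?thesis using j by simp
qed

text \<open>The biased walk is a mixture containing uniform transpositions with weight \<open>a\<^sup>2\<close>; these
  commute with everything.\<close>

lemma biased_early_phase:
  assumes N: "N > 0" and a: "0 < a" "a \<le> 1"
    and p: "\<And>r. r < N \<Longrightarrow> p r \<ge> a / real N" and p1: "(\<Sum>r<N. p r) = 1"
    and x: "0 \<le> x" "x \<le> 1" and q: "q \<ge> 0"
    and T: "\<And>j g. g permutes {..<N} \<Longrightarrow> (trans_op N ^^ j) f g \<ge> (1 - 3 * x ^ j) * q"
    and g: "g permutes {..<N}"
  shows "(move_op (\<lambda>r l. p r * p l) N ^^ i) f g \<ge> (1 - 3 * (1 - a\<^sup>2 * (1 - x)) ^ i) * q"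
proof -
  define P where "P = move_op (\<lambda>r l. p r * p l) N"
  \<comment> \<open>What is left of the biased step after removing uniform transpositions. It is set
    to zero outside the range since monotonicity of \<open>move_op\<close> asks for nonnegative
    weights at all pairs.\<close>
  define R where "R r l = (if r < N \<and> l < N then p r * p l - a\<^sup>2 / real N ^ 2 else 0)" for r l
  have Rpos: "R r l \<ge> 0" for r l
  proof (cases "r < N \<and> l < N")
    case True
    then have "a / real N \<le> p r" "a / real N \<le> p l" using p by auto
    moreover have "0 \<le> a / real N" using a by simp
    ultimately have "(a / real N) * (a / real N) \<le> p r * p l" by (intro mult_mono) linarith+
    then show ?thesis using True by (simp add: R_def power2_eq_square)
  qed (simp only: R_def if_False order_refl)
  have P: "P h g = a\<^sup>2 * trans_op N h g + move_op R N h g" for h g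
  proof -
    have "P h g = (\<Sum>r<N. \<Sum>l<N. a\<^sup>2 * (1 / real N ^ 2 * h (g \<circ> exch r l)) + R r l * h (g \<circ> exch r l))"
      unfolding P_def move_op_def by (intro sum.cong refl) (auto simp: R_def algebra_simps)
    then show ?thesis by (simp add: trans_op_def move_op_def sum.distrib sum_distrib_left)
  qed
  have Rmass: "(\<Sum>r<N. \<Sum>l<N. R r l) = 1 - a\<^sup>2"
  proof -
    have "(\<Sum>r<N. \<Sum>l<N. R r l) = (\<Sum>r<N. \<Sum>l<N. p r * p l - a\<^sup>2 / real N ^ 2)"
      by (intro sum.cong refl) (auto simp: R_def)
    also have "\<dots> = (\<Sum>r<N. p r) * (\<Sum>l<N. p l) - a\<^sup>2"
      using N by (simp add: sum_subtractf sum_product[symmetric] power2_eq_square)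
    finally show ?thesis by (simp add: p1)
  qed
  define y where "y = 1 - a\<^sup>2 * (1 - x)"
  \<comment> \<open>A biased step either adds one uniform transposition to the \<open>j\<close>
    collected ones or leaves \<open>j\<close> alone; hence \<open>j\<close> is general. The factor
    \<open>y ^ i\<close> is the generating function at \<open>x\<close> of the binomial number of
    uniform transpositions among \<open>i\<close> steps.\<close>
  have "\<forall>j g. g permutes {..<N} \<longrightarrow> (trans_op N ^^ j) ((P ^^ i) f) g \<ge> (1 - 3 * (x ^ j * y ^ i)) * q"
  proof (induction i)
    case 0
    then show ?case using T by simp
  next
    case (Suc i)
    show ?case
    proof (intro allI impI)
      fix j and g :: "nat \<Rightarrow> nat" assume g: "g permutes {..<N}"
      let ?h = "(trans_op N ^^ j) ((P ^^ i) f)"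
      have "(trans_op N ^^ j) ((P ^^ Suc i) f) g = P ?h g"
        unfolding P_def using trans_op_move_op_commute by simp
      also have "\<dots> = a\<^sup>2 * (trans_op N ^^ Suc j) ((P ^^ i) f) g + move_op R N ?h g"
        by (simp add: P)
      finally have 1: "(trans_op N ^^ j) ((P ^^ Suc i) f) g = \<dots>" .
      have "move_op R N (\<lambda>_. (1 - 3 * (x ^ j * y ^ i)) * q) g \<le> move_op R N ?h g"
        using Suc.IH Rpos g by (intro move_op_mono) auto
      then have 2: "(1 - a\<^sup>2) * ((1 - 3 * (x ^ j * y ^ i)) * q) \<le> move_op R N ?h g"
        by (simp add: move_op_const Rmass)
      have 3: "a\<^sup>2 * ((1 - 3 * (x ^ Suc j * y ^ i)) * q) \<le> a\<^sup>2 * (trans_op N ^^ Suc j) ((P ^^ i) f) g"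
        by (intro mult_left_mono Suc.IH[rule_format, OF g]) simp
      have "(1 - 3 * (x ^ j * y ^ Suc i)) * q
          = a\<^sup>2 * ((1 - 3 * (x ^ Suc j * y ^ i)) * q) + (1 - a\<^sup>2) * ((1 - 3 * (x ^ j * y ^ i)) * q)"
        by (simp add: y_def algebra_simps)
      then show "(1 - 3 * (x ^ j * y ^ Suc i)) * q \<le> (trans_op N ^^ j) ((P ^^ Suc i) f) g"
        using 1 2 3 by linarith
    qed
  qed
  from this[rule_format, OF g, of 0] show ?thesis by (simp add: P_def y_def)
qed

section \<open>Marking further cards\<close>

lemma right_avg_permutes_absorb:
  assumes "h permutes M"
  shows "right_avg {p. p permutes M} f (g \<circ> h) = right_avg {p. p permutes M} f g"
proof -
  have "(\<Sum>p | p permutes M. f (g \<circ> h \<circ> p)) = (\<Sum>p | p permutes M. f (g \<circ> p))"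
    by (rule sum.reindex_bij_witness[of _ "\<lambda>p. inv h \<circ> p" "\<lambda>p. h \<circ> p"])
       (use assms in \<open>auto simp: permutes_compose permutes_inv comp_assoc[symmetric] permutes_inv_o\<close>)
  then show ?thesis by (simp add: right_avg_def)
qed

lemma right_avg_permutes_exch:
  assumes "r < N" "l < N"
  shows "right_avg {p. p permutes M} (\<lambda>g. f (g \<circ> exch r l)) g
    = right_avg {p. p permutes (exch r l ` M)} f (g \<circ> exch r l)"
  using right_avg_permutes_shift[OF exch_permutes[OF assms], of M f g] by (simp only: inv_transpose_eq)

text \<open>Coset decomposition by the factors \<open>exch x b\<close>. The coset
  \<open>b = x\<close> gives the first summand: it is the move without motion that random exchanges
  of \<open>x\<close> with marked cards do not supply.\<close>

lemma right_avg_permutes_insert: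
  assumes "finite M" "x \<notin> M"
  shows "(real (card M) + 1) * right_avg {p. p permutes (insert x M)} f g
    = right_avg {p. p permutes M} f g
      + (\<Sum>c\<in>M. right_avg {p. p permutes M} (\<lambda>g. f (g \<circ> exch x c)) g)"
proof -
  have inv: "inv (exch x b \<circ> p) = inv p \<circ> exch x b" if "p permutes M" for b p
    using o_inv_distrib[OF bij_transpose permutes_bij[OF that]] by (simp only: inv_transpose_eq)
  have "(\<Sum>q | q permutes (insert x M). f (g \<circ> q)) = (\<Sum>q | q permutes (insert x M). f (g \<circ> inv q))"
    using sum_permutations_inverse[of "\<lambda>q. f (g \<circ> q)" "insert x M"] by simp
  also have "\<dots> = (\<Sum>b\<in>insert x M. \<Sum>p | p permutes M. f (g \<circ> inv (exch x b \<circ> p)))"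
    by (rule sum_over_permutations_insert[OF assms])
  also have "\<dots> = (\<Sum>b\<in>insert x M. \<Sum>p | p permutes M. f (g \<circ> (inv p \<circ> exch x b)))"
    by (intro sum.cong refl) (simp only: inv mem_Collect_eq)
  also have "\<dots> = (\<Sum>b\<in>insert x M. \<Sum>p | p permutes M. f (g \<circ> (p \<circ> exch x b)))"
    using sum_permutations_inverse[of "\<lambda>p. f (g \<circ> (p \<circ> exch x b))" M for b] by simp
  also have "\<dots> = (\<Sum>p | p permutes M. f (g \<circ> p)) + (\<Sum>c\<in>M. \<Sum>p | p permutes M. f (g \<circ> (p \<circ> exch x c)))"
    using assms by simp
  finally have *: "(\<Sum>q | q permutes (insert x M). f (g \<circ> q)) = \<dots>" .
  have c1: "real (card {p. p permutes M}) = fact (card M)"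
    using card_permutations[OF refl assms(1)] by simp
  have c2: "real (card {p. p permutes (insert x M)}) = (real (card M) + 1) * fact (card M)"
    using card_permutations[OF refl, of "insert x M"] assms by (simp add: algebra_simps)
  have k: "real (card M) + 1 \<noteq> 0" by linarith
  have "K * ((s + t) / (K * F)) = s / F + t / F" if "K \<noteq> 0" for K s t F :: real
    using that by (simp add: add_divide_distrib[symmetric])
  note aux = this[OF k]
  show ?thesis
    unfolding right_avg_def * c1 c2 aux by (simp add: sum_divide_distrib comp_assoc)
qed

text \<open>Split by which hands lie in \<open>M\<close>. Both inside: the average keeps its value
  \<open>u\<close>. Both outside: \<open>M\<close> stays marked. One on \<open>x\<close> outside and
  one on \<open>c\<close> inside, with weight \<open>\<alpha> + e c\<close>: over all
  \<open>c\<close>, the \<open>\<alpha>\<close> parts form the average over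
  \<open>insert x M\<close> up to the missing trivial coset, a deficit \<open>\<alpha> * u\<close>
  that \<open>lazy\<close> charges to the first case; the \<open>e c\<close> parts let
  \<open>x\<close> and \<open>c\<close> exchange roles. The factor 2 counts which hand holds
  \<open>x\<close>.\<close>

lemma marking_step:
  fixes p e :: "nat \<Rightarrow> real"
  assumes M: "M \<subseteq> {..<N}" and g: "g permutes {..<N}"
    and p: "\<And>c. c < N \<Longrightarrow> p c = \<alpha> + e c" and \<alpha>: "\<alpha> \<ge> 0" and e: "\<And>c. c < N \<Longrightarrow> e c \<ge> 0"
    and p1: "(\<Sum>c<N. p c) = 1"
    and lazy: "2 * \<alpha> * (\<Sum>x\<in>{..<N} - M. p x) \<le> (\<Sum>c\<in>M. p c)\<^sup>2"
    and v: "\<And>M' g. M' \<subseteq> {..<N} \<Longrightarrow> card M \<le> card M' \<Longrightarrow> g permutes {..<N} \<Longrightarrow>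
        right_avg {p. p permutes M'} f g \<ge> v M'"
  shows "right_avg {p. p permutes M} (move_op (\<lambda>r l. p r * p l) N f) g
    \<ge> v M + 2 * (\<Sum>x\<in>{..<N} - M. p x * (\<alpha> * (real (card M) + 1) * (v (insert x M) - v M)
        + (\<Sum>c\<in>M. e c * (v (insert x (M - {c})) - v M))))"
proof -
  let ?U = "\<lambda>M. right_avg {p. p permutes M} f" and ?C = "{..<N} - M" and ?k = "real (card M) + 1"
  have fM: "finite M" using M finite_subset by blast
  define B where "B r l = right_avg {p. p permutes M} (\<lambda>g. f (g \<circ> exch r l)) g" for r l
  have B: "B r l = ?U (exch r l ` M) (g \<circ> exch r l)" if "r < N" "l < N" for r l
    unfolding B_def by (rule right_avg_permutes_exch[OF that])
  have pp: "p c \<ge> 0" if "c < N" for c using p e \<alpha> that by (simp add: add_nonneg_nonneg)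
  have lt: "c < N" if "c \<in> M" for c using M that by blast
  define u where "u = ?U M g"
  have u: "u \<ge> v M" unfolding u_def using v[OF M _ g] by simp
  have Bsym: "B r l = B l r" for r l unfolding B_def by (simp only: transpose_commute)
  have BM: "B r l = u" if "r \<in> M" "l \<in> M" for r l
    using that lt by (simp add: B u_def right_avg_permutes_absorb permutes_swap_id)
  have BC: "B r l \<ge> v M" if "r \<in> ?C" "l \<in> ?C" for r l
    using that v[OF M _ comp_exch_permutes[OF g]] by (simp add: B)
  have Bx: "B x c \<ge> v (insert x (M - {c}))" if "x \<in> ?C" "c \<in> M" for x c
  proof -
    have img: "exch x c ` M = insert x (M - {c})"
      using that by (auto simp: in_transpose_image_iff transpose_eq_iff image_iff Transposition.transpose_def)
    have "card (insert x (M - {c})) = card M"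
      using that fM by (simp add: card.insert_remove card_gt_0_iff) (metis One_nat_def Suc_pred card_gt_0_iff empty_iff)
    moreover have "insert x (M - {c}) \<subseteq> {..<N}" using that M by auto
    ultimately show ?thesis
      using that lt v[of "insert x (M - {c})"] comp_exch_permutes[OF g] by (simp add: B img)
  qed
  have expand: "right_avg {p. p permutes M} (move_op (\<lambda>r l. p r * p l) N f) g
      = (\<Sum>r<N. \<Sum>l<N. p r * p l * B r l)"
  proof -
    have "(\<Sum>h | h permutes M. \<Sum>r<N. \<Sum>l<N. p r * p l * f (g \<circ> h \<circ> exch r l))
        = (\<Sum>r<N. \<Sum>l<N. p r * p l * (\<Sum>h | h permutes M. f (g \<circ> h \<circ> exch r l)))"
      by (subst sum.swap, rule sum.cong[OF refl], subst sum.swap) (simp add: sum_distrib_left)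
    then show ?thesis
      by (simp add: right_avg_def move_op_def B_def sum_divide_distrib[symmetric])
  qed
  have split: "(\<Sum>r<N. \<Sum>l<N. p r * p l * B r l)
      = (\<Sum>r\<in>M. \<Sum>l\<in>M. p r * p l * B r l) + (\<Sum>r\<in>?C. \<Sum>l\<in>?C. p r * p l * B r l)
        + 2 * (\<Sum>x\<in>?C. \<Sum>c\<in>M. p x * p c * B x c)"
  proof -
    have s: "(\<Sum>r<N. k r) = (\<Sum>r\<in>M. k r) + (\<Sum>r\<in>?C. k r)" for k :: "nat \<Rightarrow> real"
      using sum.subset_diff[OF M, of k] by simp
    have "(\<Sum>r\<in>M. \<Sum>l\<in>?C. p r * p l * B r l) = (\<Sum>x\<in>?C. \<Sum>c\<in>M. p x * p c * B x c)"
      by (subst sum.swap) (simp add: Bsym mult_ac)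
    then show ?thesis by (simp add: s sum.distrib)
  qed
  let ?pM = "\<Sum>c\<in>M. p c" and ?pC = "\<Sum>x\<in>?C. p x"
  have tot: "?pM + ?pC = 1" using p1 sum.subset_diff[OF M, of p] by simp
  have MM: "(\<Sum>r\<in>M. \<Sum>l\<in>M. p r * p l * B r l) = ?pM\<^sup>2 * u"
  proof -
    have "(\<Sum>r\<in>M. \<Sum>l\<in>M. p r * p l * B r l) = (\<Sum>r\<in>M. \<Sum>l\<in>M. p r * p l * u)"
      by (intro sum.cong refl) (simp add: BM)
    then show ?thesis
      by (simp add: power2_eq_square sum_distrib_left[symmetric] sum_distrib_right[symmetric])
  qed
  have CC: "(\<Sum>r\<in>?C. \<Sum>l\<in>?C. p r * p l * B r l) \<ge> ?pC\<^sup>2 * v M"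
  proof -
    have "?pC\<^sup>2 * v M = (\<Sum>r\<in>?C. \<Sum>l\<in>?C. p r * p l * v M)"
      by (simp add: power2_eq_square sum_distrib_left[symmetric] sum_distrib_right[symmetric])
    also have "\<dots> \<le> (\<Sum>r\<in>?C. \<Sum>l\<in>?C. p r * p l * B r l)"
      using BC pp by (intro sum_mono mult_left_mono) auto
    finally show ?thesis .
  qed
  have x: "(\<Sum>c\<in>M. p x * p c * B x c)
      \<ge> p x * (\<alpha> * ?k * v (insert x M) - \<alpha> * u + (\<Sum>c\<in>M. e c * v (insert x (M - {c}))))"
    if x: "x \<in> ?C" for x
  proof -
    have xN: "x \<notin> M" "insert x M \<subseteq> {..<N}" using x M by auto
    have "(\<Sum>c\<in>M. B x c) = ?k * ?U (insert x M) g - u"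
      using right_avg_permutes_insert[OF fM xN(1), of f g] by (simp add: B_def u_def)
    moreover have "?k * ?U (insert x M) g \<ge> ?k * v (insert x M)"
      using v[OF xN(2) _ g] fM xN(1) by (intro mult_left_mono) auto
    ultimately have "(\<Sum>c\<in>M. B x c) \<ge> ?k * v (insert x M) - u" by linarith
    then have 1: "\<alpha> * (\<Sum>c\<in>M. B x c) \<ge> \<alpha> * (?k * v (insert x M) - u)"
      using \<alpha> by (intro mult_left_mono)
    have 2: "(\<Sum>c\<in>M. e c * B x c) \<ge> (\<Sum>c\<in>M. e c * v (insert x (M - {c})))"
      using Bx[OF x] e lt by (intro sum_mono mult_left_mono) auto
    have "(\<Sum>c\<in>M. p x * p c * B x c) = (\<Sum>c\<in>M. p x * (\<alpha> * B x c + e c * B x c))"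
      using p lt by (intro sum.cong refl) (simp add: algebra_simps)
    also have "\<dots> = p x * (\<alpha> * (\<Sum>c\<in>M. B x c) + (\<Sum>c\<in>M. e c * B x c))"
      by (simp add: sum_distrib_left sum.distrib distrib_left)
    also have "\<dots> \<ge> p x * (\<alpha> * (?k * v (insert x M) - u) + (\<Sum>c\<in>M. e c * v (insert x (M - {c}))))"
      using pp x by (intro mult_left_mono[OF add_mono[OF 1 2]]) auto
    finally show ?thesis by (simp add: algebra_simps)
  qed
  have W: "(\<Sum>x\<in>?C. \<Sum>c\<in>M. p x * p c * B x c)
      \<ge> (\<Sum>x\<in>?C. p x * (\<alpha> * ?k * v (insert x M) - \<alpha> * u + (\<Sum>c\<in>M. e c * v (insert x (M - {c})))))"
    by (rule sum_mono) (rule x)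
  have Z: "(\<Sum>x\<in>?C. p x * (\<alpha> * ?k * v (insert x M) - \<alpha> * u + (\<Sum>c\<in>M. e c * v (insert x (M - {c})))))
      = (\<Sum>x\<in>?C. p x * (\<alpha> * ?k * (v (insert x M) - v M) + (\<Sum>c\<in>M. e c * (v (insert x (M - {c})) - v M))))
        - \<alpha> * ?pC * u + ?pC * (\<alpha> * ?k + (\<Sum>c\<in>M. e c)) * v M"
  proof -
    have t: "p x * (\<alpha> * ?k * v (insert x M) - \<alpha> * u + (\<Sum>c\<in>M. e c * v (insert x (M - {c}))))
        = p x * (\<alpha> * ?k * (v (insert x M) - v M) + (\<Sum>c\<in>M. e c * (v (insert x (M - {c})) - v M)))
          - p x * (\<alpha> * u) + p x * ((\<alpha> * ?k + (\<Sum>c\<in>M. e c)) * v M)" for x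
      by (simp add: algebra_simps sum_subtractf sum_distrib_left)
    show ?thesis
      unfolding t sum.distrib sum_subtractf sum_distrib_right[symmetric] by (simp add: mult_ac)
  qed
  have E: "\<alpha> * ?k + (\<Sum>c\<in>M. e c) = ?pM + \<alpha>"
  proof -
    have "?pM = (\<Sum>c\<in>M. \<alpha> + e c)" using p lt by (intro sum.cong refl) auto
    then show ?thesis by (simp add: sum.distrib algebra_simps)
  qed
  \<comment> \<open>All terms in \<open>u\<close> are kept until here, where their total coefficient
    is nonnegative by \<open>lazy\<close>; only then may \<open>u\<close> be replaced by its lower
    bound \<open>v M\<close>.\<close>
  have "(?pM\<^sup>2 - 2 * \<alpha> * ?pC) * u \<ge> (?pM\<^sup>2 - 2 * \<alpha> * ?pC) * v M"
    using u lazy by (intro mult_left_mono) auto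
  moreover have "(?pM\<^sup>2 - 2 * \<alpha> * ?pC) * v M + ?pC\<^sup>2 * v M + 2 * (?pC * (?pM + \<alpha>) * v M) = v M"
  proof -
    have "(?pM\<^sup>2 - 2 * \<alpha> * ?pC) * v M + ?pC\<^sup>2 * v M + 2 * (?pC * (?pM + \<alpha>) * v M) = (?pM + ?pC)\<^sup>2 * v M"
      by (simp add: power2_eq_square algebra_simps)
    then show ?thesis by (simp add: tot)
  qed
  moreover have "(?pM\<^sup>2 - 2 * \<alpha> * ?pC) * u = ?pM\<^sup>2 * u - 2 * (\<alpha> * ?pC * u)" by (simp add: algebra_simps)
  ultimately show ?thesis unfolding expand split MM using CC W[unfolded Z E] by linarith
qed

text \<open>The family \<open>v\<close> in \<open>marking_step\<close> is taken affine in the total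
  potential of the unmarked cards. Its increments are then proportional to \<open>\<phi> x\<close>
  if \<open>x\<close> becomes marked and to \<open>\<phi> x - \<phi> c\<close> if roles are
  exchanged, and \<open>drift\<close> is the resulting contraction by \<open>\<rho>\<close> per
  step. The threshold \<open>m\<close> persists because the marked set never shrinks.\<close>

lemma marking_potential_decay:
  fixes p e \<phi> :: "nat \<Rightarrow> real"
  assumes p: "\<And>c. c < N \<Longrightarrow> p c = \<alpha> + e c" and \<alpha>: "\<alpha> \<ge> 0" and e: "\<And>c. c < N \<Longrightarrow> e c \<ge> 0"
    and p1: "(\<Sum>c<N. p c) = 1" and \<rho>: "\<rho> \<ge> 0" and \<beta>: "\<beta> \<ge> 0" and L: "L \<ge> 0"
    and lazy: "\<And>M. M \<subseteq> {..<N} \<Longrightarrow> m \<le> real (card M) \<Longrightarrow>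
        2 * \<alpha> * (\<Sum>x\<in>{..<N} - M. p x) \<le> (\<Sum>c\<in>M. p c)\<^sup>2"
    and drift: "\<And>M x. M \<subseteq> {..<N} \<Longrightarrow> m \<le> real (card M) \<Longrightarrow> x \<in> {..<N} - M \<Longrightarrow>
        2 * p x * (\<alpha> * (real (card M) + 1) * \<phi> x + (\<Sum>c\<in>M. e c * (\<phi> x - \<phi> c))) \<ge> (1 - \<rho>) * \<phi> x"
    and base: "\<And>M g. M \<subseteq> {..<N} \<Longrightarrow> m \<le> real (card M) \<Longrightarrow> g permutes {..<N} \<Longrightarrow>
        right_avg {p. p permutes M} f g \<ge> \<beta> * (1 - L * (\<Sum>x\<in>{..<N} - M. \<phi> x))"
    and M: "M \<subseteq> {..<N}" "m \<le> real (card M)" and g: "g permutes {..<N}"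
  shows "right_avg {p. p permutes M} ((move_op (\<lambda>r l. p r * p l) N ^^ t) f) g
    \<ge> \<beta> * (1 - L * \<rho> ^ t * (\<Sum>x\<in>{..<N} - M. \<phi> x))"
  using M g
proof (induction t arbitrary: M g)
  case 0
  then show ?case using base by simp
next
  case (Suc t)
  note M = Suc.prems(1,2) and g = Suc.prems(3)
  have fM: "finite M" using M finite_subset by blast
  define \<Lambda> where "\<Lambda> = \<beta> * (L * \<rho> ^ t)"
  have \<Lambda>: "\<Lambda> \<ge> 0" using \<beta> L \<rho> by (simp add: \<Lambda>_def)
  define \<Phi> where "\<Phi> M = (\<Sum>x\<in>{..<N} - M. \<phi> x)" for M
  define v where "v M = \<beta> * (1 - L * \<rho> ^ t * \<Phi> M)" for M
  have v: "v M = \<beta> - \<Lambda> * \<Phi> M" for M by (simp add: v_def \<Lambda>_def algebra_simps)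
  let ?C = "{..<N} - M"
  have "right_avg {p. p permutes M} (move_op (\<lambda>r l. p r * p l) N ((move_op (\<lambda>r l. p r * p l) N ^^ t) f)) g
    \<ge> v M + 2 * (\<Sum>x\<in>?C. p x * (\<alpha> * (real (card M) + 1) * (v (insert x M) - v M)
        + (\<Sum>c\<in>M. e c * (v (insert x (M - {c})) - v M))))"
    by (rule marking_step[OF M(1) g p \<alpha> e p1 lazy[OF M]])
       (use Suc.IH M(2) in \<open>auto simp: v_def \<Phi>_def\<close>)
  moreover have "2 * (\<Sum>x\<in>?C. p x * (\<alpha> * (real (card M) + 1) * (v (insert x M) - v M)
        + (\<Sum>c\<in>M. e c * (v (insert x (M - {c})) - v M)))) \<ge> \<Lambda> * (1 - \<rho>) * \<Phi> M"
  proof -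
    have "\<Lambda> * ((1 - \<rho>) * \<phi> x) \<le> 2 * (p x * (\<alpha> * (real (card M) + 1) * (v (insert x M) - v M)
        + (\<Sum>c\<in>M. e c * (v (insert x (M - {c})) - v M))))" if x: "x \<in> ?C" for x
    proof -
      have i1: "\<Phi> (insert x M) = \<Phi> M - \<phi> x"
      proof -
        have "{..<N} - insert x M = ?C - {x}" by blast
        then show ?thesis using x by (simp add: \<Phi>_def sum_diff1)
      qed
      have i2: "\<Phi> (insert x (M - {c})) = \<Phi> M - \<phi> x + \<phi> c" if c: "c \<in> M" for c
      proof -
        have "{..<N} - insert x (M - {c}) = insert c (?C - {x})" using c M x by blast
        then show ?thesis using x c by (simp add: \<Phi>_def sum_diff1)
      qed
      have "v (insert x M) - v M = \<Lambda> * \<phi> x" by (simp add: v i1 algebra_simps)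
      moreover have "(\<Sum>c\<in>M. e c * (v (insert x (M - {c})) - v M)) = \<Lambda> * (\<Sum>c\<in>M. e c * (\<phi> x - \<phi> c))"
        unfolding sum_distrib_left by (intro sum.cong refl) (simp add: v i2 algebra_simps)
      ultimately have "2 * (p x * (\<alpha> * (real (card M) + 1) * (v (insert x M) - v M)
          + (\<Sum>c\<in>M. e c * (v (insert x (M - {c})) - v M))))
          = \<Lambda> * (2 * p x * (\<alpha> * (real (card M) + 1) * \<phi> x + (\<Sum>c\<in>M. e c * (\<phi> x - \<phi> c))))"
        by (simp add: algebra_simps)
      also have "\<dots> \<ge> \<Lambda> * ((1 - \<rho>) * \<phi> x)" using drift[OF M x] \<Lambda> by (intro mult_left_mono)
      finally show ?thesis .
    qed
    then have "(\<Sum>x\<in>?C. \<Lambda> * ((1 - \<rho>) * \<phi> x)) \<le> (\<Sum>x\<in>?C. 2 * (p x * (\<alpha> * (real (card M) + 1) * (v (insert x M) - v M)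
        + (\<Sum>c\<in>M. e c * (v (insert x (M - {c})) - v M)))))" by (rule sum_mono)
    then show ?thesis by (simp add: sum_distrib_left[symmetric] \<Phi>_def mult.assoc)
  qed
  moreover have "v M + \<Lambda> * (1 - \<rho>) * \<Phi> M = \<beta> * (1 - L * \<rho> ^ Suc t * \<Phi> M)"
    by (simp add: v \<Lambda>_def algebra_simps)
  ultimately show ?case by (simp add: \<Phi>_def)
qed

section \<open>Upper bound\<close>

lemma card_weight_sum:
  assumes "A \<subseteq> {..<2*n}" "card A = n" "n > 0"
  shows "(\<Sum>c<2*n. card_weight a (2*n) A c) = 1"
proof -
  have fA: "finite A" using assms finite_subset by blast
  have cB: "card ({..<2*n} - A) = n" using assms fA by (simp add: card_Diff_subset)
  have "(\<Sum>c<2*n. card_weight a (2*n) A c)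
      = (\<Sum>c\<in>A. card_weight a (2*n) A c) + (\<Sum>c\<in>{..<2*n} - A. card_weight a (2*n) A c)"
    using sum.subset_diff[OF assms(1), of "card_weight a (2*n) A"] by simp
  also have "(\<Sum>c\<in>A. card_weight a (2*n) A c) = real n * (a / real (2*n))"
    using assms by (simp add: card_weight_def)
  also have "(\<Sum>c\<in>{..<2*n} - A. card_weight a (2*n) A c) = real n * ((2 - a) / real (2*n))"
    using cB by (simp add: card_weight_def)
  finally show ?thesis using assms(3) by (simp add: field_simps)
qed

text \<open>With \<open>w\<close> between \<open>N / 64\<close> and \<open>N / 32\<close>, the
  overlap factor is at least \<open>1 / 32\<close> and the parity factor at least
  \<open>1 / (3 * 64 * 128)\<close>; the product is \<open>1 / 786432\<close>.\<close>

lemma trans_op_attempt_const: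
  assumes N: "N \<ge> 64"
  obtains s where "s > 0" "s \<le> 5 * N"
    "\<And>f q g. block_uniform N (N div 32) q f \<Longrightarrow> q \<ge> 0 \<Longrightarrow> g permutes {..<N} \<Longrightarrow>
      (trans_op N ^^ s) f g \<ge> 1 / 786432 * q"
proof -
  let ?w = "N div 32"
  have w: "?w \<ge> 2" using N by simp
  have w1: "real ?w \<le> real N / 32" 
  proof -
    have "32 * ?w \<le> N" by simp
    then have "real (32 * ?w) \<le> real N" by (rule of_nat_mono)
    then show ?thesis by simp
  qed
  have w2: "real ?w \<ge> real N / 64"
  proof -
    have "N \<le> 64 * ?w" using N by simp
    then have "real N \<le> real (64 * ?w)" by (rule of_nat_mono)
    then show ?thesis by simp
  qed
  have N0: "N > 0" using N by simp
  obtain s where s: "s > 0" "s \<le> 5 * N"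
    "\<And>f q g. block_uniform N ?w q f \<Longrightarrow> q \<ge> 0 \<Longrightarrow> g permutes {..<N} \<Longrightarrow>
      (trans_op N ^^ s) f g \<ge> (1 / 16 - real ?w / real N) * (real ?w * (real ?w - 1) / (3 * real N ^ 2)) * q"
    using trans_op_attempt[OF N0 w] by blast
  have c1: "1 / 16 - real ?w / real N \<ge> 1 / 32" using w1 N0 by (simp add: field_simps)
  have c2: "real ?w * (real ?w - 1) / (3 * real N ^ 2) \<ge> 1 / 24576"
  proof -
    have "(real N / 64) * (real N / 128) \<le> real ?w * (real ?w - 1)"
      using w w2 by (intro mult_mono) auto
    then show ?thesis using N0 by (simp add: field_simps power2_eq_square)
  qed
  have c: "1 / 786432 \<le> (1 / 16 - real ?w / real N) * (real ?w * (real ?w - 1) / (3 * real N ^ 2))"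
    using mult_mono[OF c1 c2] c1 by simp
  show thesis
  proof (rule that[OF s(1,2)])
    show "(trans_op N ^^ s) f g \<ge> 1 / 786432 * q"
      if "block_uniform N ?w q f" "q \<ge> 0" "g permutes {..<N}" for f q g
      using order_trans[OF mult_right_mono[OF c that(2)] s(3)[OF that]] .
  qed
qed

text \<open>The summands of the time are in chronological order: \<open>i\<close> steps create a
  block, \<open>s\<close> steps leave at most a fraction \<open>\<delta>\<close> of the cards
  unmarked, \<open>t\<close> steps mark the rest. The proof goes from the last phase to the first;
  \<open>pos1\<close> and \<open>pos2\<close> keep the bounds passed between phases
  nonnegative.\<close>

lemma walk_dist_ge:
  fixes a \<delta> :: real and n :: nat and A :: "nat set"
  defines "N \<equiv> 2 * n"
  assumes a: "0 < a" "a \<le> 1" and A: "A \<subseteq> {..<N}" "card A = n"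
    and N: "N \<ge> 64" "real N \<ge> 8192 / a" and \<delta>: "0 < \<delta>" "\<delta> < 1 / 6"
    and \<sigma>: "\<sigma> permutes {..<N}"
    and pos1: "(1 - 2 * a * (1 - 3 * \<delta>) / real N) ^ t * real N / \<delta> \<le> 1"
    and pos2: "(1 - a\<^sup>2 / (16 * real N)) ^ s / \<delta> \<le> 1"
  shows "walk_dist a N A (i + (s + t)) \<sigma> \<ge>
      (1 - 3 * (1 - a\<^sup>2 * (1 - exp (- (1 / 786432) / (5 * real N)))) ^ i)
      * (1 / fact N * (1 - (1 - 2 * a * (1 - 3 * \<delta>) / real N) ^ t * real N / \<delta>)
         * (1 - (1 - a\<^sup>2 / (16 * real N)) ^ s / \<delta>))"
proof -
  have N0: "N > 0" and n0: "n > 0" using N by (auto simp: N_def)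
  have fA: "finite A" using A finite_subset by blast
  define p where "p = card_weight a N A"
  define \<alpha> where "\<alpha> = a / real N"
  define e where "e c = (if c \<in> A then 0 else (2 - 2 * a) / real N)" for c
  let ?P = "move_op (\<lambda>r l. p r * p l) N"
  have \<alpha>0: "\<alpha> \<ge> 0" using a by (simp add: \<alpha>_def)
  have e0: "e c \<ge> 0" for c using a by (simp add: e_def)
  have pe: "p c = \<alpha> + e c" for c
    by (simp add: p_def card_weight_def \<alpha>_def e_def add_divide_distrib[symmetric])
  have p1: "(\<Sum>c<N. p c) = 1" unfolding p_def N_def using card_weight_sum[OF A[unfolded N_def] n0] .
  have p\<alpha>: "p c \<ge> \<alpha>" for c using pe e0 by simp
  have lazy: "2 * \<alpha> * (\<Sum>x\<in>{..<N} - M. p x) \<le> (\<Sum>c\<in>M. p c)\<^sup>2"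
    if M: "M \<subseteq> {..<N}" "real N / 64 \<le> real (card M)" for M
  proof -
    have p0: "p c \<ge> 0" for c using p\<alpha> \<alpha>0 order_trans by blast
    have "(\<Sum>x\<in>{..<N} - M. p x) \<le> (\<Sum>c<N. p c)" using p0 by (intro sum_mono2) auto
    then have "2 * \<alpha> * (\<Sum>x\<in>{..<N} - M. p x) \<le> 2 * \<alpha> * 1" using \<alpha>0 p1 by (intro mult_left_mono) auto
    \<comment> \<open>The origin of the condition \<open>N \<ge> 8192 / a\<close>: a block of
      \<open>N / 64\<close> cards has weight at least \<open>a / 64\<close>, and
      \<open>8192 = 2 * 64 * 64\<close>.\<close>
    also have "\<dots> \<le> (a / 64)\<^sup>2" using N(2) a N0 by (simp add: \<alpha>_def field_simps power2_eq_square)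
    also have "\<dots> \<le> (\<Sum>c\<in>M. p c)\<^sup>2"
    proof (rule power_mono)
      have "a / 64 = \<alpha> * (real N / 64)" using N0 by (simp add: \<alpha>_def)
      also have "\<dots> \<le> \<alpha> * real (card M)" using M \<alpha>0 by (intro mult_left_mono)
      also have "\<dots> = (\<Sum>c\<in>M. \<alpha>)" by simp
      also have "\<dots> \<le> (\<Sum>c\<in>M. p c)" by (intro sum_mono p\<alpha>)
      finally show "a / 64 \<le> (\<Sum>c\<in>M. p c)" .
    qed (use a in simp)
    finally show ?thesis .
  qed
  \<comment> \<open>An unmarked \<open>b\<close>-card is charged only \<open>\<delta>\<close>, so an
    \<open>a\<close>-card that exchanges roles with a marked \<open>b\<close>-card does almost as
    well as one that becomes marked.\<close>
  define \<phi> :: "nat \<Rightarrow> real" where "\<phi> c = (if c \<in> A then 1 else \<delta>)" for c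
  define \<rho> where "\<rho> = 1 - 2 * a * (1 - 3 * \<delta>) / real N"
  define \<rho>' where "\<rho>' = 1 - a\<^sup>2 / (16 * real N)"
  have \<rho>0: "\<rho> \<ge> 0"
  proof -
    have "2 * a * (1 - 3 * \<delta>) \<le> 2 * 1 * 1" using a \<delta> by (intro mult_mono) auto
    then show ?thesis using N(1) by (simp add: \<rho>_def field_simps)
  qed
  have \<rho>'0: "\<rho>' \<ge> 0"
  proof -
    have "a\<^sup>2 \<le> 1" using a by (simp add: power_le_one)
    then show ?thesis using N(1) by (simp add: \<rho>'_def field_simps)
  qed
  let ?f0 = "point_mass \<sigma>"
  let ?f1 = "(?P ^^ t) ?f0" and ?f2 = "(?P ^^ s) ((?P ^^ t) ?f0)"
  let ?\<Phi> = "\<lambda>M. \<Sum>x\<in>{..<N} - M. \<phi> x"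
  have f0: "?f0 g \<ge> 0" for g by (simp add: point_mass_def)
  have Ppos: "(?P ^^ j) f g \<ge> 0" if "\<And>g. g permutes {..<N} \<Longrightarrow> f g \<ge> 0" "g permutes {..<N}" for j f g
  proof -
    have q0: "p r * p l \<ge> 0" for r l using p\<alpha> \<alpha>0 order_trans by (metis mult_nonneg_nonneg)
    have "(\<Sum>r<N. \<Sum>l<N. p r * p l) = 1" using p1 by (simp add: sum_product[symmetric])
    then show ?thesis using q0 that by (intro funpow_move_op_ge_const) auto
  qed
  have sub64: "real N / 64 \<le> real (card M)" if "(1 - \<delta>) * real N \<le> real (card M)" for M :: "nat set"
  proof -
    have "1 / 64 * real N \<le> (1 - \<delta>) * real N" using \<delta> by (intro mult_right_mono) auto
    then show ?thesis using that by simp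
  qed
  have cardC: "real (card ({..<N} - M)) = real N - real (card M)" if "M \<subseteq> {..<N}" for M
    using card_Diff_subset[of M "{..<N}"] card_mono[of "{..<N}" M] that finite_subset[OF that]
    by (simp add: of_nat_diff)
  have late: "right_avg {p. p permutes M} ?f1 g \<ge> 1 / fact N * (1 - 1 / \<delta> * \<rho> ^ t * ?\<Phi> M)"
    if M: "M \<subseteq> {..<N}" "(1 - \<delta>) * real N \<le> real (card M)" and g: "g permutes {..<N}" for M g
  proof (rule marking_potential_decay[OF pe \<alpha>0 e0 p1 \<rho>0 _ _ _ _ _ M g])
    show "(0::real) \<le> 1 / fact N" "0 \<le> 1 / \<delta>" using \<delta> by auto
    fix M assume M: "M \<subseteq> {..<N}" "(1 - \<delta>) * real N \<le> real (card M)"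
    show "2 * \<alpha> * (\<Sum>x\<in>{..<N} - M. p x) \<le> (\<Sum>c\<in>M. p c)\<^sup>2"
      using lazy[OF M(1) sub64[OF M(2)]] .
    have fM: "finite M" using M finite_subset by blast
    show "1 / fact N * (1 - 1 / \<delta> * ?\<Phi> M) \<le> right_avg {p. p permutes M} ?f0 g"
      if g: "g permutes {..<N}" for g
    proof (cases "M = {..<N}")
      case True
      have "(\<Sum>h | h permutes {..<N}. ?f0 (g \<circ> h)) = (\<Sum>h | h permutes {..<N}. if h = inv g \<circ> \<sigma> then 1 else 0)"
      proof (intro sum.cong refl)
        fix h assume "h \<in> {h. h permutes {..<N}}"
        have "g \<circ> h = \<sigma> \<longleftrightarrow> h = inv g \<circ> \<sigma>"
          by (auto simp: fun_eq_iff permutes_inverses[OF g])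
             (metis permutes_inverses(2)[OF g])
        then show "?f0 (g \<circ> h) = (if h = inv g \<circ> \<sigma> then 1 else 0)" by (simp add: point_mass_def)
      qed
      also have "\<dots> = 1"
        using permutes_compose[OF \<sigma> permutes_inv[OF g]] by (simp add: sum.delta finite_permutations)
      finally have "right_avg {p. p permutes {..<N}} ?f0 g = 1 / fact N"
        using card_permutations[of "{..<N}" N] by (simp add: right_avg_def)
      then show ?thesis using True by simp
    next
      case False
      \<comment> \<open>Even a single unmarked \<open>b\<close>-card has potential
        \<open>\<delta>\<close>; the prefactor \<open>1 / \<delta>\<close> thus makes the claim void
        unless all cards are marked.\<close>
      then obtain x where x: "x \<in> {..<N} - M" using M by blast
      have "\<delta> \<le> \<phi> x" using \<delta> by (simp add: \<phi>_def)
      also have "\<dots> \<le> ?\<Phi> M" using x \<delta> by (intro member_le_sum) (auto simp: \<phi>_def)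
      finally have "1 - 1 / \<delta> * ?\<Phi> M \<le> 0" using \<delta> by (simp add: field_simps)
      then have "1 / fact N * (1 - 1 / \<delta> * ?\<Phi> M) \<le> 0" by (simp add: mult_le_0_iff divide_le_0_iff)
      also have "0 \<le> right_avg {p. p permutes M} ?f0 g"
        unfolding right_avg_def by (intro divide_nonneg_nonneg sum_nonneg f0) simp
      finally show ?thesis .
    qed
    fix x assume x: "x \<in> {..<N} - M"
    let ?k = "real (card M) + 1"
    have MB: "real (card (M - A)) \<ge> (1 / 2 - \<delta>) * real N"
    proof -
      have "card ({..<N} - A) = n" using A fA by (simp add: card_Diff_subset N_def)
      moreover have "{..<N} - A \<subseteq> (M - A) \<union> ({..<N} - M)" by blast
      then have "card ({..<N} - A) \<le> card ((M - A) \<union> ({..<N} - M))"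
        using fM by (intro card_mono) auto
      then have "card ({..<N} - A) \<le> card (M - A) + card ({..<N} - M)"
        using card_Un_le order_trans by blast
      ultimately have "real n \<le> real (card (M - A)) + real (card ({..<N} - M))" by linarith
      moreover have "real n = real N / 2" by (simp add: N_def)
      moreover have "real (card ({..<N} - M)) \<le> \<delta> * real N"
        using cardC[OF M(1)] M(2) by (simp add: algebra_simps)
      ultimately show ?thesis by (simp add: algebra_simps)
    qed
    show "(1 - \<rho>) * \<phi> x \<le> 2 * p x * (\<alpha> * ?k * \<phi> x + (\<Sum>c\<in>M. e c * (\<phi> x - \<phi> c)))"
    proof (cases "x \<in> A")
      case True
      have "(\<Sum>c\<in>M. e c * (\<phi> x - \<phi> c)) = (\<Sum>c\<in>M - A. (2 - 2 * a) / real N * (1 - \<delta>))"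
        using fM True by (intro sum.mono_neutral_cong_right) (auto simp: e_def \<phi>_def)
      also have "\<dots> = (2 - 2 * a) / real N * (1 - \<delta>) * real (card (M - A))" by simp
      finally have s: "(\<Sum>c\<in>M. e c * (\<phi> x - \<phi> c)) = \<dots>" .
      \<comment> \<open>At \<open>\<delta> = 0\<close> the right side is
        \<open>a + (1 - a) = 1\<close>: direct marking plus role exchanges with the marked half of
        \<open>b\<close>-cards. The losses from unmarked cards and from the charge on
        \<open>b\<close>-cards stay below \<open>3 * \<delta>\<close>.\<close>
      have "(1 - 3 * \<delta>) \<le> a * (1 - \<delta>) + (2 - 2 * a) * (1 - \<delta>) * (1 / 2 - \<delta>)"
      proof -
        have "a * (1 - \<delta>) + (2 - 2 * a) * (1 - \<delta>) * (1 / 2 - \<delta>) - (1 - 3 * \<delta>) = 2 * \<delta>\<^sup>2 * (1 - a) + 2 * a * \<delta>"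
          by (simp add: algebra_simps power2_eq_square)
        also have "\<dots> \<ge> 0" using a \<delta> by simp
        finally show ?thesis by linarith
      qed
      then have "(1 - 3 * \<delta>) * real N \<le> (a * (1 - \<delta>) + (2 - 2 * a) * (1 - \<delta>) * (1 / 2 - \<delta>)) * real N"
        by (rule mult_right_mono) simp
      also have "\<dots> = a * ((1 - \<delta>) * real N) + (2 - 2 * a) * (1 - \<delta>) * ((1 / 2 - \<delta>) * real N)"
        by (simp add: algebra_simps)
      also have "\<dots> \<le> a * ?k + (2 - 2 * a) * (1 - \<delta>) * real (card (M - A))"
        using M(2) MB a \<delta> by (intro add_mono mult_left_mono) auto
      finally have m: "(1 - 3 * \<delta>) * real N \<le> \<dots>" .
      have "(1 - \<rho>) * \<phi> x = 2 * a / (real N)\<^sup>2 * ((1 - 3 * \<delta>) * real N)"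
        using True N0 by (simp add: \<rho>_def \<phi>_def power2_eq_square)
      also have "\<dots> \<le> 2 * a / (real N)\<^sup>2 * (a * ?k + (2 - 2 * a) * (1 - \<delta>) * real (card (M - A)))"
        using m a by (intro mult_left_mono) auto
      also have "\<dots> = 2 * p x * (\<alpha> * ?k * \<phi> x + (\<Sum>c\<in>M. e c * (\<phi> x - \<phi> c)))"
        unfolding s using True N0
        by (simp add: p_def card_weight_def \<alpha>_def \<phi>_def power2_eq_square field_simps)
      finally show ?thesis .
    next
      case False
      have s: "(\<Sum>c\<in>M. e c * (\<phi> x - \<phi> c)) = 0"
        using False by (intro sum.neutral) (auto simp: e_def \<phi>_def)
      have "(1 - 3 * \<delta>) * real N \<le> (1 - \<delta>) * real N" using \<delta> by (intro mult_right_mono) auto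
      also have "\<dots> \<le> ?k" using M(2) by simp
      also have "\<dots> \<le> (2 - a) * ?k" using mult_right_mono[of 1 "2 - a" ?k] a by simp
      finally have m: "(1 - 3 * \<delta>) * real N \<le> (2 - a) * ?k" .
      have "(1 - \<rho>) * \<phi> x = 2 * a * \<delta> / (real N)\<^sup>2 * ((1 - 3 * \<delta>) * real N)"
        using False N0 by (simp add: \<rho>_def \<phi>_def power2_eq_square)
      also have "\<dots> \<le> 2 * a * \<delta> / (real N)\<^sup>2 * ((2 - a) * ?k)"
        using m a \<delta> by (intro mult_left_mono) auto
      also have "\<dots> = 2 * p x * (\<alpha> * ?k * \<phi> x + (\<Sum>c\<in>M. e c * (\<phi> x - \<phi> c)))"
        unfolding s using False
        by (simp add: p_def card_weight_def \<alpha>_def \<phi>_def power2_eq_square)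
      finally show ?thesis .
    qed
  qed
  define \<beta> where "\<beta> = 1 / fact N * (1 - \<rho> ^ t * real N / \<delta>)"
  have \<beta>0: "\<beta> \<ge> 0" using pos1 by (simp add: \<beta>_def \<rho>_def)
  have late': "right_avg {p. p permutes M} ?f1 g \<ge> \<beta>"
    if M: "M \<subseteq> {..<N}" "(1 - \<delta>) * real N \<le> real (card M)" and g: "g permutes {..<N}" for M g
  proof -
    \<comment> \<open>Bounding the potential by \<open>N\<close> creates the factor \<open>N\<close>
      in \<open>\<beta>\<close>. Beating it is what costs the last phase its
      \<open>N ln N / (2a)\<close> steps.\<close>
    have "?\<Phi> M \<le> (\<Sum>x\<in>{..<N} - M. 1)" using \<delta> by (intro sum_mono) (auto simp: \<phi>_def)
    also have "\<dots> \<le> real N" using cardC[OF M(1)] by simp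
    finally have "1 / \<delta> * \<rho> ^ t * ?\<Phi> M \<le> 1 / \<delta> * \<rho> ^ t * real N"
      using \<delta> \<rho>0 by (intro mult_left_mono) auto
    then have "\<beta> \<le> 1 / fact N * (1 - 1 / \<delta> * \<rho> ^ t * ?\<Phi> M)"
      unfolding \<beta>_def by (intro mult_left_mono) (auto simp: mult_ac)
    then show ?thesis using late[OF M g] by linarith
  qed
  define w where "w = N div 32"
  \<comment> \<open>Because of the integer division only \<open>w + 1\<close> reaches
    \<open>N / 32\<close>; the drift contains \<open>card M + 1\<close>, so this is enough.\<close>
  have w2: "real w \<ge> real N / 64" "real w + 1 \<ge> real N / 32"
  proof -
    have "N \<le> 64 * w" using N(1) by (simp add: w_def)
    then have "real N \<le> real (64 * w)" by (rule of_nat_mono)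
    then show "real w \<ge> real N / 64" by simp
    have "N \<le> 32 * (w + 1)" by (simp add: w_def)
    then have "real N \<le> real (32 * (w + 1))" by (rule of_nat_mono)
    then show "real w + 1 \<ge> real N / 32" by simp
  qed
  define \<gamma> where "\<gamma> = \<beta> * (1 - \<rho>' ^ s / \<delta>)"
  have \<gamma>0: "\<gamma> \<ge> 0" using \<beta>0 pos2 by (simp add: \<gamma>_def \<rho>'_def)
  have mid: "right_avg {p. p permutes M} ?f2 g \<ge> \<gamma>"
    if M: "M \<subseteq> {..<N}" "real w \<le> real (card M)" and g: "g permutes {..<N}" for M g
  proof -
    \<comment> \<open>With potential 1 the unmarked cards are simply counted. The prefactor
      \<open>1 / (\<delta> * real N)\<close> makes the starting bound void unless at least
      \<open>(1 - \<delta>) * real N\<close> cards are marked, which is when the bound of the last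
      phase applies.\<close>
    have "right_avg {p. p permutes M} ?f2 g \<ge> \<beta> * (1 - 1 / (\<delta> * real N) * \<rho>' ^ s * (\<Sum>x\<in>{..<N} - M. 1))"
    proof (rule marking_potential_decay[OF pe \<alpha>0 e0 p1 \<rho>'0 \<beta>0 _ _ _ _ M g])
      show "0 \<le> 1 / (\<delta> * real N)" using \<delta> by simp
      fix M assume M: "M \<subseteq> {..<N}" "real w \<le> real (card M)"
      have k64: "real N / 64 \<le> real (card M)" using M(2) w2 by linarith
      show "2 * \<alpha> * (\<Sum>x\<in>{..<N} - M. p x) \<le> (\<Sum>c\<in>M. p c)\<^sup>2" by (rule lazy[OF M(1) k64])
      show "\<beta> * (1 - 1 / (\<delta> * real N) * (\<Sum>x\<in>{..<N} - M. 1)) \<le> right_avg {p. p permutes M} ?f1 g"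
        if g: "g permutes {..<N}" for g
      proof (cases "(1 - \<delta>) * real N \<le> real (card M)")
        case True
        have "\<beta> * (1 - 1 / (\<delta> * real N) * (\<Sum>x\<in>{..<N} - M. 1)) \<le> \<beta> * 1"
          using \<beta>0 \<delta> by (intro mult_left_mono) auto
        then show ?thesis using late'[OF M(1) True g] by linarith
      next
        case False
        then have "\<delta> * real N \<le> (\<Sum>x\<in>{..<N} - M. 1)" using cardC[OF M(1)] by (simp add: algebra_simps)
        then have "1 - 1 / (\<delta> * real N) * (\<Sum>x\<in>{..<N} - M. 1) \<le> 0" using \<delta> N0 by (simp add: field_simps)
        then have "\<beta> * (1 - 1 / (\<delta> * real N) * (\<Sum>x\<in>{..<N} - M. 1)) \<le> 0"
          using \<beta>0 by (rule mult_nonneg_nonpos[rotated])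
        also have "0 \<le> right_avg {p. p permutes M} ?f1 g"
          unfolding right_avg_def
        proof (intro divide_nonneg_nonneg sum_nonneg Ppos)
          fix h assume "h \<in> {p. p permutes M}"
          then show "g \<circ> h permutes {..<N}" using g M(1) permutes_subset permutes_compose by blast
        qed (use f0 in auto)
        finally show ?thesis .
      qed
      fix x assume x: "x \<in> {..<N} - M"
      have "a\<^sup>2 / (16 * real N) = 2 * \<alpha> * (\<alpha> * (real N / 32))"
        using N0 by (simp add: \<alpha>_def power2_eq_square)
      also have "\<dots> \<le> 2 * p x * (\<alpha> * (real (card M) + 1))"
        using w2(2) M(2) p\<alpha>[of x] \<alpha>0 by (intro mult_mono) auto
      finally show "(1 - \<rho>') * 1 \<le> 2 * p x * (\<alpha> * (real (card M) + 1) * 1 + (\<Sum>c\<in>M. e c * (1 - 1)))"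
        by (simp add: \<rho>'_def)
    qed
    moreover have "\<gamma> \<le> \<beta> * (1 - 1 / (\<delta> * real N) * \<rho>' ^ s * (\<Sum>x\<in>{..<N} - M. 1))"
      unfolding \<gamma>_def
    proof (rule mult_left_mono[OF _ \<beta>0])
      have "1 / (\<delta> * real N) * \<rho>' ^ s * (\<Sum>x\<in>{..<N} - M. 1) \<le> 1 / (\<delta> * real N) * \<rho>' ^ s * real N"
        using cardC[OF M(1)] \<delta> \<rho>'0 by (intro mult_left_mono) auto
      also have "\<dots> = \<rho>' ^ s / \<delta>" using N0 by simp
      finally show "1 - \<rho>' ^ s / \<delta> \<le> 1 - 1 / (\<delta> * real N) * \<rho>' ^ s * (\<Sum>x\<in>{..<N} - M. 1)" by simp
    qed
    ultimately show ?thesis by linarith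
  qed
  have f2: "?f2 g \<ge> 0" if "g permutes {..<N}" for g
    using that f0 by (intro Ppos) auto
  have bu: "block_uniform N w \<gamma> ?f2"
    unfolding block_uniform_def using f2 mid by auto
  obtain r where r: "r > 0" "r \<le> 5 * N"
    "\<And>f q g. block_uniform N w q f \<Longrightarrow> q \<ge> 0 \<Longrightarrow> g permutes {..<N} \<Longrightarrow> (trans_op N ^^ r) f g \<ge> 1 / 786432 * q"
    using trans_op_attempt_const[OF N(1)] unfolding w_def by blast
  let ?x = "exp (- (1 / 786432) / (5 * real N))"
  have T: "(trans_op N ^^ j) ?f2 g \<ge> (1 - 3 * ?x ^ j) * \<gamma>" if g: "g permutes {..<N}" for j g
  proof (rule trans_op_exp_bound[OF N0 r(1) _ _ _ \<gamma>0 _ bu g])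
    show "real r \<le> 5 * real N" using r(2) by (metis of_nat_le_iff of_nat_mult of_nat_numeral)
  qed (use r(3) in auto)
  have "(?P ^^ i) ?f2 id \<ge> (1 - 3 * (1 - a\<^sup>2 * (1 - ?x)) ^ i) * \<gamma>"
    by (rule biased_early_phase[OF N0 a _ p1 _ _ \<gamma>0 T permutes_id]) (use p\<alpha> in \<open>auto simp: \<alpha>_def\<close>)
  moreover have "walk_dist a N A (i + (s + t)) \<sigma> = (?P ^^ i) ?f2 id"
    unfolding walk_dist_eq_move_op p_def[symmetric] funpow_move_op_reverse[OF \<sigma>]
    by (simp only: funpow_add comp_apply)
  ultimately show ?thesis by (simp add: \<gamma>_def \<beta>_def \<rho>_def \<rho>'_def)
qed

section \<open>Lower bound\<close>

text \<open>Adds to the state the set \<open>D\<close> of cards picked so far, so that having never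
  been touched becomes a function of the state.\<close>

definition tracked_op :: "(nat \<Rightarrow> real) \<Rightarrow> nat \<Rightarrow> ((nat \<Rightarrow> nat) \<Rightarrow> nat set \<Rightarrow> real) \<Rightarrow> (nat \<Rightarrow> nat) \<Rightarrow> nat set \<Rightarrow> real" where
  "tracked_op p N F g D = (\<Sum>r<N. \<Sum>l<N. p r * p l * F (g \<circ> exch r l) (insert r (insert l D)))"

definition avoids :: "nat set \<Rightarrow> nat set \<Rightarrow> real" where
  "avoids Y D = (if Y \<inter> D = {} then 1 else 0)"

lemma tracked_op_forget:
  "(tracked_op p N ^^ t) (\<lambda>g D. f g) = (\<lambda>g D. (move_op (\<lambda>r l. p r * p l) N ^^ t) f g)"
  by (induction t) (simp_all add: fun_eq_iff tracked_op_def[abs_def] move_op_def[abs_def])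

lemma tracked_op_add:
  "(tracked_op p N ^^ t) (\<lambda>g D. F g D + G g D)
    = (\<lambda>g D. (tracked_op p N ^^ t) F g D + (tracked_op p N ^^ t) G g D)"
proof (induction t)
  case (Suc t)
  have "tracked_op p N (\<lambda>g D. F g D + G g D) = (\<lambda>g D. tracked_op p N F g D + tracked_op p N G g D)" for F G
    by (simp add: fun_eq_iff tracked_op_def sum.distrib distrib_left)
  then show ?case using Suc by simp
qed simp

lemma tracked_op_avoids:
  assumes p1: "(\<Sum>r<N. p r) = 1" and Y: "\<And>i. i \<in> I \<Longrightarrow> Y i \<subseteq> {..<N}" and fI: "finite I"
  shows "(tracked_op p N ^^ t) (\<lambda>g D. \<Sum>i\<in>I. c i * avoids (Y i) D)
    = (\<lambda>g D. \<Sum>i\<in>I. c i * (1 - (\<Sum>x\<in>Y i. p x)) ^ (2 * t) * avoids (Y i) D)"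
proof (induction t)
  case (Suc t)
  have one: "(\<Sum>r<N. p r * (if r \<in> Y then 0 else 1)) = 1 - (\<Sum>x\<in>Y. p x)" if "Y \<subseteq> {..<N}" for Y
  proof -
    have "(\<Sum>r<N. p r * (if r \<in> Y then 0 else 1)) = (\<Sum>r\<in>{..<N} - Y. p r)"
      by (rule sum.mono_neutral_cong_right) auto
    then show ?thesis using sum.subset_diff[OF that, of p] p1 by simp
  qed
  have prod: "(\<Sum>r<N. \<Sum>l<N. k * (u r * w l) * d) = k * ((\<Sum>r<N. u r) * (\<Sum>l<N. w l)) * d"
    for k d :: real and u w :: "nat \<Rightarrow> real"
    by (simp add: sum_distrib_left[symmetric] sum_distrib_right[symmetric] mult.assoc)
  have ins: "avoids Y (insert r (insert l D)) = (if r \<in> Y then 0 else 1) * (if l \<in> Y then 0 else 1) * avoids Y D"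
    for Y r l D by (auto simp: avoids_def)
  have "tracked_op p N (\<lambda>g D. \<Sum>i\<in>I. c' i * avoids (Y i) D)
      = (\<lambda>g D. \<Sum>i\<in>I. c' i * (1 - (\<Sum>x\<in>Y i. p x))\<^sup>2 * avoids (Y i) D)" for c'
  proof (intro ext)
    fix g D
    have "tracked_op p N (\<lambda>g D. \<Sum>i\<in>I. c' i * avoids (Y i) D) g D
        = (\<Sum>r<N. \<Sum>l<N. \<Sum>i\<in>I. c' i * ((p r * (if r \<in> Y i then 0 else 1)) * (p l * (if l \<in> Y i then 0 else 1))) * avoids (Y i) D)"
      unfolding tracked_op_def ins sum_distrib_left by (intro sum.cong refl) (simp only: mult_ac)
    also have "\<dots> = (\<Sum>i\<in>I. \<Sum>r<N. \<Sum>l<N. c' i * ((p r * (if r \<in> Y i then 0 else 1)) * (p l * (if l \<in> Y i then 0 else 1))) * avoids (Y i) D)"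
      by (simp only: sum.swap[where A = "{..<N}" and B = I])
    also have "\<dots> = (\<Sum>i\<in>I. c' i * (1 - (\<Sum>x\<in>Y i. p x))\<^sup>2 * avoids (Y i) D)"
    proof (rule sum.cong[OF refl])
      fix i assume i: "i \<in> I"
      have "(\<Sum>r<N. \<Sum>l<N. c' i * ((p r * (if r \<in> Y i then 0 else 1)) * (p l * (if l \<in> Y i then 0 else 1))) * avoids (Y i) D)
          = c' i * ((\<Sum>r<N. p r * (if r \<in> Y i then 0 else 1)) * (\<Sum>l<N. p l * (if l \<in> Y i then 0 else 1))) * avoids (Y i) D"
        by (rule prod)
      then show "(\<Sum>r<N. \<Sum>l<N. c' i * ((p r * (if r \<in> Y i then 0 else 1)) * (p l * (if l \<in> Y i then 0 else 1))) * avoids (Y i) D)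
          = c' i * (1 - (\<Sum>x\<in>Y i. p x))\<^sup>2 * avoids (Y i) D"
        unfolding one[OF Y[OF i]] by (simp add: power2_eq_square)
    qed
    finally show "tracked_op p N (\<lambda>g D. \<Sum>i\<in>I. c' i * avoids (Y i) D) g D
        = (\<Sum>i\<in>I. c' i * (1 - (\<Sum>x\<in>Y i. p x))\<^sup>2 * avoids (Y i) D)" .
  qed
  note step = this[of "\<lambda>i. c i * (1 - (\<Sum>x\<in>Y i. p x)) ^ (2 * t)"]
  show ?case
    unfolding funpow.simps comp_apply Suc step by (simp add: power2_eq_square mult_ac)
qed simp

text \<open>The comparison is required only on states where all cards outside \<open>D\<close> are
  in place. Moves preserve this, since the cards they exchange are added to
  \<open>D\<close>.\<close>

lemma tracked_op_mono:
  assumes p0: "\<And>r. r < N \<Longrightarrow> p r \<ge> 0"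
    and F: "\<And>g D. \<forall>x. x \<notin> D \<longrightarrow> g x = x \<Longrightarrow> F g D \<le> F' g D"
    and inv: "\<forall>x. x \<notin> D \<longrightarrow> g x = x"
  shows "(tracked_op p N ^^ t) F g D \<le> (tracked_op p N ^^ t) F' g D"
  using inv
proof (induction t arbitrary: g D)
  case 0
  then show ?case using F by simp
next
  case (Suc t)
  have "(tracked_op p N ^^ t) F (g \<circ> exch r l) (insert r (insert l D))
      \<le> (tracked_op p N ^^ t) F' (g \<circ> exch r l) (insert r (insert l D))" for r l
    by (rule Suc.IH) (use Suc.prems in auto)
  then have "tracked_op p N ((tracked_op p N ^^ t) F) g D \<le> tracked_op p N ((tracked_op p N ^^ t) F') g D"
    unfolding tracked_op_def[of p N "(tracked_op p N ^^ t) F"] tracked_op_def[of p N "(tracked_op p N ^^ t) F'"]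
    using p0 by (intro sum_mono mult_left_mono) auto
  then show ?case by simp
qed

section \<open>Fixed points under the uniform and the walk distribution\<close>

lemma card_permutes_fixing:
  assumes "x < N"
  shows "card {\<sigma>. \<sigma> permutes {..<N} \<and> \<sigma> x = x} = fact (N - 1)"
proof -
  have "{\<sigma>. \<sigma> permutes {..<N} \<and> \<sigma> x = x} = {\<sigma>. \<sigma> permutes ({..<N} - {x})}"
  proof (rule set_eqI, unfold mem_Collect_eq, intro iffI conjI)
    fix \<sigma> assume "\<sigma> permutes {..<N} \<and> \<sigma> x = x"
    then have s: "\<sigma> permutes {..<N}" "\<sigma> x = x" by auto
    show "\<sigma> permutes {..<N} - {x}" by (rule permutes_superset[OF s(1)]) (use s(2) in blast)
  next
    fix \<sigma> assume \<sigma>: "\<sigma> permutes {..<N} - {x}"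
    show "\<sigma> permutes {..<N}" by (rule permutes_subset[OF \<sigma> Diff_subset])
    show "\<sigma> x = x" by (rule permutes_not_in[OF \<sigma>]) simp
  qed
  then show ?thesis using card_permutations[of "{..<N} - {x}" "N - 1"] assms by simp
qed

text \<open>Markov's inequality for the number of fixed points in \<open>A\<close>, by double
  counting.\<close>

lemma card_few_fixed_points:
  assumes A: "A \<subseteq> {..<N}" and \<kappa>: "\<kappa> > 0"
  shows "real (card {\<sigma>. \<sigma> permutes {..<N} \<and> real (card {x\<in>A. \<sigma> x = x}) < \<kappa>})
    \<ge> fact N - real (card A) * fact (N - 1) / \<kappa>"
proof -
  let ?G = "{\<sigma>. \<sigma> permutes {..<N}}"
  let ?fix = "\<lambda>\<sigma>. real (card {x\<in>A. \<sigma> x = x})"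
  have fG: "finite ?G" by (simp add: finite_permutations)
  have fA: "finite A" using A finite_subset by blast
  let ?L = "{\<sigma>\<in>?G. ?fix \<sigma> < \<kappa>}" and ?H = "{\<sigma>\<in>?G. \<kappa> \<le> ?fix \<sigma>}"
  have "\<kappa> * real (card ?H) = (\<Sum>\<sigma>\<in>?H. \<kappa>)" by simp
  also have "\<dots> \<le> (\<Sum>\<sigma>\<in>?H. ?fix \<sigma>)" by (intro sum_mono) auto
  also have "\<dots> \<le> (\<Sum>\<sigma>\<in>?G. ?fix \<sigma>)" using fG by (intro sum_mono2) auto
  also have "\<dots> = (\<Sum>\<sigma>\<in>?G. \<Sum>x\<in>A. if \<sigma> x = x then 1 else 0)"
    using fA by (intro sum.cong refl) (simp add: sum.If_cases Collect_conj_eq Int_commute)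
  also have "\<dots> = (\<Sum>x\<in>A. \<Sum>\<sigma>\<in>?G. if \<sigma> x = x then 1 else 0)" by (rule sum.swap)
  also have "\<dots> = (\<Sum>x\<in>A. fact (N - 1))"
  proof (rule sum.cong[OF refl])
    fix x assume "x \<in> A"
    then have "x < N" using A by blast
    have "(\<Sum>\<sigma>\<in>?G. if \<sigma> x = x then 1 else 0) = real (card {\<sigma>. \<sigma> permutes {..<N} \<and> \<sigma> x = x})"
      using fG by (simp add: sum.If_cases Collect_conj_eq)
    then show "(\<Sum>\<sigma>\<in>?G. if \<sigma> x = x then 1 else 0) = (fact (N - 1) :: real)"
      using card_permutes_fixing[OF \<open>x < N\<close>] by simp
  qed
  finally have H: "\<kappa> * real (card ?H) \<le> real (card A) * fact (N - 1)" by simp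
  have "card (?L \<union> ?H) = card ?L + card ?H"
    by (rule card_Un_disjoint) (use fG in auto)
  moreover have "?L \<union> ?H = ?G" by auto
  ultimately have "card ?G = card ?L + card ?H" by simp
  then have "real (card ?G) = real (card ?L) + real (card ?H)" by simp
  then have "fact N = real (card ?L) + real (card ?H)"
    using card_permutations[of "{..<N}" N] by simp
  moreover have "real (card ?H) \<le> real (card A) * fact (N - 1) / \<kappa>"
    using H \<kappa> by (simp add: pos_le_divide_eq mult.commute)
  ultimately show ?thesis by simp
qed

text \<open>Let \<open>M\<close> be the mean number of untouched \<open>a\<close>-cards. Chebyshev
  shows that the walk has fewer than \<open>M / 2\<close> fixed \<open>a\<close>-cards with
  probability at most \<open>4 / M\<close>, while a uniform permutation does with probability at
  least \<open>1 - 1 / M\<close>. Separation would give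
  \<open>(1 - \<epsilon>) * (1 - 1 / M) \<le> 4 / M\<close>, contrary to \<open>m\<close>.\<close>

lemma walk_dist_not_separated:
  fixes a \<epsilon> :: real and n t :: nat and A :: "nat set"
  defines "N \<equiv> 2 * n"
  assumes a: "0 < a" "a \<le> 1" and A: "A \<subseteq> {..<N}" "card A = n" and n: "n > 0"
    and \<epsilon>: "\<epsilon> < 1"
    and m: "(1 - \<epsilon>) * (real n * (1 - a / real N) ^ (2 * t) - 1) > 4"
  shows "\<not> (\<forall>\<sigma>. \<sigma> permutes {..<N} \<longrightarrow> walk_dist a N A t \<sigma> \<ge> (1 - \<epsilon>) / fact N)"
proof
  assume sep: "\<forall>\<sigma>. \<sigma> permutes {..<N} \<longrightarrow> walk_dist a N A t \<sigma> \<ge> (1 - \<epsilon>) / fact N"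
  define p where "p = card_weight a N A"
  have fA: "finite A" using A finite_subset by blast
  have N0: "N > 0" using n by (simp add: N_def)
  have p1: "(\<Sum>c<N. p c) = 1" unfolding p_def N_def using card_weight_sum[OF A[unfolded N_def] n] .
  have p0: "p r \<ge> 0" for r using a by (simp add: p_def card_weight_def)
  define \<alpha> where "\<alpha> = a / real N"
  have pA: "p x = \<alpha>" if "x \<in> A" for x using that by (simp add: p_def card_weight_def \<alpha>_def)
  have \<alpha>: "0 \<le> \<alpha>" "2 * \<alpha> \<le> 1" using a n by (auto simp: \<alpha>_def N_def field_simps)
  define M where "M = real n * (1 - \<alpha>) ^ (2 * t)"
  have M1: "(1 - \<epsilon>) * (M - 1) > 4" using m by (simp add: M_def \<alpha>_def)
  have M0: "M > 1"
  proof (rule ccontr)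
    assume "\<not> M > 1"
    then have "(1 - \<epsilon>) * (M - 1) \<le> 0" using \<epsilon> by (intro mult_nonneg_nonpos) auto
    then show False using M1 by simp
  qed
  let ?fix = "\<lambda>\<sigma>. real (card {x\<in>A. \<sigma> x = x})"
  let ?X = "\<lambda>D. \<Sum>x\<in>A. avoids {x} D"
  define few where "few \<sigma> = (if ?fix \<sigma> < M / 2 then 1 else 0 :: real)" for \<sigma>
  let ?P = "move_op (\<lambda>r l. p r * p l) N"
  let ?Q = "tracked_op p N"
  \<comment> \<open>The square of \<open>?X D - M\<close> is expanded into pairs, single cards and a
    constant, each in the shape of \<open>tracked_op_avoids\<close>; for the constant this is one
    index with the empty set.\<close>
  define S2 where "S2 = (\<lambda>(g :: nat \<Rightarrow> nat) D. \<Sum>i\<in>A \<times> A. 1 * avoids {fst i, snd i} D)"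
  define S1 where "S1 = (\<lambda>(g :: nat \<Rightarrow> nat) D. \<Sum>x\<in>A. (- 2 * M) * avoids {x} D)"
  define S0 where "S0 = (\<lambda>(g :: nat \<Rightarrow> nat) D. \<Sum>i\<in>{0::nat}. M\<^sup>2 * avoids {} D)"
  have sq: "(?X D - M)\<^sup>2 = S2 g D + (S1 g D + S0 g D)" for g D
  proof -
    have "avoids {x} D * avoids {y} D = avoids {x, y} D" for x y by (auto simp: avoids_def)
    then have "?X D * ?X D = S2 g D"
      unfolding S2_def sum_product by (simp add: sum.cartesian_product case_prod_unfold)
    moreover have "S1 g D = - 2 * M * ?X D" by (simp add: S1_def sum_distrib_left)
    moreover have "S0 g D = M\<^sup>2" by (simp add: S0_def avoids_def)
    ultimately show ?thesis by (simp add: power2_eq_square algebra_simps)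
  qed
  have Q2: "(?Q ^^ t) S2 id {} \<le> M + M\<^sup>2"
  proof -
    have "(?Q ^^ t) S2 id {} = (\<Sum>i\<in>A \<times> A. (1 - (\<Sum>x\<in>{fst i, snd i}. p x)) ^ (2 * t))"
      unfolding S2_def using A fA by (subst tracked_op_avoids[OF p1]) (auto simp: avoids_def)
    also have "\<dots> \<le> (\<Sum>i\<in>A \<times> A. (if fst i = snd i then (1 - \<alpha>) ^ (2 * t) else 0) + (1 - \<alpha>) ^ (2 * t) * (1 - \<alpha>) ^ (2 * t))"
    proof (rule sum_mono)
      fix i assume i: "i \<in> A \<times> A"
      show "(1 - (\<Sum>x\<in>{fst i, snd i}. p x)) ^ (2 * t)
          \<le> (if fst i = snd i then (1 - \<alpha>) ^ (2 * t) else 0) + (1 - \<alpha>) ^ (2 * t) * (1 - \<alpha>) ^ (2 * t)"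
      proof (cases "fst i = snd i")
        case True
        have "(1 - \<alpha>) ^ (2 * t) * (1 - \<alpha>) ^ (2 * t) \<ge> 0" by simp
        then show ?thesis using True i by (auto simp: pA)
      next
        case False
        then have "(\<Sum>x\<in>{fst i, snd i}. p x) = 2 * \<alpha>" using i by (auto simp: pA)
        \<comment> \<open>Distinct cards are negatively correlated in remaining untouched, so only
          the diagonal contributes to the variance bound \<open>M\<close>.\<close>
        moreover have "(1 - 2 * \<alpha>) ^ (2 * t) \<le> ((1 - \<alpha>) * (1 - \<alpha>)) ^ (2 * t)"
          using \<alpha> by (intro power_mono) (auto simp: algebra_simps)
        ultimately show ?thesis using False by (simp add: power_mult_distrib)
      qed
    qed
    also have "\<dots> = M + M\<^sup>2"
    proof -
      have "(\<Sum>i\<in>A \<times> A. if fst i = snd i then (1 - \<alpha>) ^ (2 * t) else 0)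
          = (\<Sum>x\<in>A. \<Sum>y\<in>A. if x = y then (1 - \<alpha>) ^ (2 * t) else 0)"
        by (simp add: sum.cartesian_product case_prod_unfold)
      also have "\<dots> = M" using fA A by (simp add: M_def)
      finally show ?thesis
        using A by (simp add: sum.distrib card_cartesian_product M_def power2_eq_square mult_ac)
    qed
    finally show ?thesis .
  qed
  have Q1: "(?Q ^^ t) S1 id {} = - 2 * M * M"
    unfolding S1_def using A fA by (subst tracked_op_avoids[OF p1]) (auto simp: avoids_def pA M_def)
  have Q0: "(?Q ^^ t) S0 id {} = M\<^sup>2"
    unfolding S0_def by (subst tracked_op_avoids[OF p1]) (auto simp: avoids_def)
  have Fadd: "(?Q ^^ t) (\<lambda>g D. S2 g D + (S1 g D + S0 g D)) id {} \<le> M"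
    using Q2 unfolding tracked_op_add Q1 Q0 by (simp add: power2_eq_square)
  have "M\<^sup>2 / 4 * (?P ^^ t) few id = (?P ^^ t) (\<lambda>g. M\<^sup>2 / 4 * few g) id"
    unfolding funpow_move_op_cmult ..
  also have "\<dots> = (?Q ^^ t) (\<lambda>g D. M\<^sup>2 / 4 * few g) id {}"
    unfolding tracked_op_forget ..
  also have "\<dots> \<le> (?Q ^^ t) (\<lambda>g D. S2 g D + (S1 g D + S0 g D)) id {}"
  proof (rule tracked_op_mono)
    fix g :: "nat \<Rightarrow> nat" and D assume inv: "\<forall>x. x \<notin> D \<longrightarrow> g x = x"
    have "?X D = real (card {x\<in>A. x \<notin> D})"
      using fA by (simp add: avoids_def sum.If_cases Collect_conj_eq Int_commute)
    also have "\<dots> \<le> ?fix g" using inv fA by (intro of_nat_mono card_mono) auto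
    finally have le: "?X D \<le> ?fix g" .
    show "M\<^sup>2 / 4 * few g \<le> S2 g D + (S1 g D + S0 g D)"
    proof (cases "?fix g < M / 2")
      case True
      then have "M / 2 \<le> M - ?X D" using le by simp
      then have "(M / 2)\<^sup>2 \<le> (M - ?X D)\<^sup>2" using M0 by (intro power_mono) auto
      then show ?thesis using True unfolding sq[symmetric] few_def
        by (simp add: power2_commute[of M] power_divide)
    next
      case False
      then show ?thesis unfolding sq[symmetric] few_def by simp
    qed
  qed (use p0 in auto)
  also have "\<dots> \<le> M" by (rule Fadd)
  finally have "M\<^sup>2 / 4 * (?P ^^ t) few id \<le> M" .
  then have up: "(?P ^^ t) few id \<le> 4 / M" using M0 by (simp add: field_simps power2_eq_square)
  have "(?P ^^ t) few id = (\<Sum>\<sigma> | \<sigma> permutes {..<N}. walk_dist a N A t \<sigma> * few \<sigma>)"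
    using funpow_move_op_kernel[where g = id and N = N and q = "\<lambda>r l. p r * p l" and t = t and f = few]
    by (simp only: walk_dist_eq_move_op p_def id_comp)
  also have "\<dots> \<ge> (\<Sum>\<sigma> | \<sigma> permutes {..<N}. (1 - \<epsilon>) / fact N * few \<sigma>)"
    using sep by (intro sum_mono mult_right_mono) (auto simp: few_def)
  finally have low: "(?P ^^ t) few id \<ge> (1 - \<epsilon>) / fact N * (\<Sum>\<sigma> | \<sigma> permutes {..<N}. few \<sigma>)"
    by (simp only: sum_distrib_left)
  have "(\<Sum>\<sigma> | \<sigma> permutes {..<N}. few \<sigma>) = real (card {\<sigma>. \<sigma> permutes {..<N} \<and> ?fix \<sigma> < M / 2})"
    unfolding few_def by (simp add: sum.If_cases finite_permutations Collect_conj_eq)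
  also have "\<dots> \<ge> fact N - real (card A) * fact (N - 1) / (M / 2)"
    using M0 by (intro card_few_fixed_points A) simp
  finally have cnt: "(\<Sum>\<sigma> | \<sigma> permutes {..<N}. few \<sigma>) \<ge> fact N - real (card A) * fact (N - 1) / (M / 2)" .
  have "(fact N :: real) = real N * fact (N - 1)" using N0 by (simp add: fact_reduce)
  then have "real (card A) * fact (N - 1) / (M / 2) = fact N / M"
    using A(2) by (simp add: N_def)
  then have "(1 - \<epsilon>) / fact N * (fact N - fact N / M) \<le> (1 - \<epsilon>) / fact N * (\<Sum>\<sigma> | \<sigma> permutes {..<N}. few \<sigma>)"
    using cnt \<epsilon> by (intro mult_left_mono) auto
  then have "(1 - \<epsilon>) / fact N * (fact N - fact N / M) \<le> 4 / M" using low up by linarith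
  moreover have "(1 - \<epsilon>) / fact N * (fact N - fact N / M) = (1 - \<epsilon>) * (M - 1) / M"
    using M0 by (simp add: field_simps)
  ultimately have "(1 - \<epsilon>) * (M - 1) / M \<le> 4 / M" by simp
  then show False using M1 M0 by (simp add: divide_le_cancel)
qed

section \<open>The mixing time\<close>

lemma one_minus_power_le_exp:
  fixes z :: real
  assumes "z \<le> 1"
  shows "(1 - z) ^ k \<le> exp (- (z * real k))"
proof -
  have "(1 - z) ^ k \<le> exp (- z) ^ k"
    using exp_ge_add_one_self[of "- z"] assms by (intro power_mono) auto
  also have "\<dots> = exp (- z * real k)" by (rule exp_of_nat2_mult[symmetric])
  finally show ?thesis by simp
qed

lemma filterlim_real_double: "filterlim (\<lambda>n. real (2 * n)) at_top sequentially"
proof -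
  have "filterlim (\<lambda>n::nat. 2 * n) at_top sequentially"
    by (rule filterlim_subseq) (simp add: strict_mono_def)
  then show ?thesis by (rule filterlim_compose[OF filterlim_real_sequentially])
qed

lemma eventually_powr_small:
  assumes "\<kappa> > 0" "\<theta> > 0"
  shows "\<forall>\<^sub>F n in sequentially. C * real (2 * n) powr (- \<kappa>) \<le> \<theta>"
proof -
  have "((\<lambda>n. real (2 * n) powr (- \<kappa>)) \<longlongrightarrow> 0) sequentially"
    using assms by (intro tendsto_neg_powr filterlim_real_double) auto
  then have "((\<lambda>n. C * real (2 * n) powr (- \<kappa>)) \<longlongrightarrow> C * 0) sequentially"
    by (intro tendsto_mult tendsto_const)
  then have "\<forall>\<^sub>F n in sequentially. C * real (2 * n) powr (- \<kappa>) < \<theta>"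
    using assms(2) order_tendstoD(2) by fastforce
  then show ?thesis by eventually_elim simp
qed

text \<open>In units of \<open>N ln N / (2a)\<close>, the last phase gets
  \<open>1 + \<eta> / 2\<close> and each of the other two gets \<open>\<eta> / 8\<close>. The
  summand 3 pays for three roundings; each phase may lose \<open>\<epsilon> / 3\<close>.\<close>

lemma eventually_separated:
  fixes a \<epsilon> \<eta> :: real and A :: "nat \<Rightarrow> nat set"
  assumes a: "0 < a" "a \<le> 1" and \<epsilon>: "0 < \<epsilon>" "\<epsilon> < 1" and \<eta>: "0 < \<eta>"
    and A: "\<And>n. A n \<subseteq> {..<2*n} \<and> card (A n) = n"
  shows "\<forall>\<^sub>F n in sequentially. \<exists>T. (\<forall>\<sigma>. \<sigma> permutes {..<2*n} \<longrightarrow> walk_dist a (2*n) (A n) T \<sigma> \<ge> (1 - \<epsilon>) / fact (2*n))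
    \<and> real T \<le> (1 + 3 * \<eta> / 4) * (real (2*n) * ln (real (2*n))) / (2 * a) + 3"
proof -
  \<comment> \<open>Solves \<open>(1 - 3 * \<delta>) * (1 + \<eta> / 2) = 1 + \<eta> / 4\<close>:
    the slowdown of the last phase by \<open>1 - 3 * \<delta>\<close> must leave its exponent above
    1.\<close>
  define \<delta> where "\<delta> = \<eta> / (6 * (2 + \<eta>))"
  have \<delta>: "0 < \<delta>" "\<delta> < 1 / 6" using \<eta> by (auto simp: \<delta>_def field_simps)
  have \<delta>\<eta>: "(1 - 3 * \<delta>) * (1 + \<eta> / 2) = 1 + \<eta> / 4"
    using \<eta> by (simp add: \<delta>_def field_simps)
  define c :: real where "c = 1 / 786432"
  have \<epsilon>3: "\<epsilon> / 3 > 0" using \<epsilon> by simp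
  have "\<forall>\<^sub>F n in sequentially. real (2 * n) \<ge> max 64 (8192 / a)"
    using filterlim_real_double unfolding filterlim_at_top by blast
  moreover have "\<forall>\<^sub>F n in sequentially. (1 / \<delta>) * real (2 * n) powr (- (\<eta> / 4)) \<le> \<epsilon> / 3"
    using \<eta> \<epsilon>3 by (intro eventually_powr_small) auto
  moreover have "\<forall>\<^sub>F n in sequentially. (1 / \<delta>) * real (2 * n) powr (- (a * \<eta> / 256)) \<le> \<epsilon> / 3"
    using \<eta> \<epsilon>3 a by (intro eventually_powr_small) auto
  moreover have "\<forall>\<^sub>F n in sequentially. 3 * real (2 * n) powr (- (a * c * \<eta> / 160)) \<le> \<epsilon> / 3"
    using \<eta> \<epsilon>3 a by (intro eventually_powr_small) (auto simp: c_def)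
  ultimately show ?thesis
  proof eventually_elim
    case (elim n)
    define N where "N = 2 * n"
    have N: "N \<ge> 64" "real N \<ge> 8192 / a" using elim(1) by (auto simp: N_def)
    have N0: "real N > 0" using N by simp
    define l where "l = ln (real N)"
    have l0: "l > 0" using N by (simp add: l_def)
    have pw: "real N powr (- \<kappa>) = exp (- \<kappa> * l)" for \<kappa> using N0 by (simp add: powr_def l_def)
    define t where "t = nat \<lceil>(1 + \<eta> / 2) * (real N * l) / (2 * a)\<rceil>"
    define s where "s = nat \<lceil>(\<eta> / 8) * (real N * l) / (2 * a)\<rceil>"
    have t0: "0 \<le> (1 + \<eta> / 2) * (real N * l) / (2 * a)" and s0: "0 \<le> (\<eta> / 8) * (real N * l) / (2 * a)"
      using a \<eta> l0 by auto
    have t1: "real t \<ge> (1 + \<eta> / 2) * (real N * l) / (2 * a)" "real t \<le> (1 + \<eta> / 2) * (real N * l) / (2 * a) + 1"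
      using t0 unfolding t_def by linarith+
    have s1: "real s \<ge> (\<eta> / 8) * (real N * l) / (2 * a)" "real s \<le> (\<eta> / 8) * (real N * l) / (2 * a) + 1"
      using s0 unfolding s_def by linarith+
    define x1 where "x1 = (1 - 2 * a * (1 - 3 * \<delta>) / real N) ^ t * real N / \<delta>"
    define x2 where "x2 = (1 - a\<^sup>2 / (16 * real N)) ^ s / \<delta>"
    define x3 where "x3 = 3 * (1 - a\<^sup>2 * (1 - exp (- c / (5 * real N)))) ^ s"
    have X1: "0 \<le> x1" "x1 \<le> \<epsilon> / 3"
    proof -
      let ?z = "2 * a * (1 - 3 * \<delta>) / real N"
      have "2 * a * (1 - 3 * \<delta>) \<le> 2 * 1 * 1" using a \<delta> by (intro mult_mono) auto
      then have z: "?z \<le> 1" using N(1) by (simp add: field_simps)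
      then show "0 \<le> x1" using \<delta> by (simp add: x1_def)
      \<comment> \<open>The exponent \<open>1 + \<eta> / 4\<close> beats the factor \<open>N\<close>
        and leaves \<open>N\<close> to the power \<open>- \<eta> / 4\<close>.\<close>
      have "(1 + \<eta> / 4) * l = ?z * ((1 + \<eta> / 2) * (real N * l) / (2 * a))"
        using a N0 by (simp add: \<delta>\<eta>[symmetric] field_simps)
      also have "\<dots> \<le> ?z * real t" using t1(1) a \<delta> by (intro mult_left_mono) auto
      finally have "exp (- (?z * real t)) \<le> exp (- ((1 + \<eta> / 4) * l))" by simp
      then have "(1 - ?z) ^ t \<le> exp (- ((1 + \<eta> / 4) * l))"
        using one_minus_power_le_exp[OF z, of t] by linarith
      then have "(1 - ?z) ^ t * real N \<le> exp (- ((1 + \<eta> / 4) * l)) * real N"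
        by (rule mult_right_mono) simp
      also have "\<dots> = exp (- ((1 + \<eta> / 4) * l)) * exp l" using N0 by (simp add: l_def)
      also have "\<dots> = exp (- (\<eta> / 4) * l)" by (simp add: exp_add[symmetric] algebra_simps)
      finally have "x1 \<le> exp (- (\<eta> / 4) * l) / \<delta>" unfolding x1_def using \<delta> by (intro divide_right_mono) auto
      moreover have "exp (- (\<eta> / 4) * l) / \<delta> \<le> \<epsilon> / 3" using elim(2) unfolding N_def[symmetric] pw by simp
      ultimately show "x1 \<le> \<epsilon> / 3" by linarith
    qed
    have X2: "0 \<le> x2" "x2 \<le> \<epsilon> / 3"
    proof -
      let ?z = "a\<^sup>2 / (16 * real N)"
      have "a\<^sup>2 \<le> 1" using a by (simp add: power_le_one)
      then have z: "?z \<le> 1" using N(1) by (simp add: field_simps)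
      then show "0 \<le> x2" using \<delta> by (simp add: x2_def)
      have "(a * \<eta> / 256) * l = ?z * ((\<eta> / 8) * (real N * l) / (2 * a))"
        using a N0 by (simp add: power2_eq_square field_simps)
      also have "\<dots> \<le> ?z * real s" using s1(1) by (intro mult_left_mono) auto
      finally have "exp (- (?z * real s)) \<le> exp (- (a * \<eta> / 256) * l)" by simp
      then have "(1 - ?z) ^ s \<le> exp (- (a * \<eta> / 256) * l)"
        using one_minus_power_le_exp[OF z, of s] by linarith
      then have "x2 \<le> exp (- (a * \<eta> / 256) * l) / \<delta>" unfolding x2_def using \<delta> by (intro divide_right_mono) auto
      moreover have "exp (- (a * \<eta> / 256) * l) / \<delta> \<le> \<epsilon> / 3" using elim(3) unfolding N_def[symmetric] pw by simp
      ultimately show "x2 \<le> \<epsilon> / 3" by linarith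
    qed
    have X3: "0 \<le> x3" "x3 \<le> \<epsilon> / 3"
    proof -
      define u where "u = c / (5 * real N)"
      have u: "0 \<le> u" "u \<le> 1" using N(1) by (auto simp: u_def c_def field_simps)
      let ?z = "a\<^sup>2 * (1 - exp (- c / (5 * real N)))"
      have ue: "exp (- c / (5 * real N)) = exp (- u)" by (simp add: u_def)
      have "a\<^sup>2 * (1 - exp (- u)) \<le> 1 * 1" using a u by (intro mult_mono) (auto simp: power_le_one)
      then have z: "?z \<le> 1" unfolding ue by simp
      then show "0 \<le> x3" by (simp add: x3_def)
      have "exp (- u) \<le> 1 / (1 + u)"
        using exp_ge_add_one_self[of u] u by (simp add: exp_minus field_simps)
      also have "\<dots> \<le> 1 - u / 2"
      proof -
        have "1 \<le> (1 - u / 2) * (1 + u)" using u by (simp add: algebra_simps mult_left_le_one_le)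
        then show ?thesis using u by (simp add: divide_le_eq)
      qed
      finally have eu: "u / 2 \<le> 1 - exp (- u)" by simp
      have "(a * c * \<eta> / 160) * l = a\<^sup>2 * (u / 2) * ((\<eta> / 8) * (real N * l) / (2 * a))"
        using a N0 by (simp add: power2_eq_square u_def field_simps)
      also have "\<dots> \<le> ?z * real s" unfolding ue
        using s1(1) s0 eu u by (intro mult_mono) auto
      finally have "exp (- (?z * real s)) \<le> exp (- (a * c * \<eta> / 160) * l)" by simp
      then have "(1 - ?z) ^ s \<le> exp (- (a * c * \<eta> / 160) * l)"
        using one_minus_power_le_exp[OF z, of s] by linarith
      then have "x3 \<le> 3 * exp (- (a * c * \<eta> / 160) * l)" unfolding x3_def by simp
      then show "x3 \<le> \<epsilon> / 3" using elim(4) unfolding N_def[symmetric] pw by linarith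
    qed
    have An: "A n \<subseteq> {..<N}" "card (A n) = n" using A by (auto simp: N_def)
    have "walk_dist a N (A n) (s + (s + t)) \<sigma> \<ge> (1 - \<epsilon>) / fact N" if \<sigma>: "\<sigma> permutes {..<N}" for \<sigma>
    proof -
      have le: "x1 \<le> 1" "x2 \<le> 1" using X1 X2 \<epsilon> by linarith+
      have "walk_dist a (2*n) (A n) (s + (s + t)) \<sigma> \<ge> (1 - x3) * (1 / fact (2*n) * (1 - x1) * (1 - x2))"
        unfolding x1_def x2_def x3_def c_def N_def
        by (rule walk_dist_ge[OF a An[unfolded N_def] N[unfolded N_def] \<delta> \<sigma>[unfolded N_def]
              le(1)[unfolded x1_def N_def] le(2)[unfolded x2_def N_def]])
      moreover have "(1 - x3) * (1 / fact (2*n) * (1 - x1) * (1 - x2)) = ((1 - x3) * ((1 - x1) * (1 - x2))) / fact (2*n)"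
        by simp
      moreover have "1 - \<epsilon> \<le> (1 - x3) * ((1 - x1) * (1 - x2))"
      proof -
        have a1: "1 - x1 - x2 \<le> (1 - x1) * (1 - x2)" using X1 X2 by (simp add: algebra_simps)
        have "1 - x3 - x1 - x2 \<le> (1 - x3) * (1 - x1 - x2)" using X1 X2 X3 by (simp add: algebra_simps)
        also have "\<dots> \<le> (1 - x3) * ((1 - x1) * (1 - x2))" using a1 X3 \<epsilon> by (intro mult_left_mono) auto
        finally show ?thesis using X1 X2 X3 by linarith
      qed
      ultimately show ?thesis unfolding N_def by (simp add: divide_right_mono order_trans[rotated])
    qed
    moreover have "real (s + (s + t)) \<le> (1 + 3 * \<eta> / 4) * (real N * l) / (2 * a) + 3"
    proof -
      have "(1 + 3 * \<eta> / 4) * (real N * l) / (2 * a)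
          = 2 * ((\<eta> / 8) * (real N * l) / (2 * a)) + (1 + \<eta> / 2) * (real N * l) / (2 * a)"
        using a by (simp add: field_simps)
      then show ?thesis using s1(2) t1(2) unfolding of_nat_add by linarith
    qed
    ultimately show ?case unfolding N_def l_def by blast
  qed
qed

lemma eventually_not_separated:
  fixes a \<epsilon> \<eta> :: real and A :: "nat \<Rightarrow> nat set"
  assumes a: "0 < a" "a \<le> 1" and \<epsilon>: "\<epsilon> < 1" and \<eta>: "0 < \<eta>" "\<eta> < 1"
    and A: "\<And>n. A n \<subseteq> {..<2*n} \<and> card (A n) = n"
  shows "\<forall>\<^sub>F n in sequentially. \<forall>t. real t \<le> (1 - \<eta>) * (real (2*n) * ln (real (2*n))) / (2 * a) \<longrightarrow>
    \<not> (\<forall>\<sigma>. \<sigma> permutes {..<2*n} \<longrightarrow> walk_dist a (2*n) (A n) t \<sigma> \<ge> (1 - \<epsilon>) / fact (2*n))"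
proof -
  \<comment> \<open>In \<open>2 * exp 2\<close>, the 2 comes from \<open>n = N / 2\<close> and
    \<open>exp 2\<close> from the quadratic term of the logarithm. Of the final summand 2, one unit
    offsets the \<open>- 1\<close> in the criterion and the other gives a strict inequality.\<close>
  define K where "K = 2 * exp 2 * (4 / (1 - \<epsilon>) + 2)"
  have K: "K > 0" using \<epsilon> by (simp add: K_def add_pos_pos)
  have "\<forall>\<^sub>F n in sequentially. real (2 * n) \<ge> 2"
    using filterlim_real_double unfolding filterlim_at_top by blast
  moreover have "\<forall>\<^sub>F n in sequentially. K * real (2 * n) powr (- \<eta>) \<le> 1"
    using \<eta> by (intro eventually_powr_small) auto
  ultimately show ?thesis
  proof eventually_elim
    case (elim n)
    define N where "N = 2 * n"
    have N: "real N \<ge> 2" "n > 0" using elim(1) by (auto simp: N_def)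
    have N0: "real N > 0" using N by simp
    define l where "l = ln (real N)"
    have l0: "l \<ge> 0" using N by (simp add: l_def)
    have lN: "l \<le> real N" using ln_le_minus_one[of "real N"] N by (simp add: l_def)
    define \<alpha> where "\<alpha> = a / real N"
    have \<alpha>: "0 \<le> \<alpha>" "\<alpha> \<le> 1 / 2" "\<alpha> * real N \<le> 1" using a N by (auto simp: \<alpha>_def field_simps)
    have An: "A n \<subseteq> {..<N}" "card (A n) = n" using A by (auto simp: N_def)
    show ?case
    proof (intro allI impI)
      fix t assume "real t \<le> (1 - \<eta>) * (real (2*n) * ln (real (2*n))) / (2 * a)"
      then have t: "real t \<le> (1 - \<eta>) * (real N * l) / (2 * a)" by (simp add: N_def l_def)
      then have "2 * \<alpha> * real t \<le> 2 * \<alpha> * ((1 - \<eta>) * (real N * l) / (2 * a))"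
        using \<alpha> by (intro mult_left_mono) auto
      also have "\<dots> = (1 - \<eta>) * l" using a N0 by (simp add: \<alpha>_def)
      finally have ta: "2 * \<alpha> * real t \<le> (1 - \<eta>) * l" .
      have lnb: "- \<alpha> - 2 * \<alpha>\<^sup>2 \<le> ln (1 - \<alpha>)" using \<alpha> by (intro ln_one_minus_pos_lower_bound) auto
      \<comment> \<open>The second-order correction costs only a constant in the exponent, because
        \<open>l \<le> real N\<close> and \<open>\<alpha> * real N \<le> 1\<close>.\<close>
      have "(1 - \<eta>) * l * (1 + 2 * \<alpha>) \<le> (1 - \<eta>) * l + 2"
      proof -
        have "(1 - \<eta>) * (l * \<alpha>) \<le> 1 * (real N * \<alpha>)"
          using lN l0 \<alpha> \<eta> by (intro mult_mono) auto
        then show ?thesis using \<alpha>(3) by (simp add: algebra_simps)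
      qed
      moreover have "2 * \<alpha> * real t * (1 + 2 * \<alpha>) \<le> (1 - \<eta>) * l * (1 + 2 * \<alpha>)"
        using ta \<alpha> by (intro mult_right_mono) auto
      ultimately have "- ((1 - \<eta>) * l + 2) \<le> real (2 * t) * (- \<alpha> - 2 * \<alpha>\<^sup>2)"
        by (simp add: algebra_simps power2_eq_square)
      also have "\<dots> \<le> real (2 * t) * ln (1 - \<alpha>)" using lnb by (intro mult_left_mono) auto
      finally have "exp (- ((1 - \<eta>) * l + 2)) \<le> exp (real (2 * t) * ln (1 - \<alpha>))" by simp
      also have "\<dots> = (1 - \<alpha>) ^ (2 * t)" using \<alpha> by (subst exp_of_nat_mult) simp
      finally have "real n * exp (- ((1 - \<eta>) * l + 2)) \<le> real n * (1 - \<alpha>) ^ (2 * t)"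
        by (rule mult_left_mono) simp
      moreover have "real n * exp (- ((1 - \<eta>) * l + 2)) = real N powr \<eta> / (2 * exp 2)"
      proof -
        have "exp (- ((1 - \<eta>) * l + 2)) = exp (\<eta> * l) * exp (- l) * exp (- 2)"
          by (simp add: exp_add[symmetric] algebra_simps)
        moreover have "exp (\<eta> * l) = real N powr \<eta>" using N0 by (simp add: powr_def l_def)
        moreover have "exp (- l) = 1 / real N" using N0 by (simp add: l_def exp_minus field_simps)
        moreover have "exp (- 2 :: real) = 1 / exp 2" by (simp add: exp_minus field_simps)
        ultimately show ?thesis using N by (simp add: N_def)
      qed
      moreover have "real N powr \<eta> \<ge> K"
        using elim(2) N0 unfolding N_def[symmetric] by (simp add: powr_minus field_simps)
      then have "real N powr \<eta> / (2 * exp 2) \<ge> 4 / (1 - \<epsilon>) + 2"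
        by (simp add: K_def field_simps)
      ultimately have "real n * (1 - \<alpha>) ^ (2 * t) - 1 > 4 / (1 - \<epsilon>)" by linarith
      then have "(1 - \<epsilon>) * (real n * (1 - a / real (2 * n)) ^ (2 * t) - 1) > 4"
        using \<epsilon> by (simp add: \<alpha>_def N_def pos_divide_less_eq mult.commute)
      then show "\<not> (\<forall>\<sigma>. \<sigma> permutes {..<2*n} \<longrightarrow> walk_dist a (2*n) (A n) t \<sigma> \<ge> (1 - \<epsilon>) / fact (2*n))"
        using walk_dist_not_separated[of a "A n" n \<epsilon> t] a An N \<epsilon> by (simp add: N_def)
    qed
  qed
qed

theorem mainTheorem1:
  fixes a \<epsilon> :: real and A :: "nat \<Rightarrow> nat set"
  assumes "0 < a" and "a \<le> 1"
    and "0 < \<epsilon>" and "\<epsilon> < 1"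
    and "\<And>n. A n \<subseteq> {..<2*n} \<and> card (A n) = n"
  shows "((\<lambda>n. 2 * a * real (sep_mixing_time a (2*n) (A n) \<epsilon>)
              / (real (2*n) * ln (real (2*n)))) \<longlonglongrightarrow> 1)"
proof -
  define S where "S n t \<longleftrightarrow> (\<forall>\<sigma>. \<sigma> permutes {..<2*n} \<longrightarrow> walk_dist a (2*n) (A n) t \<sigma> \<ge> (1 - \<epsilon>) / fact (2*n))" for n t
  define L where "L n = real (2*n) * ln (real (2*n))" for n
  have T: "sep_mixing_time a (2*n) (A n) \<epsilon> = (LEAST t. S n t)" for n
    unfolding sep_mixing_time_def S_def ..
  have Linf: "filterlim L at_top sequentially"
    unfolding L_def
    by (intro filterlim_at_top_mult_at_top filterlim_real_double filterlim_compose[OF ln_at_top filterlim_real_double])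
  have up: "\<forall>\<^sub>F n in sequentially. \<exists>T. S n T \<and> real T \<le> (1 + 3 * \<eta> / 4) * L n / (2 * a) + 3" if "\<eta> > 0" for \<eta>
    using eventually_separated[OF assms(1-4) that assms(5)] unfolding S_def L_def .
  have low: "\<forall>\<^sub>F n in sequentially. \<forall>t. real t \<le> (1 - \<eta>) * L n / (2 * a) \<longrightarrow> \<not> S n t" if "0 < \<eta>" "\<eta> < 1" for \<eta>
    using eventually_not_separated[OF assms(1,2,4) that assms(5)] unfolding S_def L_def .
  show ?thesis
    unfolding T L_def[symmetric]
  proof (rule order_tendstoI)
    fix y :: real assume y: "y < 1"
    define \<eta> where "\<eta> = min (1 / 2) (1 - y)"
    have \<eta>: "0 < \<eta>" "\<eta> < 1" "y \<le> 1 - \<eta>" using y by (auto simp: \<eta>_def)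
    have "\<forall>\<^sub>F n in sequentially. L n > 0" using Linf unfolding filterlim_at_top_dense by blast
    \<comment> \<open>The upper bound is used here too: the value of \<open>LEAST\<close> is a
      separated time only if some separated time exists. The lower bound then applies, as it
      excludes every time up to the threshold.\<close>
    with low[OF \<eta>(1,2)] up[OF \<eta>(1)]
    show "\<forall>\<^sub>F n in sequentially. y < 2 * a * real (LEAST t. S n t) / L n"
    proof eventually_elim
      case (elim n)
      then have "S n (LEAST t. S n t)" by (metis LeastI)
      then have "real (LEAST t. S n t) > (1 - \<eta>) * L n / (2 * a)" using elim(1) not_le by blast
      then have "1 - \<eta> < 2 * a * real (LEAST t. S n t) / L n"
        using elim(3) assms(1) by (simp add: field_simps)
      then show ?case using \<eta>(3) by linarith
    qed
  next
    fix y :: real assume y: "1 < y"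
    define \<eta> where "\<eta> = y - 1"
    have \<eta>: "0 < \<eta>" using y by (simp add: \<eta>_def)
    \<comment> \<open>Three rounded steps contribute \<open>6 * a\<close> after scaling; this keeps
      them below \<open>\<eta> / 4 * L n\<close>, the share of \<open>\<eta>\<close> that the phases
      leave free.\<close>
    have "\<forall>\<^sub>F n in sequentially. L n > 24 * a / \<eta>" using Linf unfolding filterlim_at_top_dense by blast
    with up[OF \<eta>]
    show "\<forall>\<^sub>F n in sequentially. 2 * a * real (LEAST t. S n t) / L n < y"
    proof eventually_elim
      case (elim n)
      then obtain T where T: "S n T" "real T \<le> (1 + 3 * \<eta> / 4) * L n / (2 * a) + 3" by blast
      have L0: "L n > 0" using elim(2) \<eta> assms(1) by (meson divide_pos_pos less_trans mult_pos_pos zero_less_numeral)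
      have "real (LEAST t. S n t) \<le> (1 + 3 * \<eta> / 4) * L n / (2 * a) + 3"
        using T Least_le[of "S n" T] by linarith
      then have "2 * a * real (LEAST t. S n t) \<le> 2 * a * ((1 + 3 * \<eta> / 4) * L n / (2 * a) + 3)"
        using assms(1) by (intro mult_left_mono) auto
      also have "\<dots> = (1 + 3 * \<eta> / 4) * L n + 6 * a" using assms(1) by (simp add: field_simps)
      also have "\<dots> < (1 + \<eta>) * L n"
      proof -
        have "24 * a < \<eta> * L n" using elim(2) \<eta> by (simp add: field_simps)
        then show ?thesis by (simp add: algebra_simps)
      qed
      finally show ?case using L0 by (simp add: \<eta>_def pos_divide_less_eq)
    qed
  qed
qed

end
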